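(* Let $\{(\theta_j,g_j)\}\subset\mathcal Y_C$ be a sequence of minimizers of $G^C_{\varepsilon_j}$ for $\varepsilon_j\to0$ ($\varepsilon_j>0$). Then there are sequences of numbers $\{a_j\}\subset\{\pm1\}$ and $\{c_j\}\subset(-l,l)$ such that $(\hat\theta_j,\hat g_j)\to(\theta,g)$ in $L^1(I)\times L^2(I)$, where $$\hat\theta_j(x)=a_j\theta_j(x+c_j),\qquad \hat g_j(x)=a_jg_j(x+c_j),$$ $$\theta=\beta\chi_J-\beta(1-\chi_J),\qquad J=(-l/2,l/2).$$ Furthermore, $G^C_0(\theta,g)=2\Phi(\beta)$.
   Context: Fix constants $\sigma>0$, $D_1>0$, $D_2>0$, $l>0$ and let $I=(-l,l)$. Let $$W(\theta)=8D_2\sin^8\tfrac\theta2+4(1+\sigma)\sin^4\tfrac\theta2-4\sigma\sin^2\tfrac\theta2+a_0,$$ where the constant $a_0$ is chosen so that $\min W=0$. On $[-\pi,\pi]$, $W$ has exactly two zeros $\pm\beta$, with $0<\beta<\pi/2$. Let $\Phi(s)=2\int_{-\beta}^s\sqrt{W(t)}\,dt$. For $\varepsilon>0$ let $$F^C_\varepsilon(\theta,g)=\int_I\Big[D_1\varepsilon(g''+\cos\theta\,\theta')^2+\frac{D_2}{2\varepsilon}(g'+\sin\theta)^4+\frac1\varepsilon(g'+\sin\theta)^2+\frac{4D_2}{\varepsilon}(g'+\sin\theta)^2\sin^4\tfrac\theta2+\varepsilon\theta'^2+\frac1\varepsilon W(\theta)\Big]dx .$$ Let $$\mathcal Y_C=\{(\theta,g)\in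 W^{1,2}(I)\times W^{2,2}(I):\ \theta(-l)=\theta(l),\ g(-l)=g(l),\ g'(-l)=g'(l)\},$$ $$\mathcal A_C=\Big\{(\theta,g)\in BV(I)\times W^{1,2}(I):\ g'\in BV(I),\ g'+\sin\theta=0\text{ a.e.},\ \int_I\theta=0\Big\}.$$ Define $G^C_\varepsilon(\theta,g)=F^C_\varepsilon(\theta,g)$ if $(\theta,g)\in\mathcal Y_C$ and $+\infty$ otherwise; and $$G^C_0(\theta,g)=\int_I|(\Phi\circ\theta)'|+|\Phi(\tilde\theta(l))-\Phi(\tilde\theta(-l))|$$ if $(\theta,g)\in\mathcal A_C$ and $+\infty$ otherwise, where $\int_I|(\Phi\circ\theta)'|$ is the total variation of $\Phi\circ\theta$ on $I$ and $\tilde\theta(\pm l)$ are the (one-sided, from inside $I$) traces of $\theta$ at $\pm l$. In the translations $\theta_j(x+c_j)$, $g_j(x+c_j)$ the functions are understood as extended $2l$-periodically. The function $g$ is the second component of the limit pair.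
   Formalization: As θ→θ+2πk and g→g+b preserve minimizers, the claim is proved for θ_j shifted by a multiple of 2π to have mean in [-π,π] and g_j shifted to mean 0, and for (θ_j,g_j) themselves if eventually |mean θ_j|≤π and |mean g_j| converges (also necessary). *)

theory Defs
  imports "HOL-Analysis.Analysis"
begin

text \<open>
  Elements of the function spaces are represented by functions \<open>real \<Rightarrow> real\<close>, of which only the
  Lebesgue equivalence class on the open set \<open>S\<close> matters; no continuous representative is
  presupposed.
\<close>

definition in_Lp :: "nat \<Rightarrow> real set \<Rightarrow> (real \<Rightarrow> real) \<Rightarrow> bool" where
  "in_Lp p S f \<longleftrightarrow>
     f \<in> borel_measurable (lebesgue_on S) \<and> integrable (lebesgue_on S) (\<lambda>x. \<bar>f x\<bar> ^ p)"

definition tendsto_Lp ::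
  "nat \<Rightarrow> real set \<Rightarrow> (nat \<Rightarrow> real \<Rightarrow> real) \<Rightarrow> (real \<Rightarrow> real) \<Rightarrow> bool" where
  "tendsto_Lp p S f h \<longleftrightarrow>
     (\<forall>j. in_Lp p S (f j)) \<and> in_Lp p S h \<and>
     (\<lambda>j. LINT x|lebesgue_on S. \<bar>f j x - h x\<bar> ^ p) \<longlonglongrightarrow> 0"

definition C1_compact_support :: "real set \<Rightarrow> (real \<Rightarrow> real) set" where
  "C1_compact_support S =
     {\<phi>. \<phi> C1_differentiable_on UNIV \<and> (\<exists>K. compact K \<and> K \<subseteq> S \<and> (\<forall>x. x \<notin> K \<longrightarrow> \<phi> x = 0))}"

definition locally_integrable :: "real set \<Rightarrow> (real \<Rightarrow> real) \<Rightarrow> bool" where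
  "locally_integrable S f \<longleftrightarrow> (\<forall>K. compact K \<and> K \<subseteq> S \<longrightarrow> integrable (lebesgue_on K) f)"

definition has_weak_deriv :: "real set \<Rightarrow> (real \<Rightarrow> real) \<Rightarrow> (real \<Rightarrow> real) \<Rightarrow> bool" where
  "has_weak_deriv S f h \<longleftrightarrow>
     locally_integrable S f \<and> locally_integrable S h \<and>
     (\<forall>\<phi>\<in>C1_compact_support S.
        (LINT x|lebesgue_on S. f x * deriv \<phi> x) = - (LINT x|lebesgue_on S. h x * \<phi> x))"

text \<open>A weak derivative is unique up to null sets; an arbitrary representative is chosen.\<close>

definition weak_deriv :: "real set \<Rightarrow> (real \<Rightarrow> real) \<Rightarrow> real \<Rightarrow> real" where
  "weak_deriv S f = (SOME h. has_weak_deriv S f h)"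

definition in_W12 :: "real set \<Rightarrow> (real \<Rightarrow> real) \<Rightarrow> bool" where
  "in_W12 S f \<longleftrightarrow> in_Lp 2 S f \<and> (\<exists>h. has_weak_deriv S f h \<and> in_Lp 2 S h)"

definition in_W22 :: "real set \<Rightarrow> (real \<Rightarrow> real) \<Rightarrow> bool" where
  "in_W22 S f \<longleftrightarrow> in_W12 S f \<and> in_W12 S (weak_deriv S f)"

definition total_variation :: "real set \<Rightarrow> (real \<Rightarrow> real) \<Rightarrow> ereal" where
  "total_variation S f =
     (SUP \<phi>\<in>{\<phi>\<in>C1_compact_support S. \<forall>x. \<bar>\<phi> x\<bar> \<le> 1}.
        ereal (LINT x|lebesgue_on S. f x * deriv \<phi> x))"

definition in_BV :: "real set \<Rightarrow> (real \<Rightarrow> real) \<Rightarrow> bool" where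
  "in_BV S f \<longleftrightarrow> in_Lp 1 S f \<and> total_variation S f < \<infinity>"

text \<open>
  The one-sided trace, from inside \<open>S\<close>, at an endpoint \<open>z\<close> of an interval \<open>S\<close>. For functions in
  \<open>W\<^sup>1\<^sup>,\<^sup>2\<close> it is the endpoint value of the representative continuous on the closed interval.
\<close>

definition has_trace :: "real set \<Rightarrow> (real \<Rightarrow> real) \<Rightarrow> real \<Rightarrow> real \<Rightarrow> bool" where
  "has_trace S f z t \<longleftrightarrow>
     ((\<lambda>r. (LINT x|lebesgue_on (ball z r \<inter> S). \<bar>f x - t\<bar>) / r) \<longlongrightarrow> 0) (at_right 0)"

definition bdry_trace :: "real set \<Rightarrow> (real \<Rightarrow> real) \<Rightarrow> real \<Rightarrow> real" where
  "bdry_trace S f z = (THE t. has_trace S f z t)"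

definition periodic_ext :: "real \<Rightarrow> (real \<Rightarrow> real) \<Rightarrow> real \<Rightarrow> real" where
  "periodic_ext l f x = f (x - 2 * l * of_int \<lfloor>(x + l) / (2 * l)\<rfloor>)"

definition mean :: "real \<Rightarrow> (real \<Rightarrow> real) \<Rightarrow> real" where
  "mean l f = (LINT x|lebesgue_on {-l<..<l}. f x) / (2 * l)"

definition W :: "real \<Rightarrow> real \<Rightarrow> real \<Rightarrow> real \<Rightarrow> real" where
  "W \<sigma> D2 a0 \<theta> =
     8 * D2 * sin (\<theta> / 2) ^ 8 + 4 * (1 + \<sigma>) * sin (\<theta> / 2) ^ 4 - 4 * \<sigma> * sin (\<theta> / 2) ^ 2 + a0"

text \<open>The integral is oriented: it is negative for \<open>s < - \<beta>\<close>.\<close>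

definition \<Phi> :: "real \<Rightarrow> real \<Rightarrow> real \<Rightarrow> real \<Rightarrow> real \<Rightarrow> real" where
  "\<Phi> \<sigma> D2 a0 \<beta> s = 2 * (LBINT t=ereal (- \<beta>)..ereal s. sqrt (W \<sigma> D2 a0 t))"

definition F_C ::
  "real \<Rightarrow> real \<Rightarrow> real \<Rightarrow> real \<Rightarrow> real \<Rightarrow> real \<Rightarrow> (real \<Rightarrow> real) \<Rightarrow> (real \<Rightarrow> real) \<Rightarrow> real" where
  "F_C \<sigma> D1 D2 a0 l \<epsilon> \<theta> g =
     (let I = {-l<..<l}; \<theta>' = weak_deriv I \<theta>; g' = weak_deriv I g; g'' = weak_deriv I g' in
      LINT x|lebesgue_on I.
          D1 * \<epsilon> * (g'' x + cos (\<theta> x) * \<theta>' x) ^ 2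
        + D2 / (2 * \<epsilon>) * (g' x + sin (\<theta> x)) ^ 4
        + 1 / \<epsilon> * (g' x + sin (\<theta> x)) ^ 2
        + 4 * D2 / \<epsilon> * (g' x + sin (\<theta> x)) ^ 2 * sin (\<theta> x / 2) ^ 4
        + \<epsilon> * \<theta>' x ^ 2
        + 1 / \<epsilon> * W \<sigma> D2 a0 (\<theta> x))"

definition Y_C :: "real \<Rightarrow> ((real \<Rightarrow> real) \<times> (real \<Rightarrow> real)) set" where
  "Y_C l =
     (let I = {-l<..<l} in
      {(\<theta>, g). in_W12 I \<theta> \<and> in_W22 I g \<and>
         bdry_trace I \<theta> (-l) = bdry_trace I \<theta> l \<and>
         bdry_trace I g (-l) = bdry_trace I g l \<and>
         bdry_trace I (weak_deriv I g) (-l) = bdry_trace I (weak_deriv I g) l})"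

definition A_C :: "real \<Rightarrow> ((real \<Rightarrow> real) \<times> (real \<Rightarrow> real)) set" where
  "A_C l =
     (let I = {-l<..<l} in
      {(\<theta>, g). in_BV I \<theta> \<and> in_W12 I g \<and> in_BV I (weak_deriv I g) \<and>
         (AE x in lebesgue_on I. weak_deriv I g x + sin (\<theta> x) = 0) \<and>
         (LINT x|lebesgue_on I. \<theta> x) = 0})"

definition G_C ::
  "real \<Rightarrow> real \<Rightarrow> real \<Rightarrow> real \<Rightarrow> real \<Rightarrow> real \<Rightarrow> (real \<Rightarrow> real) \<times> (real \<Rightarrow> real) \<Rightarrow> ereal" where
  "G_C \<sigma> D1 D2 a0 l \<epsilon> = (\<lambda>(\<theta>, g).
     if (\<theta>, g) \<in> Y_C l then ereal (F_C \<sigma> D1 D2 a0 l \<epsilon> \<theta> g) else \<infinity>)"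

definition G_C0 ::
  "real \<Rightarrow> real \<Rightarrow> real \<Rightarrow> real \<Rightarrow> real \<Rightarrow> (real \<Rightarrow> real) \<times> (real \<Rightarrow> real) \<Rightarrow> ereal" where
  "G_C0 \<sigma> D2 a0 \<beta> l = (\<lambda>(\<theta>, g).
     let I = {-l<..<l}; P = \<Phi> \<sigma> D2 a0 \<beta> in
     if (\<theta>, g) \<in> A_C l
     then total_variation I (\<lambda>x. P (\<theta> x)) + ereal \<bar>P (bdry_trace I \<theta> l) - P (bdry_trace I \<theta> (-l))\<bar>
     else \<infinity>)"

definition is_minimizer :: "('a \<Rightarrow> ereal) \<Rightarrow> 'a \<Rightarrow> bool" where
  "is_minimizer G u \<longleftrightarrow> (\<forall>v. G u \<le> G v)"

text \<open>
  The energy is invariant under \<open>\<theta> \<mapsto> \<theta> + 2\<pi>k\<close> for an integer \<open>k\<close> and under \<open>g \<mapsto> g + b\<close> for a real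
  \<open>b\<close>, and so is the class \<open>Y_C\<close>. Hence minimizers can converge only for suitable representatives
  modulo these shifts. The following representatives have the mean of \<open>\<theta>\<close> in \<open>[-\<pi>, \<pi>]\<close> and
  the mean of \<open>g\<close> equal to zero.
\<close>

definition angle_rep :: "real \<Rightarrow> (real \<Rightarrow> real) \<Rightarrow> real \<Rightarrow> real" where
  "angle_rep l \<theta> x = \<theta> x - 2 * pi * of_int (round (mean l \<theta> / (2 * pi)))"

definition mean_zero_rep :: "real \<Rightarrow> (real \<Rightarrow> real) \<Rightarrow> real \<Rightarrow> real" where
  "mean_zero_rep l g x = g x - mean l g"

text \<open>
  Convergence, after reflections and translations, to the profile which equals \<open>\<beta>\<close> on \<open>J\<close> and
  \<open>- \<beta>\<close> off \<open>J\<close>, together with the value of the limit energy.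
\<close>

definition converges_to_profile ::
  "real \<Rightarrow> real \<Rightarrow> real \<Rightarrow> real \<Rightarrow> real \<Rightarrow> (nat \<Rightarrow> real \<Rightarrow> real) \<Rightarrow> (nat \<Rightarrow> real \<Rightarrow> real) \<Rightarrow> bool" where
  "converges_to_profile \<sigma> D2 a0 \<beta> l \<theta>s gs \<longleftrightarrow>
     (let I = {-l<..<l}; J = {-l/2<..<l/2};
          \<theta> = (\<lambda>x. \<beta> * indicator J x - \<beta> * (1 - indicator J x)) in
      \<exists>(a :: nat \<Rightarrow> real) (c :: nat \<Rightarrow> real) (g :: real \<Rightarrow> real).
        (\<forall>j. a j \<in> {-1, 1}) \<and> (\<forall>j. c j \<in> I) \<and>
        tendsto_Lp 1 I (\<lambda>j x. a j * periodic_ext l (\<theta>s j) (x + c j)) \<theta> \<and>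
        tendsto_Lp 2 I (\<lambda>j x. a j * periodic_ext l (gs j) (x + c j)) g \<and>
        G_C0 \<sigma> D2 a0 \<beta> l (\<theta>, g) = ereal (2 * \<Phi> \<sigma> D2 a0 \<beta> \<beta>))"

end

theory Submission
  imports Defs
begin

text \<open>
  In one dimension a Sobolev function is an absolutely continuous function with square
  integrable derivative, so \<open>\<epsilon> \<theta>'\<^sup>2 + W(\<theta>)/\<epsilon>\<close> dominates the variation of \<open>\<Phi> \<circ> \<theta>\<close> along the circle.
  Antiperiodic transition layers with \<open>g' = - sin \<theta>\<close> show that minimizers have energy at most
  \<open>2 \<Phi>(\<beta>) + o(1)\<close>.  Since going from \<open>\<beta>\<close> to \<open>2\<pi> - \<beta>\<close> costs more than \<open>\<Phi>(\<beta>)\<close>, a minimizer stays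
  near the wells \<open>2\<pi>k \<plusminus> \<beta>\<close> of a single period off a small set, and since four transitions cost
  about \<open>4 \<Phi>(\<beta>)\<close>, the sets where it is near \<open>2\<pi>k + \<beta>\<close> and near \<open>2\<pi>k - \<beta>\<close> are nearly two arcs.
  As \<open>g\<close> is periodic, the integral of \<open>sin \<theta>\<close> is nearly zero, so both arcs have length nearly \<open>l\<close>.
\<close>


subsection \<open>The fundamental lemma of the calculus of variations\<close>

text \<open>No subsequence is extracted. For each tolerance \<open>\<rho>\<close> explicit constants
  are found such that energy at most \<open>2 * P \<beta> + \<delta>\<close> together with small
  \<open>\<epsilon>\<close> forces closeness to a step. The excess \<open>\<delta>\<close> is fixed
  before \<open>\<rho>\<close>; the accuracy comes from \<open>\<epsilon>\<close> alone, because the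
  integrals of \<open>W\<close> and of \<open>(g' + sin \<theta>)^2\<close> are at most
  \<open>\<epsilon>\<close> times the energy. The obstacle is the symmetry group: periods of
  \<open>\<theta>\<close>, constants in \<open>g\<close>, translations, and the reflection to
  \<open>(- \<theta>, - g)\<close>. The reflection is tied to the translations, since a shift of the
  limit profile by \<open>l\<close>, half its period, also changes its sign. Hence the signs
  \<open>a j\<close> may be prescribed and the translations adapted to them. For minimizers that are
  not normalized, \<open>a j\<close> is the sign of the mean of \<open>g j\<close>, so that the
  reflected means converge as soon as their absolute values do. Weak derivatives and traces are
  given by choice operators, so everything is first transferred to continuous representatives.
  Absolute continuity is used in the form of indefinite integrals, and the chain rule is proved
  without differentiation almost everywhere.\<close>

lemma integrable_lebesgue_on_iff:
  fixes f :: "'a::euclidean_space \<Rightarrow> 'b::euclidean_space"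
  assumes "S \<in> sets lebesgue"
  shows "integrable (lebesgue_on S) f \<longleftrightarrow> f absolutely_integrable_on S"
  using assms by (simp add: integrable_restrict_space set_integrable_def)

lemma LINT_lebesgue_on:
  fixes f :: "'a::euclidean_space \<Rightarrow> 'b::euclidean_space"
  assumes "S \<in> sets lebesgue" "f absolutely_integrable_on S"
  shows "(LINT x|lebesgue_on S. f x) = integral S f"
  using assms by (simp add: integrable_lebesgue_on_iff lebesgue_integral_eq_integral)

lemma AE_lebesgue_on_iff:
  assumes "S \<in> sets lebesgue"
  shows "(AE x in lebesgue_on S. P x) \<longleftrightarrow> negligible {x \<in> S. \<not> P x}"
proof -
  have "(AE x in lebesgue_on S. P x) \<longleftrightarrow> (AE x in lebesgue. x \<in> S \<longrightarrow> P x)"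
    using assms by (simp add: AE_restrict_space_iff)
  also have "\<dots> \<longleftrightarrow> (AE x in lebesgue. x \<notin> {x \<in> S. \<not> P x})"
    by (rule arg_cong[where f="\<lambda>p. AE x in lebesgue. p x"]) auto
  also have "\<dots> \<longleftrightarrow> negligible {x \<in> S. \<not> P x}"
    by (simp add: completion.AE_iff_null_sets negligible_iff_null_sets)
  finally show ?thesis .
qed

lemma C1_differentiable_onI:
  fixes f :: "real \<Rightarrow> real"
  assumes "\<And>x. (f has_real_derivative f' x) (at x)" "continuous_on UNIV f'"
  shows "f C1_differentiable_on UNIV"
  unfolding C1_differentiable_on_def using assms has_real_derivative_iff_has_vector_derivative by auto

lemma C1_has_deriv:
  fixes f :: "real \<Rightarrow> real"
  assumes "f C1_differentiable_on UNIV"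
  shows "(f has_real_derivative deriv f x) (at x)" "continuous_on UNIV (deriv f)"
proof -
  obtain D where D: "\<And>x. (f has_real_derivative D x) (at x)" "continuous_on UNIV D"
    using assms unfolding C1_differentiable_on_def has_real_derivative_iff_has_vector_derivative by auto
  then have "deriv f = D" by (auto intro: DERIV_imp_deriv)
  with D show "(f has_real_derivative deriv f x) (at x)" "continuous_on UNIV (deriv f)" by auto
qed

lemma compact_subset_Ioo:
  fixes a b :: real
  assumes "compact K" "K \<subseteq> {a<..<b}" "a < b"
  obtains c d where "a < c" "c < d" "d < b" "K \<subseteq> {c<..<d}"
proof (cases "K = {}")
  case True
  then show ?thesis using that[of "(2*a+b)/3" "(a+2*b)/3"] assms by auto
next
  case False
  then obtain x y where "x \<in> K" "\<forall>z\<in>K. x \<le> z" "y \<in> K" "\<forall>z\<in>K. z \<le> y"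
    using compact_attains_inf[OF assms(1)] compact_attains_sup[OF assms(1)] by metis
  then show ?thesis using that[of "(a+x)/2" "(y+b)/2"] assms by force
qed

lemma C1_compact_supportE:
  assumes "\<phi> \<in> C1_compact_support {a<..<b}" "a < b"
  obtains c d where "a < c" "c < d" "d < b" "\<And>x. x \<notin> {c<..<d} \<Longrightarrow> \<phi> x = 0"
    "\<And>x. x \<notin> {c<..<d} \<Longrightarrow> deriv \<phi> x = 0"
proof -
  obtain K where K: "\<phi> C1_differentiable_on UNIV" "compact K" "K \<subseteq> {a<..<b}" "\<And>x. x \<notin> K \<Longrightarrow> \<phi> x = 0"
    using assms(1) unfolding C1_compact_support_def by auto
  obtain c d where cd: "a < c" "c < d" "d < b" "K \<subseteq> {c<..<d}"
    using compact_subset_Ioo[OF K(2,3) assms(2)] .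
  show ?thesis
  proof (rule that[OF cd(1-3)])
    fix x assume x: "x \<notin> {c<..<d}"
    have "x \<notin> K" using x cd(4) by blast
    then show "\<phi> x = 0" by (rule K(4))
    have "x \<in> - K" "open (- K)" using x cd K by (auto simp: compact_imp_closed)
    then have "\<forall>\<^sub>F y in nhds x. \<phi> y = 0"
      unfolding eventually_nhds using K(4) by (intro exI[of _ "- K"]) blast
    then have "(\<phi> has_real_derivative 0) (at x)"
      using DERIV_cong_ev[of x x \<phi> "\<lambda>_. 0" 0 0] by simp
    then show "deriv \<phi> x = 0" by (rule DERIV_imp_deriv)
  qed
qed

lemma C1_compact_supportI:
  assumes "\<And>x. (\<phi> has_real_derivative \<phi>' x) (at x)" "continuous_on UNIV \<phi>'"
    and "a < c" "d < b" "\<And>x. x \<notin> {c..d} \<Longrightarrow> \<phi> x = 0"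
  shows "\<phi> \<in> C1_compact_support {a<..<b}"
  unfolding C1_compact_support_def
  using assms C1_differentiable_onI by (auto intro!: exI[of _ "{c..d}"])

lemma DERIV_max0_power2:
  "((\<lambda>t::real. (max 0 t)\<^sup>2) has_real_derivative 2 * max 0 t) (at t)"
proof -
  consider "t < 0" | "t = 0" | "t > 0" by linarith
  then show ?thesis
  proof cases
    case 1
    have "((\<lambda>t::real. 0) has_real_derivative 0) (at t)" by simp
    then have "((\<lambda>t::real. (max 0 t)\<^sup>2) has_real_derivative 0) (at t)"
      by (rule has_field_derivative_transform_within_open[where S="{..<0}"]) (use 1 in auto)
    then show ?thesis using 1 by simp
  next
    case 3
    have "((\<lambda>t::real. t^2) has_real_derivative 2 * t) (at t)" by (auto intro!: derivative_eq_intros)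
    then have "((\<lambda>t::real. (max 0 t)\<^sup>2) has_real_derivative 2 * t) (at t)"
      by (rule has_field_derivative_transform_within_open[where S="{0<..}"]) (use 3 in auto)
    then show ?thesis using 3 by simp
  next
    case 2
    have "((\<lambda>h. ((max 0 (0 + h))\<^sup>2 - (max 0 (0::real))\<^sup>2) / h) \<longlongrightarrow> 0) (at 0)"
    proof (rule Lim_null_comparison[where g="\<lambda>h. \<bar>h\<bar>"])
      show "\<forall>\<^sub>F h::real in at 0. norm (((max 0 (0 + h))\<^sup>2 - (max 0 0)\<^sup>2) / h) \<le> \<bar>h\<bar>"
        by (intro always_eventually allI) (auto simp: max_def power2_eq_square)
      show "((\<lambda>h::real. \<bar>h\<bar>) \<longlongrightarrow> 0) (at 0)" by (rule tendsto_eq_intros | simp)+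
    qed
    then show ?thesis using 2 by (simp add: DERIV_def)
  qed
qed

lemma DERIV_max0_power2_comp [derivative_intros]:
  assumes "(h has_real_derivative h') (at x within S)"
  shows "((\<lambda>x. (max 0 (h x))\<^sup>2) has_real_derivative 2 * max 0 (h x) * h') (at x within S)"
  using DERIV_chain2[OF DERIV_max0_power2 assms] .

text \<open>Test functions are only required to be C1, so squares of positive parts serve as cutoffs
  in place of smooth mollifiers. This one has its maximum 1 at 0 and vanishes off the unit
  interval.\<close>

definition bump :: "real \<Rightarrow> real" where "bump x = (max 0 (1 - x\<^sup>2))\<^sup>2"

lemma DERIV_bump [derivative_intros]:
  assumes "(h has_real_derivative h') (at x within S)"
  shows "((\<lambda>x. bump (h x)) has_real_derivative - 4 * h x * max 0 (1 - (h x)\<^sup>2) * h') (at x within S)"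
  unfolding bump_def by (rule derivative_eq_intros assms refl | simp)+

lemma bump_bounds: "0 \<le> bump x" "bump x \<le> 1"
  by (auto simp: bump_def max_def power_le_one)

lemma bump_0 [simp]: "bump 0 = 1" by (simp add: bump_def)

lemma bump_eq_0: "1 \<le> \<bar>x\<bar> \<Longrightarrow> bump x = 0"
  using one_le_power[of "\<bar>x\<bar>" 2] by (simp add: bump_def)

lemma locally_integrableD:
  assumes "locally_integrable S u" "{c..d} \<subseteq> S"
  shows "u absolutely_integrable_on {c..d}"
  using assms integrable_lebesgue_on_iff[of "{c..d}" u] unfolding locally_integrable_def by auto

text \<open>On the open interval \<open>u\<close> is only locally integrable. The compact support of
  \<open>\<psi>\<close> moves every integral to a closed subinterval, where the gauge integral
  calculus applies.\<close>

lemma integrable_times_C1: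
  assumes "a < b" "locally_integrable {a<..<b} u" "continuous_on UNIV \<psi>"
    and "a < c" "d < b" "\<And>x. x \<notin> {c..d} \<Longrightarrow> \<psi> x = 0"
  shows "(\<lambda>x. u x * \<psi> x) absolutely_integrable_on {c..d}"
    "(\<lambda>x. u x * \<psi> x) absolutely_integrable_on {a<..<b}"
    "(LINT x|lebesgue_on {a<..<b}. u x * \<psi> x) = integral {c..d} (\<lambda>x. u x * \<psi> x)"
proof -
  have cd: "{c..d} \<subseteq> {a<..<b}" using assms by auto
  have u: "u absolutely_integrable_on {c..d}"
    using locally_integrableD assms(2) cd .
  have "bounded (\<psi> ` {c..d})"
    by (intro compact_imp_bounded compact_continuous_image continuous_on_subset[OF assms(3)]) auto
  moreover have "\<psi> \<in> borel_measurable (lebesgue_on {c..d})"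
    by (rule continuous_imp_measurable_on_sets_lebesgue[OF continuous_on_subset[OF assms(3)]]) auto
  ultimately show 1: "(\<lambda>x. u x * \<psi> x) absolutely_integrable_on {c..d}"
    using absolutely_integrable_bounded_measurable_product_real[of \<psi> "{c..d}" u] u
    by (simp add: mult.commute)
  have eq: "(\<lambda>x. u x * \<psi> x) = (\<lambda>x. if x \<in> {c..d} then u x * \<psi> x else 0)"
    using assms(6) by fastforce
  have e2: "{x \<in> {c..d} - {a<..<b}. u x * \<psi> x \<noteq> 0} = {}"
    "{x \<in> {a<..<b} - {c..d}. u x * \<psi> x \<noteq> 0} = {}"
    using cd assms(6) by auto
  show "(\<lambda>x. u x * \<psi> x) absolutely_integrable_on {a<..<b}"
    by (rule absolutely_integrable_spike_set[OF 1]) (simp_all only: e2 negligible_empty)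
  show "(LINT x|lebesgue_on {a<..<b}. u x * \<psi> x) = integral {c..d} (\<lambda>x. u x * \<psi> x)"
    using integral_restrict[of "{c..d}" "{a<..<b}" "\<lambda>x. u x * \<psi> x"] cd 1 LINT_lebesgue_on[of "{c..d}"]
    by (subst eq) simp
qed

text \<open>Lebesgue differentiation: at almost every point \<open>u\<close> is the limit of its
  averages over \<open>{x..x+h}\<close>, and all these averages vanish.\<close>

lemma Lebesgue_zero:
  assumes "a < b" "locally_integrable {a<..<b} u"
    and zero: "\<And>c d. a < c \<Longrightarrow> c < d \<Longrightarrow> d < b \<Longrightarrow> integral {c..d} u = 0"
  shows "AE x in lebesgue_on {a<..<b}. u x = 0"
proof -
  have *: "negligible {x \<in> {c<..<d}. u x \<noteq> 0}" if cd: "a < c" "c < d" "d < b" for c d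
  proof -
    define v where "v x = (if x \<in> {c..d} then u x else 0)" for x
    have u: "u absolutely_integrable_on {c..d}"
      by (rule locally_integrableD[OF assms(2)]) (use cd in auto)
    then have "v absolutely_integrable_on UNIV"
      unfolding v_def using absolutely_integrable_restrict_UNIV by blast
    then have "v integrable_on cbox x y" for x y
      using set_lebesgue_integral_eq_integral(1) integrable_on_subcbox by blast
    then obtain N where N: "negligible N"
      "\<And>x e. \<lbrakk>x \<notin> N; 0 < e\<rbrakk> \<Longrightarrow> \<exists>\<delta>>0. \<forall>h. 0 < h \<and> h < \<delta> \<longrightarrow>
          norm (integral (cbox x (x + h *\<^sub>R One)) v /\<^sub>R h ^ DIM(real) - v x) < e"
      using integrable_ccontinuous_explicit[of v] by metis
    have "u x = 0" if x: "x \<in> {c<..<d}" "x \<notin> N" for x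
    proof (rule ccontr)
      assume "u x \<noteq> 0"
      then obtain \<delta> where \<delta>: "\<delta> > 0" "\<forall>h. 0 < h \<and> h < \<delta> \<longrightarrow>
          norm (integral (cbox x (x + h *\<^sub>R One)) v /\<^sub>R h ^ DIM(real) - v x) < \<bar>u x\<bar>"
        using N(2)[of x "\<bar>u x\<bar>"] x by auto
      define h where "h = min (\<delta>/2) (d - x)"
      have h: "0 < h" "h < \<delta>" "x + h \<le> d" using \<delta> x by (auto simp: h_def)
      have "integral {x..x+h} v = integral {x..x+h} u"
        by (rule integral_cong) (use h x in \<open>auto simp: v_def\<close>)
      also have "\<dots> = 0" using zero[of x "x+h"] h x cd by auto
      finally have "\<bar>v x\<bar> < \<bar>u x\<bar>" using \<delta>(2)[rule_format, of h] h by simp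
      then show False using x by (simp add: v_def)
    qed
    then show ?thesis by (intro negligible_subset[OF N(1)]) blast
  qed
  \<comment> \<open>An exhaustion of \<open>{a<..<b}\<close> from inside; an offset above 2 makes
    the interval nondegenerate already for \<open>n = 0\<close>.\<close>
  define c where "c n = a + (b - a) / (real n + 3)" for n
  define d where "d n = b - (b - a) / (real n + 3)" for n
  have cd: "a < c n" "c n < d n" "d n < b" for n
  proof -
    have "3 * ((b - a) / (real n + 3)) \<le> b - a"
      using mult_right_mono[of a b "real n"] assms(1) by (simp add: field_simps)
    moreover have "0 < (b - a) / (real n + 3)" using assms(1) by auto
    ultimately show "a < c n" "c n < d n" "d n < b" using assms(1) unfolding c_def d_def by linarith+
  qed
  have "{x \<in> {a<..<b}. u x \<noteq> 0} \<subseteq> (\<Union>n. {x \<in> {c n<..<d n}. u x \<noteq> 0})"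
  proof safe
    fix x assume x: "x \<in> {a<..<b}" "u x \<noteq> 0"
    define m where "m = min (x - a) (b - x)"
    have "m > 0" using x by (auto simp: m_def)
    obtain n :: nat where n: "(b - a) / m < real n" using reals_Archimedean2 by blast
    then have "(b - a) < real n * m" using \<open>m > 0\<close> by (simp add: field_simps)
    also have "\<dots> \<le> (real n + 3) * m" using \<open>m > 0\<close> by (simp add: algebra_simps)
    finally have "(b - a) / (real n + 3) < m" by (simp add: field_simps)
    then have "x \<in> {c n<..<d n}" by (auto simp: c_def d_def m_def)
    then show "x \<in> (\<Union>n. {x \<in> {c n<..<d n}. u x \<noteq> 0})" using x by auto
  qed
  moreover have "negligible (\<Union>n. {x \<in> {c n<..<d n}. u x \<noteq> 0})"
    by (rule negligible_Union_nat) (use * cd in auto)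
  ultimately have "negligible {x \<in> {a<..<b}. u x \<noteq> 0}" by (rule negligible_subset[rotated])
  then show ?thesis by (simp add: AE_lebesgue_on_iff)
qed

text \<open>The indicator of \<open>{c<..<d}\<close> is a bounded pointwise limit of test functions,
  so dominated convergence makes the integral of \<open>u\<close> over every closed subinterval
  vanish, and \<open>Lebesgue_zero\<close> applies.\<close>

lemma fundamental_lemma:
  assumes "a < b" "locally_integrable {a<..<b} u"
    and zero: "\<And>\<phi>. \<phi> \<in> C1_compact_support {a<..<b} \<Longrightarrow> (LINT x|lebesgue_on {a<..<b}. u x * \<phi> x) = 0"
  shows "AE x in lebesgue_on {a<..<b}. u x = 0"
proof (rule Lebesgue_zero[OF assms(1,2)])
  fix c d assume cd: "a < c" "c < d" "d < b"
  define w where "w y = (max 0 ((y - c) * (d - y)))\<^sup>2" for y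
  \<comment> \<open>Takes values in \<open>[0,1]\<close>, tends to 1 wherever \<open>w > 0\<close>
    and is 0 elsewhere. It inherits C1 regularity from \<open>w\<close>, the square of a positive
    part.\<close>
  define \<phi> where "\<phi> n y = real n * w y / (1 + real n * w y)" for n y
  have w0: "0 \<le> w y" for y by (simp add: w_def)
  have w1: "1 + real n * w y > 0" for n y using w0[of y] by (simp add: add_pos_nonneg)
  have wz: "w y = 0" if "y \<notin> {c<..<d}" for y
  proof -
    have "(y - c) * (d - y) \<le> 0" using that cd by (auto simp: mult_le_0_iff)
    then show ?thesis by (simp add: w_def)
  qed
  have wp: "w y > 0" if "y \<in> {c<..<d}" for y
    using that by (simp add: w_def max_def)
  define w' where "w' y = 2 * max 0 ((y - c) * (d - y)) * ((d - y) - (y - c))" for y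
  have Dw: "(w has_real_derivative w' y) (at y)" for y
    unfolding w_def[abs_def] w'_def by (rule derivative_eq_intros refl | simp)+
  have wc: "continuous_on UNIV w" by (rule DERIV_continuous_on) (use Dw in auto)
  have D: "(\<phi> n has_real_derivative real n * w' y / (1 + real n * w y)\<^sup>2) (at y)" for n y
    unfolding \<phi>_def[abs_def]
    apply (rule derivative_eq_intros Dw refl | simp add: w1[of n y, THEN less_imp_neq, symmetric])+
    using w1[of n y] by (simp add: divide_simps power2_eq_square) (simp add: algebra_simps)
  have c: "continuous_on UNIV (\<phi> n)" for n by (rule DERIV_continuous_on) (use D in auto)
  have C1: "\<phi> n \<in> C1_compact_support {a<..<b}" for n
  proof (rule C1_compact_supportI[OF D _ cd(1,3)])
    show "continuous_on UNIV (\<lambda>y. real n * w' y / (1 + real n * w y)\<^sup>2)"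
      unfolding w'_def using w1[of n] by (intro continuous_intros wc) (auto simp: less_imp_neq[symmetric])
    show "\<phi> n x = 0" if "x \<notin> {c..d}" for x using that wz[of x] by (auto simp: \<phi>_def)
  qed
  have u: "u absolutely_integrable_on {c..d}"
      by (rule locally_integrableD[OF assms(2)]) (use cd in auto)
  have z: "\<phi> n x = 0" if "x \<notin> {c..d}" for n x using that wz[of x] by (auto simp: \<phi>_def)
  note P = integrable_times_C1[OF assms(1,2) c cd(1,3) z]
  have i0: "integral {c..d} (\<lambda>x. u x * \<phi> n x) = 0" for n
    using zero[OF C1[of n]] P(3)[of n] by simp
  have "(\<lambda>n. integral {c..d} (\<lambda>x. u x * \<phi> n x)) \<longlonglongrightarrow> integral {c..d} (\<lambda>x. if x \<in> {c<..<d} then u x else 0)"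
  proof (rule dominated_convergence(2)[where h="\<lambda>x. \<bar>u x\<bar>"])
    show "(\<lambda>x. u x * \<phi> n x) integrable_on {c..d}" for n
      using P(1)[of n] set_lebesgue_integral_eq_integral(1) by blast
    show "(\<lambda>x. \<bar>u x\<bar>) integrable_on {c..d}" using u by (simp add: absolutely_integrable_on_def)
    fix x
    show "norm (u x * \<phi> n x) \<le> \<bar>u x\<bar>" for n
    proof -
      have "0 \<le> \<phi> n x" "\<phi> n x \<le> 1" unfolding \<phi>_def using w1[of n x] w0[of x] by (auto simp: divide_simps)
      then show ?thesis by (simp add: abs_mult mult_left_le)
    qed
    show "(\<lambda>n. u x * \<phi> n x) \<longlonglongrightarrow> (if x \<in> {c<..<d} then u x else 0)"
    proof (cases "x \<in> {c<..<d}")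
      case True
      have "(\<lambda>n. 1 - 1 / (1 + real n * w x)) \<longlonglongrightarrow> 1 - 0"
      proof (intro tendsto_intros tendsto_divide_0[OF tendsto_const] filterlim_at_top_imp_at_infinity)
        show "filterlim (\<lambda>n. 1 + real n * w x) at_top sequentially"
          by (intro filterlim_tendsto_add_at_top[OF tendsto_const]
              filterlim_at_top_mult_tendsto_pos[OF tendsto_const wp[OF True] filterlim_real_sequentially])
      qed
      then have "(\<lambda>n. \<phi> n x) \<longlonglongrightarrow> 1"
        unfolding \<phi>_def using w1[of _ x] by (auto simp: diff_divide_eq_iff less_imp_neq[symmetric] elim!: Lim_transform_eventually)
      then have "(\<lambda>n. u x * \<phi> n x) \<longlonglongrightarrow> u x * 1" by (intro tendsto_intros)
      then show ?thesis using True by simp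
    next
      case False
      then have "(if x \<in> {c<..<d} then u x else 0) = 0" by auto
      then show ?thesis using wz[OF False] by (simp add: \<phi>_def)
    qed
  qed
  then have "integral {c..d} (\<lambda>x. if x \<in> {c<..<d} then u x else 0) = 0"
    using i0 by (simp add: LIMSEQ_const_iff)
  moreover have "integral {c..d} (\<lambda>x. if x \<in> {c<..<d} then u x else 0) = integral {c..d} u"
    by (rule integral_spike[of "{c,d}"]) auto
  ultimately show "integral {c..d} u = 0" by simp
qed

lemma has_weak_deriv_unique:
  assumes "a < b" "has_weak_deriv {a<..<b} f h1" "has_weak_deriv {a<..<b} f h2"
  shows "AE x in lebesgue_on {a<..<b}. h1 x = h2 x"
proof -
  have l: "locally_integrable {a<..<b} h1" "locally_integrable {a<..<b} h2"
    using assms unfolding has_weak_deriv_def by auto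
  have "AE x in lebesgue_on {a<..<b}. h1 x - h2 x = 0"
  proof (rule fundamental_lemma[OF assms(1)])
    show "locally_integrable {a<..<b} (\<lambda>x. h1 x - h2 x)" using l unfolding locally_integrable_def by auto
    fix \<phi> assume \<phi>: "\<phi> \<in> C1_compact_support {a<..<b}"
    then have c: "continuous_on UNIV \<phi>"
      unfolding C1_compact_support_def using C1_differentiable_imp_continuous_on by blast
    obtain c d where cd: "a < c" "d < b" "\<And>x. x \<notin> {c..d} \<Longrightarrow> \<phi> x = 0"
      using C1_compact_supportE[OF \<phi> assms(1)] by (metis greaterThanLessThan_subseteq_atLeastAtMost_iff order_refl subsetD)
    have "(LINT x|lebesgue_on {a<..<b}. (h1 x - h2 x) * \<phi> x) =
      (LINT x|lebesgue_on {a<..<b}. h1 x * \<phi> x) - (LINT x|lebesgue_on {a<..<b}. h2 x * \<phi> x)"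
      using integrable_times_C1(2)[OF assms(1) l(1) c cd] integrable_times_C1(2)[OF assms(1) l(2) c cd]
      by (simp add: integrable_lebesgue_on_iff[symmetric] left_diff_distrib)
    also have "\<dots> = 0" using assms(2,3) \<phi> unfolding has_weak_deriv_def by auto
    finally show "(LINT x|lebesgue_on {a<..<b}. (h1 x - h2 x) * \<phi> x) = 0" .
  qed
  then show ?thesis by simp
qed

lemma ex_antiderivative:
  fixes f :: "real \<Rightarrow> real"
  assumes "continuous_on UNIV f"
  obtains F where "\<And>x. (F has_real_derivative f x) (at x)"
    "\<And>x y. x \<le> y \<Longrightarrow> integral {x..y} f = F y - F x"
proof -
  obtain F where F: "\<forall>x::real. -\<infinity> < ereal x \<longrightarrow> ereal x < \<infinity> \<longrightarrow> (F has_vector_derivative f x) (at x)"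
    using einterval_antiderivative[of "-\<infinity>" "\<infinity>" f] assms by (auto simp: continuous_on_eq_continuous_at)
  then have D: "(F has_vector_derivative f x) (at x)" for x by auto
  have "integral {x..y} f = F y - F x" if "x \<le> y" for x y
    using fundamental_theorem_of_calculus[OF that, of F f] D has_vector_derivative_at_within integral_unique by blast
  with D show ?thesis using that by (auto simp: has_real_derivative_iff_has_vector_derivative)
qed

text \<open>A test function with integral zero is the derivative of a test function. Subtracting
  from any \<open>\<rho>\<close> its integral times a fixed normalized bump \<open>\<psi>\<close>
  gives such a function, so \<open>u - C\<close> is orthogonal to all test functions for
  \<open>C\<close> the integral of \<open>u * \<psi>\<close>.\<close>

lemma du_Bois_Reymond:
  assumes "a < b" "locally_integrable {a<..<b} u"
    and zero: "\<And>\<phi>. \<phi> \<in> C1_compact_support {a<..<b} \<Longrightarrow> (LINT x|lebesgue_on {a<..<b}. u x * deriv \<phi> x) = 0"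
  obtains C where "AE x in lebesgue_on {a<..<b}. u x = C"
proof -
  define m r where "m = (a+b)/2" and "r = (b-a)/4"
  have r: "r > 0" "a < m - r" "m + r < b" using assms(1) by (auto simp: m_def r_def field_simps)
  define B where "B x = bump ((x - m) / r)" for x
  have Bc: "continuous_on UNIV B"
    unfolding B_def[abs_def] bump_def using r(1) by (intro continuous_intros) auto
  have Bz: "B x = 0" if "x \<notin> {m-r..m+r}" for x
    using that r unfolding B_def by (intro bump_eq_0) (auto simp: abs_if field_simps)
  have Bi: "integral {m-r..m+r} B > 0"
  proof -
    have "integral {m-r..m+r} B \<noteq> 0"
    proof
      assume "integral {m-r..m+r} B = 0"
      then have "\<forall>x\<in>{m-r..m+r}. B x = 0"
        using integral_eq_0_iff[of "m-r" "m+r" B] continuous_on_subset[OF Bc] r bump_bounds by (auto simp: B_def)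
      then have "B m = 0" using r by auto
      then show False by (simp add: B_def)
    qed
    moreover have "integral {m-r..m+r} B \<ge> 0"
      by (rule integral_nonneg) (auto simp: B_def bump_bounds intro!: integrable_continuous_interval continuous_on_subset[OF Bc[unfolded B_def[abs_def]]])
    ultimately show ?thesis by simp
  qed
  define Z where "Z = integral {m-r..m+r} B"
  define \<psi> where "\<psi> x = B x / Z" for x
  have \<psi>c: "continuous_on UNIV \<psi>" unfolding \<psi>_def[abs_def] by (intro continuous_intros Bc) (use Bi Z_def in auto)
  have \<psi>z: "\<psi> x = 0" if "x \<notin> {m-r..m+r}" for x using Bz[OF that] by (simp add: \<psi>_def)
  have one: "locally_integrable {a<..<b} (\<lambda>_. 1)"
    unfolding locally_integrable_def by (auto simp: integrable_lebesgue_on_iff lmeasurable_compact fmeasurableD)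
  note I\<psi> = integrable_times_C1[OF assms(1,2) \<psi>c r(2,3) \<psi>z]
  note J\<psi> = integrable_times_C1[OF assms(1) one \<psi>c r(2,3) \<psi>z, simplified]
  have J1: "(LINT x|lebesgue_on {a<..<b}. \<psi> x) = 1"
    using J\<psi>(3) Bi by (simp add: \<psi>_def[abs_def] Z_def)
  define C where "C = (LINT x|lebesgue_on {a<..<b}. u x * \<psi> x)"
  have "AE x in lebesgue_on {a<..<b}. u x - C = 0"
  proof (rule fundamental_lemma[OF assms(1)])
    show "locally_integrable {a<..<b} (\<lambda>x. u x - C)"
      using assms(2) unfolding locally_integrable_def
      by (auto simp: integrable_lebesgue_on_iff lmeasurable_compact fmeasurableD)
    fix \<rho> assume \<rho>: "\<rho> \<in> C1_compact_support {a<..<b}"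
    then have \<rho>c: "continuous_on UNIV \<rho>"
      unfolding C1_compact_support_def using C1_differentiable_imp_continuous_on by blast
    obtain c d where cd: "a < c" "d < b" "\<And>x. x \<notin> {c..d} \<Longrightarrow> \<rho> x = 0"
      using C1_compact_supportE[OF \<rho> assms(1)] by (metis greaterThanLessThan_subseteq_atLeastAtMost_iff order_refl subsetD)
    define t where "t = (LINT x|lebesgue_on {a<..<b}. \<rho> x)"
    note I\<rho> = integrable_times_C1[OF assms(1,2) \<rho>c cd]
    note J\<rho> = integrable_times_C1[OF assms(1) one \<rho>c cd, simplified]
    define \<eta> where "\<eta> x = \<rho> x - t * \<psi> x" for x
    have \<eta>c: "continuous_on UNIV \<eta>" unfolding \<eta>_def[abs_def] by (intro continuous_intros \<rho>c \<psi>c)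
    define c' d' where "c' = min c (m-r)" and "d' = max d (m+r)"
    have cd': "a < c'" "c' \<le> d'" "d' < b" using cd r by (auto simp: c'_def d'_def)
    have \<eta>z: "\<eta> x = 0" if "x \<notin> {c'..d'}" for x
    proof -
      have "x \<notin> {c..d}" "x \<notin> {m-r..m+r}" using that by (auto simp: c'_def d'_def)
      then show ?thesis using cd(3) \<psi>z by (simp add: \<eta>_def)
    qed
    obtain F where F: "\<And>x. (F has_real_derivative \<eta> x) (at x)" "\<And>x y. x \<le> y \<Longrightarrow> integral {x..y} \<eta> = F y - F x"
      using ex_antiderivative[OF \<eta>c] by metis
    have "(LINT x|lebesgue_on {a<..<b}. \<eta> x) = 0"
      using I\<rho> J\<rho> J\<psi> J1 unfolding \<eta>_def t_def by (simp add: integrable_lebesgue_on_iff[symmetric])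
    then have "integral {c'..d'} \<eta> = 0"
      using integrable_times_C1(3)[OF assms(1) one \<eta>c cd'(1,3) \<eta>z] by simp
    then have Fcd: "F d' = F c'" using F(2)[OF cd'(2)] by simp
    have F1: "F x = F c'" if "x \<le> c'" for x
    proof -
      have "integral {x..c'} \<eta> = integral {x..c'} (\<lambda>_. 0)"
        by (rule integral_spike[of "{c'}"]) (auto intro!: \<eta>z)
      then show ?thesis using F(2)[OF that] by simp
    qed
    have F2: "F x = F d'" if "d' \<le> x" for x
    proof -
      have "integral {d'..x} \<eta> = integral {d'..x} (\<lambda>_. 0)"
        by (rule integral_spike[of "{d'}"]) (auto intro!: \<eta>z)
      then show ?thesis using F(2)[OF that] by simp
    qed
    have D: "((\<lambda>x. F x - F c') has_real_derivative \<eta> x) (at x)" for x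
      using F(1)[of x] by (auto intro!: derivative_eq_intros)
    have "(\<lambda>x. F x - F c') \<in> C1_compact_support {a<..<b}"
    proof (rule C1_compact_supportI[OF D \<eta>c cd'(1,3)])
      fix x assume "x \<notin> {c'..d'}"
      then have "x \<le> c' \<or> d' \<le> x" by auto
      then show "F x - F c' = 0" using F1[of x] F2[of x] Fcd by linarith
    qed
    from zero[OF this] have "(LINT x|lebesgue_on {a<..<b}. u x * \<eta> x) = 0"
      using DERIV_imp_deriv[OF D] by simp
    moreover have "(\<lambda>x. u x * \<eta> x) = (\<lambda>x. u x * \<rho> x - t * (u x * \<psi> x))"
      by (auto simp: \<eta>_def algebra_simps)
    ultimately have "(LINT x|lebesgue_on {a<..<b}. u x * \<rho> x) = t * C"
      using I\<rho>(2) I\<psi>(2) unfolding C_def by (simp add: integrable_lebesgue_on_iff[symmetric])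
    moreover have "(\<lambda>x. (u x - C) * \<rho> x) = (\<lambda>x. u x * \<rho> x - C * \<rho> x)" by (auto simp: algebra_simps)
    ultimately show "(LINT x|lebesgue_on {a<..<b}. (u x - C) * \<rho> x) = 0"
      using I\<rho>(2) J\<rho>(2) unfolding t_def by (simp add: integrable_lebesgue_on_iff[symmetric])
  qed
  then show ?thesis using that[of C] by simp
qed

subsection \<open>Absolutely continuous functions on an interval\<close>

text \<open>Absolute continuity in its integral form: \<open>h\<close> is an arbitrary
  representative of the derivative, and pointwise differentiability of \<open>F\<close> is never
  asserted. This is the form that weak derivatives deliver and energy estimates consume.\<close>

definition AC_deriv :: "real \<Rightarrow> real \<Rightarrow> (real \<Rightarrow> real) \<Rightarrow> (real \<Rightarrow> real) \<Rightarrow> bool" where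
  "AC_deriv a b F h \<longleftrightarrow> h absolutely_integrable_on {a..b} \<and> (\<forall>x\<in>{a..b}. F x = F a + integral {a..x} h)"

lemma AC_derivI:
  assumes "h absolutely_integrable_on {a..b}"
    "\<And>x. a \<le> x \<Longrightarrow> x \<le> b \<Longrightarrow> F x = F a + integral {a..x} h"
  shows "AC_deriv a b F h"
  unfolding AC_deriv_def
proof (intro conjI ballI assms(1))
  fix x assume "x \<in> {a..b}"
  then show "F x = F a + integral {a..x} h" by (intro assms(2)) auto
qed

lemma AC_derivD:
  assumes "AC_deriv a b F h"
  shows "h absolutely_integrable_on {a..b}"
    "a \<le> x \<Longrightarrow> x \<le> b \<Longrightarrow> F x = F a + integral {a..x} h"
proof -
  show "h absolutely_integrable_on {a..b}" using assms unfolding AC_deriv_def by (rule conjunct1)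
  assume "a \<le> x" "x \<le> b"
  then have "x \<in> {a..b}" by simp
  with assms show "F x = F a + integral {a..x} h" unfolding AC_deriv_def by (elim conjE) (rule bspec)
qed

lemma AC_deriv_integrable:
  assumes "AC_deriv a b F h" "a \<le> x" "y \<le> b"
  shows "h absolutely_integrable_on {x..y}" "h integrable_on {x..y}" "(\<lambda>x. \<bar>h x\<bar>) integrable_on {x..y}"
proof -
  show *: "h absolutely_integrable_on {x..y}"
    by (rule absolutely_integrable_on_subinterval[where S="{a..b}"]) (use assms AC_derivD(1)[OF assms(1)] in auto)
  show "h integrable_on {x..y}" "(\<lambda>x. \<bar>h x\<bar>) integrable_on {x..y}"
    using * by (auto simp: absolutely_integrable_on_def)
qed

lemma AC_deriv_diff:
  assumes "AC_deriv a b F h" "a \<le> x" "x \<le> y" "y \<le> b"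
  shows "F y - F x = integral {x..y} h"
proof -
  have "integral {a..x} h + integral {x..y} h = integral {a..y} h"
    by (rule Henstock_Kurzweil_Integration.integral_combine) (use assms AC_deriv_integrable[OF assms(1)] in auto)
  moreover have "F x = F a + integral {a..x} h" "F y = F a + integral {a..y} h"
    by (rule AC_derivD(2)[OF assms(1)]; use assms in simp)+
  ultimately show ?thesis by simp
qed

lemma AC_deriv_continuous:
  assumes "AC_deriv a b F h"
  shows "continuous_on {a..b} F"
proof -
  have "continuous_on {a..b} (\<lambda>x. F a + integral {a..x} h)"
    by (intro continuous_intros indefinite_integral_continuous_1) (use assms AC_deriv_integrable in auto)
  then show ?thesis
    by (rule continuous_on_eq) (metis AC_derivD(2)[OF assms] atLeastAtMost_iff)
qed

text \<open>Bisection in place of differentiation: the error and the bound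
  \<open>\<eta> * integral m\<close> are compatible with joining adjacent intervals, so an estimate
  on short intervals around each point holds on the whole interval; finally \<open>\<eta>\<close> is
  arbitrary.\<close>

lemma integral_eq_diff_local:
  fixes k m K :: "real \<Rightarrow> real"
  assumes "a \<le> b" "k integrable_on {a..b}" "m integrable_on {a..b}"
    and local: "\<And>\<eta> z. \<eta> > 0 \<Longrightarrow> a \<le> z \<Longrightarrow> z \<le> b \<Longrightarrow> \<exists>\<delta>>0. \<forall>x y. a \<le> x \<and> x \<le> z \<and> z \<le> y \<and> y \<le> b \<and> y - x < \<delta> \<longrightarrow>
        \<bar>K y - K x - integral {x..y} k\<bar> \<le> \<eta> * integral {x..y} m"
  shows "integral {a..b} k = K b - K a"
proof -
  have *: "\<bar>K b - K a - integral {a..b} k\<bar> \<le> \<eta> * integral {a..b} m" if "\<eta> > 0" for \<eta>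
  proof -
    have "a \<le> a \<longrightarrow> b \<le> b \<longrightarrow> \<bar>K b - K a - integral {a..b} k\<bar> \<le> \<eta> * integral {a..b} m"
      using assms(1)
    proof (induction rule: Bolzano[where P="\<lambda>x y. a \<le> x \<longrightarrow> y \<le> b \<longrightarrow> \<bar>K y - K x - integral {x..y} k\<bar> \<le> \<eta> * integral {x..y} m"])
      case (trans x y z)
      show ?case
      proof (intro impI)
        assume ab: "a \<le> x" "z \<le> b"
        have "integral {x..y} k + integral {y..z} k = integral {x..z} k"
          by (rule Henstock_Kurzweil_Integration.integral_combine) (use trans ab integrable_on_subinterval[OF assms(2)] in auto)
        moreover have "integral {x..y} m + integral {y..z} m = integral {x..z} m"
          by (rule Henstock_Kurzweil_Integration.integral_combine) (use trans ab integrable_on_subinterval[OF assms(3)] in auto)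
        moreover have "\<bar>K y - K x - integral {x..y} k\<bar> \<le> \<eta> * integral {x..y} m" "\<bar>K z - K y - integral {y..z} k\<bar> \<le> \<eta> * integral {y..z} m"
          using trans ab by auto
        ultimately show "\<bar>K z - K x - integral {x..z} k\<bar> \<le> \<eta> * integral {x..z} m"
          by (smt (verit) distrib_left)
      qed
    next
      case (local x)
      from assms(4)[OF that this] show ?case by blast
    qed
    then show ?thesis by simp
  qed
  have "K b - K a - integral {a..b} k = 0"
  proof (rule ccontr)
    assume ne: "K b - K a - integral {a..b} k \<noteq> 0"
    define M where "M = \<bar>integral {a..b} m\<bar> + 1"
    have "M > 0" "integral {a..b} m \<le> M" by (auto simp: M_def)
    let ?d = "\<bar>K b - K a - integral {a..b} k\<bar>"
    have "?d \<le> ?d / (2 * M) * integral {a..b} m" by (rule *) (use ne \<open>M > 0\<close> in auto)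
    also have "\<dots> \<le> ?d / (2 * M) * M" using \<open>M > 0\<close> \<open>integral {a..b} m \<le> M\<close> by (intro mult_left_mono) auto
    also have "\<dots> = ?d / 2" using \<open>M > 0\<close> by simp
    finally show False using ne by simp
  qed
  then show ?thesis by simp
qed

text \<open>On a short interval the mean value theorem replaces the increment of
  \<open>G \<circ> F\<close> by \<open>G' \<xi>\<close> times the increment of \<open>F\<close>, and
  continuity of \<open>G'\<close> makes the error at most \<open>\<eta>\<close> times the integral
  of \<open>\<bar>h\<bar>\<close>. This is the local estimate required by
  \<open>integral_eq_diff_local\<close>.\<close>

lemma AC_deriv_chain:
  assumes F: "AC_deriv a b F h" and "a \<le> b"
    and G: "\<And>x. (G has_real_derivative G' x) (at x)" "continuous_on UNIV G'"
  shows "AC_deriv a b (\<lambda>x. G (F x)) (\<lambda>x. G' (F x) * h x)"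
proof -
  have Fc: "continuous_on {a..b} F" by (rule AC_deriv_continuous[OF F])
  have GFc: "continuous_on {a..b} (\<lambda>x. G' (F x))"
    by (rule continuous_on_compose2[OF G(2) Fc]) auto
  have gi: "(\<lambda>x. G' (F x) * h x) absolutely_integrable_on {a..b}"
  proof (rule absolutely_integrable_bounded_measurable_product_real)
    show "(\<lambda>x. G' (F x)) \<in> borel_measurable (lebesgue_on {a..b})"
      by (rule continuous_imp_measurable_on_sets_lebesgue[OF GFc]) auto
    show "bounded ((\<lambda>x. G' (F x)) ` {a..b})"
      by (intro compact_imp_bounded compact_continuous_image GFc) auto
  qed (use AC_derivD(1)[OF F] in auto)
  have "integral {a..c} (\<lambda>x. G' (F x) * h x) = G (F c) - G (F a)" if c: "c \<in> {a..b}" for c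
  proof (rule integral_eq_diff_local[where m="\<lambda>x. \<bar>h x\<bar>"])
    show "a \<le> c" using c by auto
    have gi': "(\<lambda>x. G' (F x) * h x) absolutely_integrable_on {x..y}" if "a \<le> x" "y \<le> b" for x y
      by (rule absolutely_integrable_on_subinterval[OF gi]) (use that in auto)
    then show "(\<lambda>x. G' (F x) * h x) integrable_on {a..c}" using c
      by (meson set_lebesgue_integral_eq_integral(1) atLeastAtMost_iff order_refl)
    show "(\<lambda>x. \<bar>h x\<bar>) integrable_on {a..c}" using AC_deriv_integrable[OF F] c by auto
    fix \<eta> z :: real assume \<eta>: "\<eta> > 0" and z: "a \<le> z" "z \<le> c"
    have "isCont G' (F z)" using G(2) by (auto simp: continuous_on_eq_continuous_at)
    then obtain s where s: "s > 0" "\<And>w. \<bar>w - F z\<bar> < s \<Longrightarrow> \<bar>G' w - G' (F z)\<bar> < \<eta> / 2"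
      using \<eta> unfolding continuous_at_eps_delta dist_real_def by (metis half_gt_zero)
    obtain \<delta> where \<delta>: "\<delta> > 0" "\<And>t. t \<in> {a..b} \<Longrightarrow> \<bar>t - z\<bar> < \<delta> \<Longrightarrow> \<bar>F t - F z\<bar> < s"
      using Fc s(1) z c unfolding continuous_on_iff dist_real_def by (metis atLeastAtMost_iff order_trans)
    show "\<exists>\<delta>>0. \<forall>x y. a \<le> x \<and> x \<le> z \<and> z \<le> y \<and> y \<le> c \<and> y - x < \<delta> \<longrightarrow>
        \<bar>G (F y) - G (F x) - integral {x..y} (\<lambda>x. G' (F x) * h x)\<bar> \<le> \<eta> * integral {x..y} (\<lambda>x. \<bar>h x\<bar>)"
    proof (intro exI[of _ \<delta>] conjI \<delta>(1) allI impI, elim conjE)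
      fix x y assume xy: "a \<le> x" "x \<le> z" "z \<le> y" "y \<le> c" "y - x < \<delta>"
      have near: "\<bar>F t - F z\<bar> < s" if "t \<in> {x..y}" for t
        by (rule \<delta>(2)) (use that xy c in auto)
      have "\<exists>\<xi>. \<bar>\<xi> - F z\<bar> < s \<and> G (F y) - G (F x) = G' \<xi> * (F y - F x)"
      proof -
        consider "F x < F y" | "F x = F y" | "F x > F y" by linarith
        then show ?thesis
        proof cases
          case 1
          from MVT2[OF this, of G G'] G(1) obtain \<xi> where \<xi>: "F x < \<xi>" "\<xi> < F y" "G (F y) - G (F x) = (F y - F x) * G' \<xi>" by auto
          moreover have "\<bar>\<xi> - F z\<bar> < s" using \<xi> near[of x] near[of y] xy by auto
          ultimately show ?thesis by (auto simp: mult.commute)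
        next
          case 2 then show ?thesis using s(1) by (intro exI[of _ "F z"]) auto
        next
          case 3
          from MVT2[OF this, of G G'] G(1) obtain \<xi> where \<xi>: "F y < \<xi>" "\<xi> < F x" "G (F x) - G (F y) = (F x - F y) * G' \<xi>" by auto
          moreover have "\<bar>\<xi> - F z\<bar> < s" using \<xi> near[of x] near[of y] xy by auto
          ultimately show ?thesis by (intro exI[of _ \<xi>]) (auto simp: algebra_simps)
        qed
      qed
      then obtain \<xi> where \<xi>: "\<bar>\<xi> - F z\<bar> < s" "G (F y) - G (F x) = G' \<xi> * (F y - F x)" by blast
      have hi: "h integrable_on {x..y}" "(\<lambda>x. \<bar>h x\<bar>) integrable_on {x..y}" "(\<lambda>x. G' (F x) * h x) integrable_on {x..y}"
        using AC_deriv_integrable[OF F, of x y] xy c gi'[of x y]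
        by (auto simp: absolutely_integrable_on_def)
      have "G (F y) - G (F x) - integral {x..y} (\<lambda>x. G' (F x) * h x)
          = integral {x..y} (\<lambda>t. G' \<xi> * h t - G' (F t) * h t)"
        using hi AC_deriv_diff[OF F, of x y] xy c by (subst integral_diff) (auto simp: \<xi> intro!: integrable_on_mult_right)
      also have "\<bar>\<dots>\<bar> \<le> integral {x..y} (\<lambda>t. \<eta> * \<bar>h t\<bar>)"
        unfolding real_norm_def[symmetric]
      proof (rule integral_norm_bound_integral)
        show "(\<lambda>t. G' \<xi> * h t - G' (F t) * h t) integrable_on {x..y}" "(\<lambda>t. \<eta> * norm (h t)) integrable_on {x..y}"
          using hi(1-3) by (intro integrable_diff integrable_on_mult_right; simp)+
        fix t assume "t \<in> {x..y}"
        then have "\<bar>G' \<xi> - G' (F t)\<bar> \<le> \<eta>" using s(2)[OF \<xi>(1)] s(2)[OF near[of t]] by linarith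
        then show "norm (G' \<xi> * h t - G' (F t) * h t) \<le> \<eta> * norm (h t)"
          by (simp add: left_diff_distrib[symmetric] abs_mult mult_right_mono)
      qed
      finally show "\<bar>G (F y) - G (F x) - integral {x..y} (\<lambda>x. G' (F x) * h x)\<bar> \<le> \<eta> * integral {x..y} (\<lambda>x. \<bar>h x\<bar>)"
        by simp
    qed
  qed
  then show ?thesis by (intro AC_derivI gi) auto
qed

lemma AC_deriv_add:
  assumes "AC_deriv a b F h" "AC_deriv a b G k"
  shows "AC_deriv a b (\<lambda>x. F x + G x) (\<lambda>x. h x + k x)"
proof (rule AC_derivI)
  show "(\<lambda>x. h x + k x) absolutely_integrable_on {a..b}"
    using AC_derivD(1)[OF assms(1)] AC_derivD(1)[OF assms(2)] by auto
  fix x assume x: "a \<le> x" "x \<le> b"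
  have "integral {a..x} (\<lambda>x. h x + k x) = integral {a..x} h + integral {a..x} k"
    using AC_deriv_integrable(2)[OF assms(1)] AC_deriv_integrable(2)[OF assms(2)] x
    by (intro Henstock_Kurzweil_Integration.integral_add) auto
  then show "F x + G x = F a + G a + integral {a..x} (\<lambda>x. h x + k x)"
    using AC_derivD(2)[OF assms(1) x] AC_derivD(2)[OF assms(2) x] by linarith
qed

lemma AC_deriv_cmult:
  assumes "AC_deriv a b F h"
  shows "AC_deriv a b (\<lambda>x. c * F x) (\<lambda>x. c * h x)"
proof (rule AC_derivI)
  show "(\<lambda>x. c * h x) absolutely_integrable_on {a..b}" using AC_derivD(1)[OF assms] by auto
  fix x assume x: "a \<le> x" "x \<le> b"
  show "c * F x = c * F a + integral {a..x} (\<lambda>x. c * h x)"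
    by (subst AC_derivD(2)[OF assms x]) (simp add: algebra_simps)
qed

lemma AC_deriv_add_const:
  assumes "AC_deriv a b F h"
  shows "AC_deriv a b (\<lambda>x. F x + c) h"
proof (rule AC_derivI[OF AC_derivD(1)[OF assms]])
  fix x assume "a \<le> x" "x \<le> b"
  from AC_derivD(2)[OF assms this] show "F x + c = F a + c + integral {a..x} h" by linarith
qed

text \<open>Covers the functions with finitely many kinks: the truncated transition layers and the
  triangle wave.\<close>

lemma AC_deriv_finite:
  assumes "finite S" "continuous_on {a..b} F" "\<And>x. x \<in> {a<..<b} - S \<Longrightarrow> (F has_real_derivative h x) (at x)"
    and "h absolutely_integrable_on {a..b}"
  shows "AC_deriv a b F h"
proof -
  have "(h has_integral F x - F a) {a..x}" if "x \<in> {a..b}" for x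
    by (rule fundamental_theorem_of_calculus_interior_strong[OF assms(1)])
      (use that assms in \<open>auto simp: has_real_derivative_iff_has_vector_derivative intro: continuous_on_subset\<close>)
  from integral_unique[OF this] show ?thesis by (intro AC_derivI assms(4)) simp
qed

lemma AC_deriv_C1:
  assumes "\<And>x. (F has_real_derivative h x) (at x)" "continuous_on UNIV h"
  shows "AC_deriv a b F h"
proof (rule AC_deriv_finite[of "{}"])
  show "continuous_on {a..b} F"
    by (rule DERIV_continuous_on) (rule has_field_derivative_at_within[OF assms(1)])
  show "h absolutely_integrable_on {a..b}"
    by (rule absolutely_integrable_continuous_real) (rule continuous_on_subset[OF assms(2)], simp)
qed (simp_all add: assms(1))

text \<open>Polarization: \<open>F * G\<close> is a quarter of the difference of the squares of
  \<open>F + G\<close> and \<open>F - G\<close>, and squares are covered by the chain rule.\<close>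

lemma AC_deriv_mult:
  assumes F: "AC_deriv a b F h" and G: "AC_deriv a b G k" and "a \<le> b"
  shows "AC_deriv a b (\<lambda>x. F x * G x) (\<lambda>x. h x * G x + F x * k x)"
proof -
  have sq: "AC_deriv a b (\<lambda>x. (H x)\<^sup>2) (\<lambda>x. 2 * H x * e x)" if "AC_deriv a b H e" for H e
    by (rule AC_deriv_chain[OF that \<open>a \<le> b\<close>]) (auto intro!: derivative_eq_intros continuous_intros)
  have "AC_deriv a b (\<lambda>x. (1/4) * (F x + G x)\<^sup>2 + (-1/4) * (F x + (-1) * G x)\<^sup>2)
      (\<lambda>x. (1/4) * (2 * (F x + G x) * (h x + k x)) + (-1/4) * (2 * (F x + (-1) * G x) * (h x + (-1) * k x)))"
    by (intro AC_deriv_add AC_deriv_cmult sq assms)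
  moreover have "(\<lambda>x. (1/4) * (F x + G x)\<^sup>2 + (-1/4) * (F x + (-1) * G x)\<^sup>2) = (\<lambda>x. F x * G x)"
    by (auto simp: power2_eq_square algebra_simps)
  moreover have "(\<lambda>x. (1/4) * (2 * (F x + G x) * (h x + k x)) + (-1/4) * (2 * (F x + (-1) * G x) * (h x + (-1) * k x))) = (\<lambda>x. h x * G x + F x * k x)"
    by (rule ext) (simp add: field_simps)
  ultimately show ?thesis by simp
qed

subsection \<open>Sobolev functions in one dimension\<close>

lemma LINT_Ioo:
  fixes f :: "real \<Rightarrow> real"
  assumes "f absolutely_integrable_on {a..b}"
  shows "(LINT x|lebesgue_on {a<..<b}. f x) = integral {a..b} f"
  using LINT_lebesgue_on[of "{a<..<b}" f] assms absolutely_integrable_on_Icc_iff_Ioo[where f=f and a=a and b=b]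
  by (simp add: integral_open_interval_real)

lemma LINT_Ioo_AE:
  fixes f g :: "real \<Rightarrow> real"
  assumes "AE x in lebesgue_on {a<..<b}. f x = g x" "g absolutely_integrable_on {a..b}"
  shows "f absolutely_integrable_on {a..b}" "(LINT x|lebesgue_on {a<..<b}. f x) = integral {a..b} g"
proof -
  have N: "negligible {x \<in> {a<..<b}. f x \<noteq> g x}" using assms(1) by (simp add: AE_lebesgue_on_iff)
  have 1: "g absolutely_integrable_on {a<..<b}" using assms(2) absolutely_integrable_on_Icc_iff_Ioo by blast
  then have 2: "f absolutely_integrable_on {a<..<b}"
    by (rule absolutely_integrable_spike[OF _ N]) auto
  then show 3: "f absolutely_integrable_on {a..b}" using absolutely_integrable_on_Icc_iff_Ioo by blast
  have "integral {a<..<b} g = integral {a<..<b} f" by (rule integral_spike[OF N]) auto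
  then show "(LINT x|lebesgue_on {a<..<b}. f x) = integral {a..b} g"
    using LINT_Ioo[OF 3] by (simp add: integral_open_interval_real)
qed

lemma AE_interior_iff:
  fixes a b :: real
  shows "(AE x in lebesgue_on {a<..<b}. P x) \<longleftrightarrow> (AE x in lebesgue_on {a..b}. P x)"
proof -
  have "negligible {x \<in> {a..b}. \<not> P x}" if "negligible {x \<in> {a<..<b}. \<not> P x}"
  proof -
    have "negligible ({x \<in> {a<..<b}. \<not> P x} \<union> {a,b})" using that by (intro negligible_Un) auto
    then show ?thesis by (rule negligible_subset) auto
  qed
  moreover have "negligible {x \<in> {a<..<b}. \<not> P x}" if "negligible {x \<in> {a..b}. \<not> P x}"
    using that by (rule negligible_subset) auto
  ultimately show ?thesis by (auto simp: AE_lebesgue_on_iff)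
qed

lemma borel_measurable_lebesgue_on_AE:
  fixes f g :: "real \<Rightarrow> real"
  assumes "f \<in> borel_measurable (lebesgue_on S)" "S \<in> sets lebesgue" "AE x in lebesgue_on S. f x = g x"
  shows "g \<in> borel_measurable (lebesgue_on S)"
proof -
  have "(\<lambda>x. if x \<in> S then f x else 0) \<in> borel_measurable lebesgue"
    using assms borel_measurable_if by blast
  moreover have "AE x in lebesgue. (if x \<in> S then f x else 0) = (if x \<in> S then g x else 0)"
    using assms(2,3) by (auto simp: AE_restrict_space_iff)
  ultimately have "(\<lambda>x. if x \<in> S then g x else 0) \<in> borel_measurable lebesgue"
    by (rule borel_measurable_AE)
  then show ?thesis using assms borel_measurable_if by blast
qed

lemma in_Lp_AE:
  assumes "in_Lp p S f" "S \<in> sets lebesgue" "AE x in lebesgue_on S. f x = g x"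
  shows "in_Lp p S g"
proof -
  have g: "g \<in> borel_measurable (lebesgue_on S)"
    using borel_measurable_lebesgue_on_AE[OF _ assms(2,3)] assms(1) in_Lp_def by blast
  have "integrable (lebesgue_on S) (\<lambda>x. \<bar>g x\<bar> ^ p)"
  proof (subst integrable_cong_AE)
    show "AE x in lebesgue_on S. \<bar>g x\<bar> ^ p = \<bar>f x\<bar> ^ p" using assms(3) by (auto elim: AE_mp)
    show "integrable (lebesgue_on S) (\<lambda>x. \<bar>f x\<bar> ^ p)" using assms(1) in_Lp_def by blast
    show "(\<lambda>x. \<bar>f x\<bar> ^ p) \<in> borel_measurable (lebesgue_on S)" using assms(1) in_Lp_def by (intro borel_measurable_integrable) auto
    show "(\<lambda>x. \<bar>g x\<bar> ^ p) \<in> borel_measurable (lebesgue_on S)" using g by measurable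
  qed
  with g show ?thesis by (simp add: in_Lp_def)
qed

lemma in_Lp_bounded:
  fixes f :: "real \<Rightarrow> real"
  assumes "f \<in> borel_measurable (lebesgue_on {a<..<b})" "\<And>x. x \<in> {a<..<b} \<Longrightarrow> \<bar>f x\<bar> \<le> B"
  shows "in_Lp p {a<..<b} f"
proof -
  have "(\<lambda>x. \<bar>f x\<bar> ^ p) absolutely_integrable_on {a<..<b}"
  proof (rule measurable_bounded_by_integrable_imp_absolutely_integrable[where g="\<lambda>_. B ^ p"])
    show "(\<lambda>x. \<bar>f x\<bar> ^ p) \<in> borel_measurable (lebesgue_on {a<..<b})" using assms(1) by measurable
    show "(\<lambda>_. B ^ p) integrable_on {a<..<b}" by (intro integrable_on_const) (simp add: lmeasurable_interval[of a b, unfolded box_real])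
    show "norm (\<bar>f x\<bar> ^ p) \<le> B ^ p" if "x \<in> {a<..<b}" for x using assms(2)[OF that] by (simp add: power_mono)
  qed auto
  then show ?thesis using assms(1) by (simp add: in_Lp_def integrable_lebesgue_on_iff)
qed

lemma in_L2D:
  fixes h :: "real \<Rightarrow> real"
  assumes "in_Lp 2 {a<..<b} h"
  shows "h absolutely_integrable_on {a..b}" "(\<lambda>x. (h x)\<^sup>2) absolutely_integrable_on {a..b}"
    "h \<in> borel_measurable (lebesgue_on {a<..<b})"
proof -
  show m: "h \<in> borel_measurable (lebesgue_on {a<..<b})" using assms by (simp add: in_Lp_def)
  have "(\<lambda>x. (h x)\<^sup>2) absolutely_integrable_on {a<..<b}"
    using assms by (simp add: in_Lp_def integrable_lebesgue_on_iff)
  then show 2: "(\<lambda>x. (h x)\<^sup>2) absolutely_integrable_on {a..b}" by (simp add: absolutely_integrable_on_Icc_iff_Ioo)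
  have "h absolutely_integrable_on {a<..<b}"
  proof (rule measurable_bounded_by_integrable_imp_absolutely_integrable[OF m, where g="\<lambda>x. 1 + (h x)\<^sup>2"])
    show "(\<lambda>x. 1 + (h x)\<^sup>2) integrable_on {a<..<b}"
      using set_lebesgue_integral_eq_integral(1)[OF 2[unfolded absolutely_integrable_on_Icc_iff_Ioo]]
      by (intro integrable_add integrable_on_const) (simp_all add: lmeasurable_interval[of a b, unfolded box_real])
    show "norm (h x) \<le> 1 + (h x)\<^sup>2" for x
    proof -
      have "0 \<le> (\<bar>h x\<bar> - 1)\<^sup>2" by simp
      then have "2 * \<bar>h x\<bar> \<le> 1 + (h x)\<^sup>2" by (simp add: power2_diff)
      then show ?thesis by simp
    qed
  qed auto
  then show "h absolutely_integrable_on {a..b}" by (simp add: absolutely_integrable_on_Icc_iff_Ioo)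
qed

text \<open>Integration by parts: the product with a test function is absolutely continuous and
  vanishes at both ends.\<close>

lemma AC_deriv_weak:
  assumes F: "AC_deriv a b F h" and "a < b"
  shows "has_weak_deriv {a<..<b} F h"
proof -
  have Fi: "F absolutely_integrable_on {a..b}"
    by (rule absolutely_integrable_continuous_real[OF AC_deriv_continuous[OF F]])
  have loc: "locally_integrable {a<..<b} f" if "f absolutely_integrable_on {a..b}" for f
    unfolding locally_integrable_def
  proof (intro allI impI, elim conjE)
    fix K :: "real set" assume K: "compact K" "K \<subseteq> {a<..<b}"
    have "K \<in> sets lebesgue" using K(1) by (simp add: lmeasurable_compact fmeasurableD)
    moreover have "f absolutely_integrable_on K"
      by (rule set_integrable_subset[OF that]) (use K calculation in \<open>auto simp: subset_eq less_imp_le\<close>)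
    ultimately show "integrable (lebesgue_on K) f" by (simp add: integrable_lebesgue_on_iff)
  qed
  show ?thesis
    unfolding has_weak_deriv_def
  proof (intro conjI ballI loc Fi AC_derivD(1)[OF F])
    fix \<phi> assume \<phi>: "\<phi> \<in> C1_compact_support {a<..<b}"
    then have C1: "\<phi> C1_differentiable_on UNIV" by (simp add: C1_compact_support_def)
    have \<phi>c: "continuous_on UNIV \<phi>"
      using C1 C1_differentiable_imp_continuous_on by blast
    note \<phi>' = C1_has_deriv[OF C1]
    obtain c d where cd: "a < c" "c < d" "d < b" "\<And>x. x \<notin> {c<..<d} \<Longrightarrow> \<phi> x = 0" "\<And>x. x \<notin> {c<..<d} \<Longrightarrow> deriv \<phi> x = 0"
      using C1_compact_supportE[OF \<phi> assms(2)] by metis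
    have "AC_deriv a b (\<lambda>x. F x * \<phi> x) (\<lambda>x. h x * \<phi> x + F x * deriv \<phi> x)"
      by (rule AC_deriv_mult[OF F AC_deriv_C1[OF \<phi>']]) (use assms in auto)
    from AC_derivD(2)[OF this, of b] have "integral {a..b} (\<lambda>x. h x * \<phi> x + F x * deriv \<phi> x) = 0"
      using cd assms(2) by simp
    moreover have i1: "(\<lambda>x. h x * \<phi> x) absolutely_integrable_on {a<..<b}"
      by (rule integrable_times_C1(2)[OF assms(2) loc[OF AC_derivD(1)[OF F]] \<phi>c cd(1,3)]) (use cd in auto)
    moreover have i2: "(\<lambda>x. F x * deriv \<phi> x) absolutely_integrable_on {a<..<b}"
      by (rule integrable_times_C1(2)[OF assms(2) loc[OF Fi] \<phi>'(2) cd(1,3)]) (use cd in auto)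
    ultimately have "integral {a..b} (\<lambda>x. h x * \<phi> x) + integral {a..b} (\<lambda>x. F x * deriv \<phi> x) = 0"
      by (subst Henstock_Kurzweil_Integration.integral_add[symmetric])
         (simp_all add: absolutely_integrable_on_Icc_iff_Ioo[symmetric] set_lebesgue_integral_eq_integral(1))
    then show "(LINT x|lebesgue_on {a<..<b}. F x * deriv \<phi> x) = - (LINT x|lebesgue_on {a<..<b}. h x * \<phi> x)"
      using i1 i2 by (simp add: LINT_Ioo absolutely_integrable_on_Icc_iff_Ioo)
  qed
qed

text \<open>The difference between \<open>f\<close> and the indefinite integral of its weak
  derivative has weak derivative zero, hence is constant almost everywhere by
  \<open>du_Bois_Reymond\<close>.\<close>

lemma in_W12_AC:
  assumes "a < b" "in_W12 {a<..<b} f"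
  obtains F where "AC_deriv a b F (weak_deriv {a<..<b} f)" "AE x in lebesgue_on {a<..<b}. f x = F x"
    "in_Lp 2 {a<..<b} (weak_deriv {a<..<b} f)"
proof -
  define w where "w = weak_deriv {a<..<b} f"
  obtain h where h: "has_weak_deriv {a<..<b} f h" "in_Lp 2 {a<..<b} h"
    using assms(2) by (auto simp: in_W12_def)
  have w: "has_weak_deriv {a<..<b} f w"
    unfolding w_def weak_deriv_def by (rule someI[of "has_weak_deriv {a<..<b} f", OF h(1)])
  \<comment> \<open>Membership in \<open>in_W12\<close> gives square integrability for some weak
    derivative \<open>h\<close>; uniqueness carries it over to the one selected by
    \<open>weak_deriv\<close>.\<close>
  have "AE x in lebesgue_on {a<..<b}. h x = w x" by (rule has_weak_deriv_unique[OF assms(1) h(1) w])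
  then have w2: "in_Lp 2 {a<..<b} w" by (intro in_Lp_AE[OF h(2)]) auto
  note wi = in_L2D[OF w2]
  define H where "H x = integral {a..x} w" for x
  have H: "AC_deriv a b H w"
    by (rule AC_derivI[OF wi(1)]) (simp add: H_def)
  note Hw = AC_deriv_weak[OF H assms(1)]
  have lf: "locally_integrable {a<..<b} f" "locally_integrable {a<..<b} H"
    using w Hw by (auto simp: has_weak_deriv_def)
  obtain C where C: "AE x in lebesgue_on {a<..<b}. f x - H x = C"
  proof (rule du_Bois_Reymond[OF assms(1)])
    show "locally_integrable {a<..<b} (\<lambda>x. f x - H x)"
      using lf unfolding locally_integrable_def by auto
    fix \<phi> assume \<phi>: "\<phi> \<in> C1_compact_support {a<..<b}"
    then have C1: "\<phi> C1_differentiable_on UNIV" by (simp add: C1_compact_support_def)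
    obtain c d where cd: "a < c" "c < d" "d < b" "\<And>x. x \<notin> {c<..<d} \<Longrightarrow> \<phi> x = 0" "\<And>x. x \<notin> {c<..<d} \<Longrightarrow> deriv \<phi> x = 0"
      using C1_compact_supportE[OF \<phi> assms(1)] by metis
    have "(\<lambda>x. u x * deriv \<phi> x) absolutely_integrable_on {a<..<b}" if "locally_integrable {a<..<b} u" for u
      by (rule integrable_times_C1(2)[OF assms(1) that C1_has_deriv(2)[OF C1] cd(1,3)]) (use cd in auto)
    with lf have "(LINT x|lebesgue_on {a<..<b}. (f x - H x) * deriv \<phi> x) =
      (LINT x|lebesgue_on {a<..<b}. f x * deriv \<phi> x) - (LINT x|lebesgue_on {a<..<b}. H x * deriv \<phi> x)"
      by (simp add: left_diff_distrib integrable_lebesgue_on_iff[symmetric])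
    also have "\<dots> = 0" using w Hw \<phi> by (simp add: has_weak_deriv_def)
    finally show "(LINT x|lebesgue_on {a<..<b}. (f x - H x) * deriv \<phi> x) = 0" .
  qed
  show ?thesis
  proof (rule that[of "\<lambda>x. H x + C"])
    show "AC_deriv a b (\<lambda>x. H x + C) (weak_deriv {a<..<b} f)"
      using AC_deriv_add_const[OF H] by (simp add: w_def)
    show "AE x in lebesgue_on {a<..<b}. f x = H x + C" using C by (auto elim: AE_mp)
    show "in_Lp 2 {a<..<b} (weak_deriv {a<..<b} f)" using w2 by (simp add: w_def)
  qed
qed

lemma in_Lp_continuous:
  assumes "continuous_on {a..b} F"
  shows "in_Lp p {a<..<b} F"
proof -
  obtain B where "\<forall>x\<in>{a..b}. \<bar>F x\<bar> \<le> B"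
    using compact_imp_bounded[OF compact_continuous_image[OF assms]] by (auto simp: bounded_iff)
  moreover have "F \<in> borel_measurable (lebesgue_on {a<..<b})"
    by (rule continuous_imp_measurable_on_sets_lebesgue[OF continuous_on_subset[OF assms]]) auto
  ultimately show ?thesis by (intro in_Lp_bounded[where B=B]) auto
qed

lemma has_weak_deriv_AE:
  assumes "has_weak_deriv {a<..<b} f h" "AE x in lebesgue_on {a<..<b}. f x = g x"
  shows "has_weak_deriv {a<..<b} g h"
  unfolding has_weak_deriv_def
proof (intro conjI ballI)
  have N: "negligible {x \<in> {a<..<b}. f x \<noteq> g x}" using assms(2) by (simp add: AE_lebesgue_on_iff)
  have lf: "locally_integrable {a<..<b} f" using assms(1) by (simp add: has_weak_deriv_def)
  show "locally_integrable {a<..<b} g"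
    unfolding locally_integrable_def
  proof (intro allI impI, elim conjE)
    fix K :: "real set" assume K: "compact K" "K \<subseteq> {a<..<b}"
    have KL: "K \<in> sets lebesgue" using K(1) by (simp add: lmeasurable_compact fmeasurableD)
    have "f absolutely_integrable_on K" using lf K KL by (auto simp: locally_integrable_def integrable_lebesgue_on_iff)
    then have "g absolutely_integrable_on K"
      by (rule absolutely_integrable_spike[OF _ N]) (use K in auto)
    then show "integrable (lebesgue_on K) g" using KL by (simp add: integrable_lebesgue_on_iff)
  qed
  show "locally_integrable {a<..<b} h" using assms(1) by (simp add: has_weak_deriv_def)
  fix \<phi> assume \<phi>: "\<phi> \<in> C1_compact_support {a<..<b}"
  have eq: "AE x in lebesgue_on {a<..<b}. g x * deriv \<phi> x = f x * deriv \<phi> x" using assms(2) by (auto elim: AE_mp)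
  have "(LINT x|lebesgue_on {a<..<b}. g x * deriv \<phi> x) = (LINT x|lebesgue_on {a<..<b}. f x * deriv \<phi> x)"
  proof (cases "a < b")
    case True
    obtain c d where cd: "a < c" "c < d" "d < b" "\<And>x. x \<notin> {c<..<d} \<Longrightarrow> \<phi> x = 0" "\<And>x. x \<notin> {c<..<d} \<Longrightarrow> deriv \<phi> x = 0"
      using C1_compact_supportE[OF \<phi> True] by metis
    have C1: "\<phi> C1_differentiable_on UNIV" using \<phi> by (simp add: C1_compact_support_def)
    have "(\<lambda>x. f x * deriv \<phi> x) absolutely_integrable_on {a<..<b}"
      by (rule integrable_times_C1(2)[OF True lf C1_has_deriv(2)[OF C1] cd(1,3)]) (use cd in auto)
    then have i: "(\<lambda>x. f x * deriv \<phi> x) absolutely_integrable_on {a..b}" by (simp add: absolutely_integrable_on_Icc_iff_Ioo)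
    show ?thesis using LINT_Ioo_AE(2)[OF eq i] LINT_Ioo[OF i] by simp
  qed simp
  then show "(LINT x|lebesgue_on {a<..<b}. g x * deriv \<phi> x) = - (LINT x|lebesgue_on {a<..<b}. h x * \<phi> x)"
    using assms(1) \<phi> by (simp add: has_weak_deriv_def)
qed

lemma in_W12_AE:
  assumes "AC_deriv a b F h" "a < b" "in_Lp 2 {a<..<b} h" "AE x in lebesgue_on {a<..<b}. f x = F x"
  shows "in_W12 {a<..<b} f" "AE x in lebesgue_on {a<..<b}. weak_deriv {a<..<b} f x = h x"
proof -
  have ae: "AE x in lebesgue_on {a<..<b}. F x = f x" using assms(4) by (auto elim: AE_mp)
  have w: "has_weak_deriv {a<..<b} f h"
    by (rule has_weak_deriv_AE[OF AC_deriv_weak[OF assms(1,2)] ae])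
  have "in_Lp 2 {a<..<b} F" by (rule in_Lp_continuous[OF AC_deriv_continuous[OF assms(1)]])
  then have "in_Lp 2 {a<..<b} f" by (rule in_Lp_AE[OF _ _ ae]) auto
  then show "in_W12 {a<..<b} f" unfolding in_W12_def using w assms(3) by blast
  have "has_weak_deriv {a<..<b} f (weak_deriv {a<..<b} f)"
    unfolding weak_deriv_def by (rule someI[of "has_weak_deriv {a<..<b} f", OF w])
  from has_weak_deriv_unique[OF assms(2) this w]
  show "AE x in lebesgue_on {a<..<b}. weak_deriv {a<..<b} f x = h x" .
qed

lemma AC_deriv_W12:
  assumes "AC_deriv a b F h" "a < b" "in_Lp 2 {a<..<b} h"
  shows "in_W12 {a<..<b} F" "AE x in lebesgue_on {a<..<b}. weak_deriv {a<..<b} F x = h x"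
  using in_W12_AE[OF assms, of F] by auto

text \<open>At either endpoint the half ball is an interval of length exactly \<open>r\<close>;
  writing it as \<open>{p<..<p+r}\<close> treats both endpoints at once.\<close>

lemma ball_Int_Ioo:
  fixes a b r :: real
  assumes "z = a \<or> z = b" "0 < r" "r < b - a"
  obtains p where "ball z r \<inter> {a<..<b} = {p<..<p+r}" "a \<le> p" "p + r \<le> b"
proof (cases "z = a")
  case True
  then have "ball z r \<inter> {a<..<b} = {a<..<a+r}" using assms by (auto simp: dist_real_def)
  then show ?thesis using that[of a] assms by auto
next
  case False
  then have "z = b" using assms by auto
  then have "ball z r \<inter> {a<..<b} = {b-r<..<b-r+r}" using assms by (auto simp: dist_real_def)
  then show ?thesis using that[of "b-r"] assms by auto
qed

lemma has_traceI:
  assumes "a < b" "z = a \<or> z = b" "f absolutely_integrable_on {a..b}"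
    and lim: "\<And>\<eta>. \<eta> > 0 \<Longrightarrow> \<exists>d>0. AE x in lebesgue_on {a<..<b}. \<bar>x - z\<bar> < d \<longrightarrow> \<bar>f x - t\<bar> \<le> \<eta>"
  shows "has_trace {a<..<b} f z t"
  unfolding has_trace_def
proof (rule tendstoI)
  fix e :: real assume "e > 0"
  then obtain d where d: "d > 0" "AE x in lebesgue_on {a<..<b}. \<bar>x - z\<bar> < d \<longrightarrow> \<bar>f x - t\<bar> \<le> e / 2"
    using lim[of "e/2"] by auto
  have N: "negligible {x \<in> {a<..<b}. \<not> (\<bar>x - z\<bar> < d \<longrightarrow> \<bar>f x - t\<bar> \<le> e / 2)}" (is "negligible ?N")
    using d(2) by (subst (asm) AE_lebesgue_on_iff) auto
  have "dist ((LINT x|lebesgue_on (ball z r \<inter> {a<..<b}). \<bar>f x - t\<bar>) / r) 0 < e"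
    if r: "0 < r" "r < min d (b - a)" for r
  proof -
    obtain p where p: "ball z r \<inter> {a<..<b} = {p<..<p+r}" "a \<le> p" "p + r \<le> b"
      using ball_Int_Ioo[of z a b r] assms(2) r by auto
    have fi: "f absolutely_integrable_on {p..p+r}"
      by (rule absolutely_integrable_on_subinterval[OF assms(3)]) (use p in auto)
    then have ai: "(\<lambda>x. \<bar>f x - t\<bar>) absolutely_integrable_on {p..p+r}"
      by (intro set_integrable_abs set_integral_diff) auto
    have "(LINT x|lebesgue_on (ball z r \<inter> {a<..<b}). \<bar>f x - t\<bar>) = integral {p<..<p+r} (\<lambda>x. \<bar>f x - t\<bar>)"
      using LINT_Ioo[OF ai] p(1) by (simp add: integral_open_interval_real)
    \<comment> \<open>The bound \<open>e/2\<close> holds only almost everywhere. Truncation makes it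
      hold pointwise and leaves the integral unchanged.\<close>
    also have "integral {p<..<p+r} (\<lambda>x. \<bar>f x - t\<bar>) = integral {p<..<p+r} (\<lambda>x. min (\<bar>f x - t\<bar>) (e/2))"
    proof (rule integral_spike[OF N])
      fix x assume x: "x \<in> {p<..<p+r} - ?N"
      then have "x \<in> ball z r" "x \<in> {a<..<b}" using p by blast+
      then show "min (\<bar>f x - t\<bar>) (e/2) = \<bar>f x - t\<bar>" using x r by (auto simp: dist_real_def abs_minus_commute)
    qed
    also have "\<dots> = integral {p..p+r} (\<lambda>x. min (\<bar>f x - t\<bar>) (e/2))" by (simp add: integral_open_interval_real)
    also have "\<dots> \<le> integral {p..p+r} (\<lambda>x. e/2)"
    proof (rule integral_le)
      show "(\<lambda>x. min (\<bar>f x - t\<bar>) (e/2)) integrable_on {p..p+r}"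
        using absolutely_integrable_min_1[OF ai, of "\<lambda>_. e/2"] by (simp add: set_lebesgue_integral_eq_integral(1))
    qed (rule integrable_const_ivl, rule min.cobounded2)
    also have "\<dots> = r * (e / 2)" using r by simp
    finally have "(LINT x|lebesgue_on (ball z r \<inter> {a<..<b}). \<bar>f x - t\<bar>) \<le> r * (e / 2)" .
    moreover have "0 \<le> (LINT x|lebesgue_on (ball z r \<inter> {a<..<b}). \<bar>f x - t\<bar>)" by simp
    moreover have "r * (e/2) < r * e" using r \<open>e > 0\<close> by simp
    ultimately show ?thesis using r(1) by (simp add: field_simps)
  qed
  then show "\<forall>\<^sub>F r in at_right 0. dist ((LINT x|lebesgue_on (ball z r \<inter> {a<..<b}). \<bar>f x - t\<bar>) / r) 0 < e"
    using assms(1) d(1) by (auto simp: eventually_at_right_field intro!: exI[of _ "min d (b-a)"])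
qed

text \<open>The triangle inequality for \<open>\<bar>t - t'\<bar>\<close> is averaged over the half
  ball, whose length is \<open>r\<close>; both averages tend to 0.\<close>

lemma has_trace_unique:
  assumes "a < b" "z = a \<or> z = b" "f absolutely_integrable_on {a..b}"
    and t: "has_trace {a<..<b} f z t" "has_trace {a<..<b} f z t'"
  shows "t = t'"
proof -
  let ?J = "\<lambda>t r. (LINT x|lebesgue_on (ball z r \<inter> {a<..<b}). \<bar>f x - t\<bar>) / r"
  have "((\<lambda>r. ?J t r + ?J t' r) \<longlongrightarrow> 0 + 0) (at_right 0)"
    using t unfolding has_trace_def by (intro tendsto_add)
  moreover have "\<forall>\<^sub>F r in at_right 0. \<bar>t - t'\<bar> \<le> ?J t r + ?J t' r"
  proof -
    have "\<bar>t - t'\<bar> \<le> ?J t r + ?J t' r" if r: "0 < r" "r < b - a" for r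
    proof -
      obtain p where p: "ball z r \<inter> {a<..<b} = {p<..<p+r}" "a \<le> p" "p + r \<le> b"
        using ball_Int_Ioo[of z a b r] assms(2) r by auto
      have fi: "f absolutely_integrable_on {p..p+r}"
        by (rule absolutely_integrable_on_subinterval[OF assms(3)]) (use p in auto)
      then have ai: "(\<lambda>x. \<bar>f x - t\<bar>) absolutely_integrable_on {p..p+r}" for t
        by (intro set_integrable_abs set_integral_diff) auto
      have "r * \<bar>t - t'\<bar> = integral {p..p+r} (\<lambda>x. \<bar>t - t'\<bar>)" using r by simp
      also have "\<dots> \<le> integral {p..p+r} (\<lambda>x. \<bar>f x - t\<bar> + \<bar>f x - t'\<bar>)"
        by (rule integral_le) (use ai in \<open>auto simp: set_lebesgue_integral_eq_integral(1) intro!: integrable_add\<close>)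
      also have "\<dots> = integral {p..p+r} (\<lambda>x. \<bar>f x - t\<bar>) + integral {p..p+r} (\<lambda>x. \<bar>f x - t'\<bar>)"
        by (rule Henstock_Kurzweil_Integration.integral_add) (use ai in \<open>auto simp: set_lebesgue_integral_eq_integral(1)\<close>)
      finally have "r * \<bar>t - t'\<bar> \<le> integral {p..p+r} (\<lambda>x. \<bar>f x - t\<bar>) + integral {p..p+r} (\<lambda>x. \<bar>f x - t'\<bar>)" .
      then show ?thesis using LINT_Ioo[OF ai] p(1) r by (simp add: field_simps)
    qed
    then show ?thesis using assms(1) by (auto simp: eventually_at_right_field intro!: exI[of _ "b-a"])
  qed
  ultimately have "\<bar>t - t'\<bar> \<le> 0 + 0" by (intro tendsto_lowerbound) auto
  then show ?thesis by simp
qed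

text \<open>Since \<open>bdry_trace\<close> is a definite description, a trace has to be both
  exhibited and shown to be unique before its value is known.\<close>

lemma bdry_trace_eq:
  assumes "a < b" "z = a \<or> z = b" "f absolutely_integrable_on {a..b}"
    and lim: "\<And>\<eta>. \<eta> > 0 \<Longrightarrow> \<exists>d>0. AE x in lebesgue_on {a<..<b}. \<bar>x - z\<bar> < d \<longrightarrow> \<bar>f x - t\<bar> \<le> \<eta>"
  shows "bdry_trace {a<..<b} f z = t"
  unfolding bdry_trace_def
  using has_traceI[OF assms] has_trace_unique[OF assms(1-3)] by (intro the_equality) auto

lemma bdry_trace_continuous:
  assumes "a < b" "z = a \<or> z = b" "continuous_on {a..b} F" "AE x in lebesgue_on {a<..<b}. f x = F x"
  shows "bdry_trace {a<..<b} f z = F z"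
proof (rule bdry_trace_eq[OF assms(1,2)])
  show "f absolutely_integrable_on {a..b}"
    by (rule LINT_Ioo_AE(1)[OF assms(4) absolutely_integrable_continuous_real[OF assms(3)]])
  fix \<eta> :: real assume "\<eta> > 0"
  moreover have "z \<in> {a..b}" using assms(1,2) by auto
  ultimately obtain d where d: "d > 0" "\<And>x. x \<in> {a..b} \<Longrightarrow> dist x z < d \<Longrightarrow> dist (F x) (F z) < \<eta>"
    using assms(3) unfolding continuous_on_iff by metis
  show "\<exists>d>0. AE x in lebesgue_on {a<..<b}. \<bar>x - z\<bar> < d \<longrightarrow> \<bar>f x - F z\<bar> \<le> \<eta>"
  proof (intro exI[of _ d] conjI d(1), rule lebesgue_on_mono[OF assms(4)], intro impI)
    fix x assume x: "f x = F x" "x \<in> {a<..<b}" "\<bar>x - z\<bar> < d"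
    then have "dist (F x) (F z) < \<eta>" by (intro d(2)) (auto simp: dist_real_def)
    then show "\<bar>f x - F z\<bar> \<le> \<eta>" using x by (simp add: dist_real_def)
  qed
qed

subsection \<open>The double-well potential\<close>

locale wells =
  fixes \<sigma> D2 a0 \<beta> :: real
  assumes \<sigma>_pos: "\<sigma> > 0" and D2_pos: "D2 > 0"
    and W_nonneg: "\<And>t. W \<sigma> D2 a0 t \<ge> 0"
    and \<beta>_pos: "0 < \<beta>" and \<beta>_less: "\<beta> < pi / 2"
    and W_zeros: "{t \<in> {-pi..pi}. W \<sigma> D2 a0 t = 0} = {-\<beta>, \<beta>}"
begin

abbreviation "V \<equiv> W \<sigma> D2 a0"
abbreviation "P \<equiv> \<Phi> \<sigma> D2 a0 \<beta>"

lemma V_beta [simp]: "V \<beta> = 0" "V (-\<beta>) = 0"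
  using W_zeros by auto

lemma V_continuous: "continuous_on S V"
  unfolding W_def by (intro continuous_intros) auto

lemma V_even: "V (-t) = V t"
  by (simp add: W_def)

lemma V_periodic: "V (t + 2 * pi) = V t"
  by (simp add: W_def add_divide_distrib)

lemma V_periodic_int: "V (t + 2 * pi * of_int k) = V t"
proof -
  have n: "V (t + 2 * pi * real n) = V t" for n t
  proof (induction n)
    case (Suc n)
    have "V (t + 2 * pi * real (Suc n)) = V ((t + 2 * pi * real n) + 2 * pi)" by (simp add: algebra_simps)
    then show ?case using V_periodic Suc by simp
  qed simp
  show ?thesis
  proof (cases "k \<ge> 0")
    case True then show ?thesis using n[of t "nat k"] by simp
  next
    case False then show ?thesis using n[of "t + 2 * pi * of_int k" "nat (-k)"] by simp
  qed
qed

text \<open>With \<open>s = sin (t/2)^2\<close> and \<open>z = sin (\<beta>/2)^2\<close> the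
  potential is a quartic in \<open>s\<close>, and \<open>Q\<close> is its quotient by
  \<open>(s - z)^2\<close>. Positivity of \<open>Q\<close> locates all zeros of \<open>W\<close>,
  also outside \<open>[-pi, pi]\<close>; its monotonicity compares the two sides of the well at
  \<open>\<beta>\<close>.\<close>

definition Q :: "real \<Rightarrow> real" where
  "Q s = 8 * D2 * (s\<^sup>2 + 2 * sin (\<beta>/2)^2 * s + 3 * sin (\<beta>/2)^4) + 4 * (1 + \<sigma>)"

lemma Q_pos: "s \<ge> 0 \<Longrightarrow> Q s > 0"
  unfolding Q_def using D2_pos \<sigma>_pos by (intro add_nonneg_pos mult_nonneg_nonneg) auto

lemma Q_mono: "0 \<le> s \<Longrightarrow> s \<le> t \<Longrightarrow> Q s \<le> Q t"
  unfolding Q_def using D2_pos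
  by (intro add_mono mult_left_mono power_mono order_refl) auto

text \<open>The zero \<open>\<beta>\<close> of \<open>W \<ge> 0\<close> is double, so \<open>(sin\<^sup>2 (t/2) - sin\<^sup>2 (\<beta>/2))\<^sup>2\<close> splits off.\<close>

lemma V_factor: "V t = (sin (t/2)^2 - sin (\<beta>/2)^2)^2 * Q (sin (t/2)^2)"
proof -
  define z where "z = sin (\<beta>/2)^2"
  have "sin (\<beta>/2) > 0" using \<beta>_pos \<beta>_less by (intro sin_gt_zero) auto
  moreover have "cos (\<beta>/2) > 0" using \<beta>_pos \<beta>_less by (intro cos_gt_zero) auto
  moreover have "(V has_real_derivative
     (32 * D2 * z^3 + 8 * (1 + \<sigma>) * z - 4 * \<sigma>) * (sin (\<beta>/2) * cos (\<beta>/2))) (at \<beta>)"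
    unfolding W_def[abs_def] z_def
    by (rule derivative_eq_intros refl | simp)+ (simp add: eval_nat_numeral algebra_simps)
  then have "(32 * D2 * z^3 + 8 * (1 + \<sigma>) * z - 4 * \<sigma>) * (sin (\<beta>/2) * cos (\<beta>/2)) = 0"
    by (rule DERIV_local_min[of _ _ _ 1]) (use W_nonneg in auto)
  ultimately have 1: "4 * \<sigma> = 32 * D2 * z^3 + 8 * (1 + \<sigma>) * z" by auto
  have e: "V t = 8 * D2 * (sin (t/2)^2)^4 + 4 * (1 + \<sigma>) * (sin (t/2)^2)^2 - 4 * \<sigma> * sin (t/2)^2 + a0" for t
    by (simp add: W_def)
  have 2: "a0 = 4 * \<sigma> * z - 8 * D2 * z^4 - 4 * (1 + \<sigma>) * z^2"
    using e[of \<beta>] unfolding V_beta z_def[symmetric] by simp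
  define s where "s = sin (t/2)^2"
  have "V t = 8 * D2 * s^4 + 4 * (1 + \<sigma>) * s^2 - 4 * \<sigma> * s + (4 * \<sigma> * z - 8 * D2 * z^4 - 4 * (1 + \<sigma>) * z^2)"
    using e[of t] 2 by (simp add: s_def)
  also have "\<dots> = (s - z)^2 * (8 * D2 * (s\<^sup>2 + 2 * z * s + 3 * z^2) + 4 * (1 + \<sigma>))"
    unfolding 1 by (simp add: eval_nat_numeral algebra_simps)
  also have "\<dots> = (s - z)^2 * Q s" unfolding Q_def z_def by simp
  finally show ?thesis by (simp add: s_def z_def)
qed

lemma sin_half_sq: "sin (t/2)^2 = (1 - cos t) / (2::real)"
  using cos_double_sin[of "t/2"] by simp

lemma V_eq_0_iff: "V t = 0 \<longleftrightarrow> cos t = cos \<beta>"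
proof -
  have "Q (sin (t/2)^2) > 0" by (rule Q_pos) simp
  then show ?thesis unfolding V_factor by (simp add: sin_half_sq)
qed

lemma countable_zeros: "countable {t. V t = 0}"
proof -
  have "{t. V t = 0} \<subseteq> (\<lambda>n. \<beta> + 2 * n * pi) ` \<int> \<union> (\<lambda>n. - \<beta> + 2 * n * pi) ` \<int>"
    by (auto simp: V_eq_0_iff cos_eq)
  moreover have "countable ((\<lambda>n. \<beta> + 2 * n * pi) ` \<int> \<union> (\<lambda>n. - \<beta> + 2 * n * pi) ` \<int>)"
    by (intro countable_Un countable_image countable_int)
  ultimately show ?thesis by (rule countable_subset)
qed

section \<open>The primitive \<open>P\<close> and the costs of transitions\<close>

lemma P_deriv: "(P has_real_derivative 2 * sqrt (V s)) (at s)"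
proof -
  define a b where "a = min (-\<beta>) s - 1" and "b = max (-\<beta>) s + 1"
  have "((\<lambda>u. LBINT t=ereal (-\<beta>)..ereal u. sqrt (V t)) has_vector_derivative sqrt (V s)) (at s within {a..b})"
    by (rule interval_integral_FTC2) (auto simp: a_def b_def intro!: continuous_intros V_continuous)
  then have "((\<lambda>u. LBINT t=ereal (-\<beta>)..ereal u. sqrt (V t)) has_real_derivative sqrt (V s)) (at s)"
    using at_within_Icc_at[of a s b] by (simp add: has_real_derivative_iff_has_vector_derivative a_def b_def)
  then show ?thesis unfolding \<Phi>_def[abs_def] by (auto intro!: derivative_eq_intros)
qed

lemma P_minus_beta [simp]: "P (-\<beta>) = 0"
  by (simp add: \<Phi>_def)

lemma P_mono: "x \<le> y \<Longrightarrow> P x \<le> P y"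
  by (rule DERIV_nonneg_imp_nondecreasing[of x y P]) (use P_deriv W_nonneg in \<open>auto intro!: exI\<close>)

text \<open>If \<open>P x = P y\<close>, then \<open>P\<close> is constant between them and
  \<open>V\<close> vanishes on an interval, although its zero set is countable.\<close>

lemma P_strict_mono: "x < y \<Longrightarrow> P x < P y"
proof (rule ccontr)
  assume xy: "x < y" "\<not> P x < P y"
  have "V t = 0" if t: "t \<in> {x<..<y}" for t
  proof -
    have "((\<lambda>_. P x) has_real_derivative 2 * sqrt (V t)) (at t)"
    proof (rule has_field_derivative_transform_within_open[OF P_deriv, where S="{x<..<y}"])
      fix u assume "u \<in> {x<..<y}"
      then show "P u = P x" using P_mono[of x u] P_mono[of u y] xy by auto
    qed (use t in auto)
    then have "2 * sqrt (V t) = 0" by (rule DERIV_unique) simp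
    then show ?thesis by simp
  qed
  then have "{x<..<y} \<subseteq> {t. V t = 0}" by auto
  then have "countable {x<..<y}" using countable_zeros countable_subset by blast
  then show False using uncountable_open_interval[of x y] xy by blast
qed

text \<open>Symmetries of \<open>V\<close> under translations, and under reflections in the next
  lemma, become identities for \<open>P\<close> by differentiation, without evaluating any
  integral.\<close>

lemma P_diff_const:
  assumes "\<And>t. V (f t) = V t" "\<And>t. (f has_real_derivative 1) (at t)"
  shows "P (f x) - P x = P (f y) - P y"
proof -
  have "((\<lambda>t. P (f t) - P t) has_real_derivative 0) (at t)" for t
    using DERIV_chain2[OF P_deriv assms(2), of t] P_deriv[of t] assms(1)
    by (auto intro!: derivative_eq_intros)
  then show ?thesis using DERIV_isconst_all[of "\<lambda>t. P (f t) - P t" x y] by blast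
qed

lemma P_sum_const:
  assumes "\<And>t. V (f t) = V t" "\<And>t. (f has_real_derivative -1) (at t)"
  shows "P (f x) + P x = P (f y) + P y"
proof -
  have "((\<lambda>t. P (f t) + P t) has_real_derivative 0) (at t)" for t
    using DERIV_chain2[OF P_deriv assms(2), of t] P_deriv[of t] assms(1)
    by (auto intro!: derivative_eq_intros)
  then show ?thesis using DERIV_isconst_all[of "\<lambda>t. P (f t) + P t" x y] by blast
qed

lemma P_shift: "P (x + 2 * pi * of_int k) - P x = P (y + 2 * pi * of_int k) - P y"
  by (rule P_diff_const) (auto simp: V_periodic_int intro!: derivative_eq_intros)

lemma P_beta_pos: "0 < P \<beta>"
  using P_strict_mono[of "-\<beta>" \<beta>] \<beta>_pos by simp

text \<open>From \<open>cos (\<beta> + t) + cos (\<beta> - t) = 2 * cos \<beta> * cos t\<close>,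
  which is at most \<open>2 * cos \<beta>\<close>, the variable \<open>sin (u/2)^2\<close> is at
  least as far from its value at the zero for \<open>u = \<beta> + t\<close> as for
  \<open>u = \<beta> - t\<close>. The cofactor \<open>Q\<close> is also at least as large
  there.\<close>

lemma V_right_ge_left:
  assumes "0 \<le> t" "t \<le> \<beta>"
  shows "V (\<beta> - t) \<le> V (\<beta> + t)"
proof -
  have c: "cos \<beta> > 0" using \<beta>_pos \<beta>_less by (intro cos_gt_zero) auto
  have 1: "cos \<beta> \<le> cos (\<beta> - t)" by (rule cos_monotone_0_pi_le) (use assms \<beta>_less in auto)
  have "cos (\<beta> + t) + cos (\<beta> - t) = 2 * cos \<beta> * cos t" by (simp add: cos_add cos_diff)
  also have "\<dots> \<le> 2 * cos \<beta> * 1" using c by (intro mult_left_mono) auto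
  finally have 2: "cos (\<beta> - t) - cos \<beta> \<le> cos \<beta> - cos (\<beta> + t)" by simp
  have "\<bar>sin ((\<beta>-t)/2)^2 - sin (\<beta>/2)^2\<bar> \<le> \<bar>sin ((\<beta>+t)/2)^2 - sin (\<beta>/2)^2\<bar>"
  proof -
    have d: "sin (u/2)^2 - sin (\<beta>/2)^2 = (cos \<beta> - cos u) / 2" for u by (simp add: sin_half_sq field_simps)
    have "\<bar>cos \<beta> - cos (\<beta> - t)\<bar> \<le> \<bar>cos \<beta> - cos (\<beta> + t)\<bar>" using 1 2 by linarith
    then show ?thesis unfolding d abs_divide by (rule divide_right_mono) simp
  qed
  then have "(sin ((\<beta>-t)/2)^2 - sin (\<beta>/2)^2)^2 \<le> (sin ((\<beta>+t)/2)^2 - sin (\<beta>/2)^2)^2"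
    by (simp add: abs_le_square_iff)
  moreover have "Q (sin ((\<beta>-t)/2)^2) \<le> Q (sin ((\<beta>+t)/2)^2)"
    by (rule Q_mono) (use 1 2 in \<open>auto simp: sin_half_sq\<close>)
  ultimately show ?thesis unfolding V_factor by (intro mult_mono) (auto intro: less_imp_le[OF Q_pos])
qed

text \<open>Here \<open>\<beta> < \<pi>/2\<close> is essential: by \<open>cos \<beta> > 0\<close>, \<open>W\<close> is larger at \<open>\<beta> + t\<close> than at \<open>\<beta> - t\<close>.\<close>

lemma P_long_way: "P \<beta> < P (2 * pi - \<beta>) - P \<beta>"
proof -
  have e: "P (-t) + P t = P (-0) + P 0" for t
    by (rule P_sum_const) (auto simp: V_even intro!: derivative_eq_intros)
  have 1: "2 * P 0 = P \<beta>" using e[of \<beta>] by simp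
  have V2: "V (2 * pi - t) = V t" for t using V_periodic[of "-t"] V_even[of t] by (simp add: algebra_simps)
  have "P (2 * pi - \<beta>) + P \<beta> = P (2 * pi - pi) + P pi"
    by (rule P_sum_const) (auto simp: V2 intro!: derivative_eq_intros)
  then have 2: "P (2 * pi - \<beta>) + P \<beta> = 2 * P pi" by simp
  \<comment> \<open>By the reflections about 0 and \<open>pi\<close> it suffices to compare halves.
    Half of the short way, from 0 to \<open>\<beta>\<close>, costs at most as much as the stretch
    from \<open>\<beta>\<close> to \<open>2 * \<beta>\<close>, which is a proper part of half of the
    long way, from \<open>\<beta>\<close> to \<open>pi\<close>.\<close>
  have "(P (\<beta> + 0) + P (\<beta> - 0)) \<le> P (\<beta> + \<beta>) + P (\<beta> - \<beta>)"
  proof (rule DERIV_nonneg_imp_nondecreasing[of 0 \<beta> "\<lambda>t. P (\<beta> + t) + P (\<beta> - t)"])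
    fix t assume t: "0 \<le> t" "t \<le> \<beta>"
    have "((\<lambda>t. P (\<beta> + t) + P (\<beta> - t)) has_real_derivative 2 * sqrt (V (\<beta> + t)) - 2 * sqrt (V (\<beta> - t))) (at t)"
      by (rule derivative_eq_intros DERIV_chain2[OF P_deriv] refl | simp)+
    then show "\<exists>y. ((\<lambda>t. P (\<beta> + t) + P (\<beta> - t)) has_real_derivative y) (at t) \<and> 0 \<le> y"
      using V_right_ge_left[OF t] by (intro exI conjI) (assumption, simp)
  qed (use \<beta>_pos in auto)
  then have "2 * P \<beta> \<le> P (2 * \<beta>) + P 0" by simp
  moreover have "P (2 * \<beta>) < P pi" using \<beta>_less by (intro P_strict_mono) auto
  ultimately show ?thesis using 1 2 by linarith
qed

lemma ex_period_rep:
  obtains k :: int where "t - 2 * pi * of_int k \<in> {-pi..pi}"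
proof
  define k where "k = \<lfloor>(t + pi) / (2 * pi)\<rfloor>"
  have "of_int k \<le> (t + pi) / (2 * pi)" "(t + pi) / (2 * pi) < of_int k + 1" by (auto simp: k_def)
  then show "t - 2 * pi * of_int k \<in> {-pi..pi}" by (auto simp: field_simps)
qed

text \<open>Compactness of one period with neighbourhoods of \<open>\<beta>\<close> and
  \<open>-\<beta>\<close> removed, followed by periodicity. It turns a small integral of
  \<open>V\<close> into a small set of points away from all wells.\<close>

lemma V_away:
  assumes "\<eta> > 0"
  obtains w where "w > 0"
    "\<And>t. (\<And>k::int. \<eta> \<le> \<bar>t - 2 * pi * of_int k - \<beta>\<bar> \<and> \<eta> \<le> \<bar>t - 2 * pi * of_int k + \<beta>\<bar>) \<Longrightarrow> w \<le> V t"
proof -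
  define C where "C = {t \<in> {-pi..pi}. \<eta> \<le> \<bar>t - \<beta>\<bar> \<and> \<eta> \<le> \<bar>t + \<beta>\<bar>}"
  have "C = {-pi..pi} \<inter> {t. \<eta> \<le> \<bar>t - \<beta>\<bar>} \<inter> {t. \<eta> \<le> \<bar>t + \<beta>\<bar>}" by (auto simp: C_def)
  moreover have "closed {t. \<eta> \<le> \<bar>t - \<beta>\<bar>}" "closed {t. \<eta> \<le> \<bar>t + \<beta>\<bar>}"
    by (intro closed_Collect_le continuous_intros)+
  ultimately have cC: "compact C" by (simp add: compact_Int_closed)
  obtain w where w: "w > 0" "\<And>t. t \<in> C \<Longrightarrow> w \<le> V t"
  proof (cases "C = {}")
    case True then show ?thesis using that[of 1] by auto
  next
    case False
    obtain t where t: "t \<in> C" "\<And>s. s \<in> C \<Longrightarrow> V t \<le> V s"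
      using continuous_attains_inf[OF cC False V_continuous] by blast
    have "t \<in> {-pi..pi}" "t \<noteq> \<beta>" "t \<noteq> -\<beta>" using t assms by (auto simp: C_def)
    then have "V t \<noteq> 0" using W_zeros by blast
    then show ?thesis using that[of "V t"] t(2) W_nonneg[of t] by force
  qed
  show ?thesis
  proof (rule that[OF w(1)])
    fix t assume t: "\<And>k::int. \<eta> \<le> \<bar>t - 2 * pi * of_int k - \<beta>\<bar> \<and> \<eta> \<le> \<bar>t - 2 * pi * of_int k + \<beta>\<bar>"
    obtain k :: int where k: "t - 2 * pi * of_int k \<in> {-pi..pi}" using ex_period_rep .
    have "w \<le> V (t - 2 * pi * of_int k)" using k t[of k] by (intro w(2)) (simp add: C_def)
    then show "w \<le> V t" using V_periodic_int[of "t - 2 * pi * of_int k" k] by simp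
  qed
qed

lemma V_bounded: obtains M where "M > 0" "\<And>t. V t \<le> M"
proof
  define M where "M = 8 * D2 + 4 * (1 + \<sigma>) + \<bar>a0\<bar> + 1"
  show "M > 0" using D2_pos \<sigma>_pos by (simp add: M_def)
  fix t :: real
  have s: "0 \<le> sin (t/2)^2" "sin (t/2)^2 \<le> 1" by (simp_all add: abs_square_le_1)
  have "(sin (t/2)^2)^4 \<le> 1" "(sin (t/2)^2)^2 \<le> 1" by (rule power_le_one[OF s])+
  then have "8 * D2 * (sin (t/2))^8 \<le> 8 * D2" "4 * (1+\<sigma>) * (sin (t/2))^4 \<le> 4 * (1+\<sigma>)" "0 \<le> 4 * \<sigma> * sin (t/2)^2"
    using D2_pos \<sigma>_pos by simp_all
  then show "V t \<le> M" unfolding W_def M_def by linarith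
qed

end

subsection \<open>The recovery sequence\<close>

lemma AC_deriv_integral:
  assumes "continuous_on {a..b} f"
  shows "AC_deriv a b (\<lambda>x. C + integral {a..x} f) f"
  by (rule AC_derivI[OF absolutely_integrable_continuous_real[OF assms]]) simp

lemma borel_measurable_lebesgue_onI:
  fixes f :: "real \<Rightarrow> real"
  assumes "f \<in> borel_measurable borel"
  shows "f \<in> borel_measurable (lebesgue_on S)"
proof -
  have "f \<in> borel_measurable lborel" using assms by simp
  then have "f \<in> borel_measurable lebesgue" by (rule measurable_completion)
  then show ?thesis by (rule measurable_restrict_space1)
qed

lemma absolutely_integrable_bounded_measurable:
  fixes f :: "real \<Rightarrow> real"
  assumes "f \<in> borel_measurable (lebesgue_on {a..b})" "\<And>x. x \<in> {a..b} \<Longrightarrow> \<bar>f x\<bar> \<le> B"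
  shows "f absolutely_integrable_on {a..b}"
  by (rule measurable_bounded_by_integrable_imp_absolutely_integrable[OF assms(1), where g="\<lambda>_. B"])
    (use assms(2) in auto)

lemma integral_le_AE:
  fixes f g :: "real \<Rightarrow> real"
  assumes "f integrable_on {a..b}" "g integrable_on {a..b}" "AE x in lebesgue_on {a..b}. f x \<le> g x"
  shows "integral {a..b} f \<le> integral {a..b} g"
proof -
  have N: "negligible {x \<in> {a..b}. \<not> f x \<le> g x}" using assms(3) by (subst (asm) AE_lebesgue_on_iff) auto
  have "(\<lambda>x. min (f x) (g x)) integrable_on {a..b}"
    by (rule integrable_spike[OF assms(1) N]) auto
  then have "integral {a..b} (\<lambda>x. min (f x) (g x)) \<le> integral {a..b} g"
    by (rule integral_le) (use assms in auto)
  moreover have "integral {a..b} f = integral {a..b} (\<lambda>x. min (f x) (g x))"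
    by (rule integral_spike[OF N]) auto
  ultimately show ?thesis by simp
qed

context wells
begin

text \<open>The layer solves \<open>c' = sqrt (V c + d)\<close>, the equipartition equation
  regularized by \<open>d\<close>. Since \<open>V\<close> has double zeros, the wells would be
  reached only after infinite time for \<open>d = 0\<close>; for \<open>d > 0\<close> the time
  \<open>T\<close> from 0 to \<open>\<beta>\<close> is finite. The solution is the inverse of the
  travel time \<open>\<tau>\<close>, and it is odd because \<open>V\<close> is even.\<close>

lemma transition_profile:
  assumes "d > 0"
  obtains c k :: "real \<Rightarrow> real" and T where "T > 0" "continuous_on UNIV c" "\<And>y. c (-y) = - c y"
    "\<And>y. T \<le> y \<Longrightarrow> c y = \<beta>" "\<And>y. \<bar>y\<bar> < T \<Longrightarrow> k y = sqrt (V (c y) + d)" "\<And>y. \<bar>y\<bar> \<ge> T \<Longrightarrow> k y = 0"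
    "\<And>y. \<bar>y\<bar> \<noteq> T \<Longrightarrow> (c has_real_derivative k y) (at y)" "k \<in> borel_measurable borel"
proof -
  define \<phi> where "\<phi> t = sqrt (V t + d)" for t
  have \<phi>p: "\<phi> t > 0" for t using W_nonneg[of t] assms by (simp add: \<phi>_def add_nonneg_pos)
  have \<phi>c: "continuous_on S \<phi>" for S unfolding \<phi>_def[abs_def] by (intro continuous_intros V_continuous)
  have \<phi>e: "\<phi> (-t) = \<phi> t" for t by (simp add: \<phi>_def V_even)
  obtain M where M: "\<And>t. V t \<le> M" using V_bounded by metis
  have \<phi>M: "\<phi> t \<le> sqrt (M + d)" for t using M[of t] by (simp add: \<phi>_def)
  have Mp: "sqrt (M + d) > 0" using \<phi>p[of 0] \<phi>M[of 0] by linarith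
  have "continuous_on UNIV (\<lambda>t. 1 / \<phi> t)" using \<phi>p by (intro continuous_intros \<phi>c) (metis less_irrefl)
  then obtain R where R: "\<And>t. (R has_real_derivative 1 / \<phi> t) (at t)" using ex_antiderivative by metis
  define \<tau> where "\<tau> t = R t - R 0" for t
  have \<tau>D: "(\<tau> has_real_derivative 1 / \<phi> t) (at t)" for t
    unfolding \<tau>_def[abs_def] using R[of t] by (auto intro!: derivative_eq_intros)
  have \<tau>0: "\<tau> 0 = 0" by (simp add: \<tau>_def)
  have \<tau>c: "isCont \<tau> t" for t using \<tau>D DERIV_isCont by blast
  have \<tau>m: "\<tau> s < \<tau> t" if "s < t" for s t
    by (rule DERIV_pos_imp_increasing[OF that]) (use \<tau>D \<phi>p in \<open>metis divide_pos_pos zero_less_one\<close>)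
  then have \<tau>i: "inj \<tau>" by (metis injI linorder_neqE_linordered_idom less_irrefl)
  have \<tau>o: "\<tau> (-t) = - \<tau> t" for t
  proof -
    have "((\<lambda>t. \<tau> (-t) + \<tau> t) has_real_derivative 0) (at t)" for t
      by (rule derivative_eq_intros DERIV_chain2[OF \<tau>D] \<tau>D refl | simp add: \<phi>e)+
    then have "\<tau> (-t) + \<tau> t = \<tau> (-0) + \<tau> 0" using DERIV_isconst_all[of "\<lambda>t. \<tau> (-t) + \<tau> t" t 0] by blast
    then show ?thesis using \<tau>0 by simp
  qed
  define \<kappa> where "\<kappa> = 1 / sqrt (M + d)"
  have \<kappa>: "\<kappa> > 0" using Mp by (simp add: \<kappa>_def)
  \<comment> \<open>The speed \<open>\<phi>\<close> is bounded, so travel times grow at least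
    linearly; with oddness this makes \<open>\<tau>\<close> surjective and the inverse
    global.\<close>
  have grow: "\<tau> t \<ge> \<kappa> * t" if "t \<ge> 0" for t
  proof -
    have "\<tau> 0 - \<kappa> * 0 \<le> \<tau> t - \<kappa> * t"
    proof (rule DERIV_nonneg_imp_nondecreasing[OF that, of "\<lambda>t. \<tau> t - \<kappa> * t"])
      fix x
      have "((\<lambda>t. \<tau> t - \<kappa> * t) has_real_derivative 1 / \<phi> x - \<kappa>) (at x)"
        using \<tau>D[of x] by (auto intro!: derivative_eq_intros)
      moreover have "\<kappa> \<le> 1 / \<phi> x" unfolding \<kappa>_def using \<phi>M[of x] \<phi>p[of x] by (intro divide_left_mono) (auto intro: mult_pos_pos Mp)
      ultimately show "\<exists>y. ((\<lambda>t. \<tau> t - \<kappa> * t) has_real_derivative y) (at x) \<and> 0 \<le> y" by (intro exI[of _ "1 / \<phi> x - \<kappa>"]) simp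
    qed
    then show ?thesis using \<tau>0 by simp
  qed
  have "surj \<tau>"
    unfolding surj_def
  proof
    fix y
    define z where "z = \<bar>y\<bar> / \<kappa>"
    have z: "z \<ge> 0" "\<kappa> * z = \<bar>y\<bar>" using \<kappa> by (auto simp: z_def)
    have "\<tau> z \<ge> \<bar>y\<bar>" using grow[OF z(1)] z by simp
    then have "\<tau> (-z) \<le> y" "y \<le> \<tau> z" using \<tau>o[of z] by linarith+
    then show "\<exists>x. y = \<tau> x" using IVT[of \<tau> "-z" y z] z \<tau>c by force
  qed
  with \<tau>i have bij: "bij \<tau>" by (simp add: bij_def)
  define S where "S = inv \<tau>"
  have S1: "\<tau> (S y) = y" for y unfolding S_def using bij by (simp add: bij_def surj_f_inv_f)
  have S2: "S (\<tau> t) = t" for t unfolding S_def using \<tau>i by simp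
  have Sc: "isCont S y" for y
    using isCont_inverse_function[of 1 "S y" S \<tau>] S1 S2 \<tau>c by auto
  have SD: "(S has_real_derivative \<phi> (S y)) (at y)" for y
  proof -
    have "(S has_real_derivative inverse (1 / \<phi> (S y))) (at y)"
      by (rule DERIV_inverse_function[where f=\<tau> and a="y-1" and b="y+1"])
        (use \<tau>D S1 Sc \<phi>p[of "S y"] in auto)
    then show ?thesis by simp
  qed
  have Sm: "S y < S z" if "y < z" for y z using that \<tau>m S1 by (metis not_less_iff_gr_or_eq)
  have So: "S (-y) = - S y" for y using \<tau>o[of "S y"] S1 S2 by metis
  define T where "T = \<tau> \<beta>"
  have Tp: "T > 0" using \<tau>m[OF \<beta>_pos] \<tau>0 by (simp add: T_def)
  have ST: "S T = \<beta>" "S (-T) = -\<beta>" using S2 So by (auto simp: T_def)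
  \<comment> \<open>Clamping stops the solution when it reaches a well. The resulting kinks at
    \<open>T\<close> and \<open>-T\<close> are why differentiability is claimed only for
    \<open>\<bar>y\<bar> \<noteq> T\<close>.\<close>
  define c where "c y = max (-\<beta>) (min \<beta> (S y))" for y
  define k where "k y = (if \<bar>y\<bar> < T then \<phi> (S y) else 0)" for y
  have c1: "c y = S y" if "\<bar>y\<bar> \<le> T" for y
  proof -
    have "S y \<le> \<beta>" "-\<beta> \<le> S y" using that ST Sm[of y T] Sm[of "-T" y] by (cases "y = T"; cases "y = -T"; auto simp: abs_le_iff)+
    then show ?thesis by (simp add: c_def)
  qed
  have c2: "c y = \<beta>" if "T \<le> y" for y
  proof -
    have "\<beta> \<le> S y" using that ST Sm[of T y] by (cases "y = T") auto
    then show ?thesis using \<beta>_pos by (simp add: c_def)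
  qed
  have co: "c (-y) = - c y" for y using \<beta>_pos by (auto simp: c_def So)
  have c3: "c y = -\<beta>" if "y \<le> -T" for y using c2[of "-y"] co[of y] that by simp
  show ?thesis
  proof (rule that[OF Tp])
    have "continuous_on UNIV S" using Sc by (simp add: continuous_on_eq_continuous_at)
    then show "continuous_on UNIV c" unfolding c_def[abs_def] by (intro continuous_intros)
    show "c (-y) = - c y" for y by (rule co)
    show "c y = \<beta>" if "T \<le> y" for y using that by (rule c2)
    show "k y = sqrt (V (c y) + d)" if "\<bar>y\<bar> < T" for y using that c1[of y] by (simp add: k_def \<phi>_def)
    show "k y = 0" if "\<bar>y\<bar> \<ge> T" for y using that by (simp add: k_def)
    show "(c has_real_derivative k y) (at y)" if "\<bar>y\<bar> \<noteq> T" for y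
    proof -
      have "\<bar>y\<bar> < T \<or> y > T \<or> y < -T" using that by (auto simp: abs_if split: if_splits)
      then consider "\<bar>y\<bar> < T" | "y > T" | "y < -T" by blast
      then show ?thesis
      proof cases
        case 1
        have "(c has_real_derivative \<phi> (S y)) (at y)"
          by (rule has_field_derivative_transform_within_open[OF SD, where S="{-T<..<T}"]) (use 1 c1 in auto)
        then show ?thesis using 1 by (simp add: k_def)
      next
        case 2
        have "(c has_real_derivative 0) (at y)"
          by (rule has_field_derivative_transform_within_open[OF DERIV_const[of \<beta>], where S="{T<..}"]) (use 2 c2 in auto)
        then show ?thesis using 2 Tp by (simp add: k_def)
      next
        case 3
        have "(c has_real_derivative 0) (at y)"
          by (rule has_field_derivative_transform_within_open[OF DERIV_const[of "-\<beta>"], where S="{..<-T}"]) (use 3 c3 in auto)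
        then show ?thesis using 3 Tp by (simp add: k_def)
      qed
    qed
    have "(\<lambda>y. \<phi> (S y)) \<in> borel_measurable borel"
      by (intro borel_measurable_continuous_onI continuous_on_compose2[OF \<phi>c \<open>continuous_on UNIV S\<close>]) auto
    then show "k \<in> borel_measurable borel" unfolding k_def[abs_def] by measurable
  qed
qed

text \<open>The layer, compressed by \<open>\<epsilon>\<close>, is centred at \<open>-l/2\<close>
  and, reflected, at \<open>l/2\<close>. The resulting \<open>\<theta>\<close> is even, equals
  \<open>\<beta>\<close> at 0 and \<open>-\<beta>\<close> at both ends, and each layer costs at most
  \<open>P \<beta> + \<delta> / 2\<close>.\<close>

lemma recovery_sequence:
  assumes "l > 0" "D1 > 0" "\<delta> > 0"
  obtains \<epsilon>0 where "\<epsilon>0 > 0" "\<And>\<epsilon>. 0 < \<epsilon> \<Longrightarrow> \<epsilon> < \<epsilon>0 \<Longrightarrow>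
    \<exists>\<theta> g. (\<theta>, g) \<in> Y_C l \<and> F_C \<sigma> D1 D2 a0 l \<epsilon> \<theta> g \<le> 2 * P \<beta> + \<delta>"
proof -
  \<comment> \<open>As \<open>sqrt (V + d) \<le> sqrt V + sqrt d\<close>, the regularization adds at
    most \<open>2 * sqrt d\<close> times the distance \<open>2 * \<beta>\<close> of the wells to
    each of the two layers, which is \<open>\<delta>\<close> in total.\<close>
  define d where "d = (\<delta> / (8 * \<beta>))^2"
  have d: "d > 0" "8 * \<beta> * sqrt d = \<delta>" using assms \<beta>_pos by (auto simp: d_def)
  obtain c k T where T: "T > 0" and cc: "continuous_on UNIV c" and co: "\<And>y. c (-y) = - c y"
    and cT: "\<And>y. T \<le> y \<Longrightarrow> c y = \<beta>" and k1: "\<And>y. \<bar>y\<bar> < T \<Longrightarrow> k y = sqrt (V (c y) + d)"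
    and k2: "\<And>y. \<bar>y\<bar> \<ge> T \<Longrightarrow> k y = 0"
    and cD: "\<And>y. \<bar>y\<bar> \<noteq> T \<Longrightarrow> (c has_real_derivative k y) (at y)" and km: "k \<in> borel_measurable borel"
  proof -
    show ?thesis by (rule transition_profile[OF d(1)], rule that; assumption)
  qed
  have cV: "V (c y) = 0" if "\<bar>y\<bar> \<ge> T" for y
  proof -
    have "c y = \<beta> \<or> c y = -\<beta>" using cT[of y] cT[of "-y"] co[of y] that by (cases "y \<ge> 0") auto
    then show ?thesis using V_beta by metis
  qed
  obtain M where M: "\<And>t. V t \<le> M" using V_bounded by metis
  have kb: "0 \<le> k y" "k y \<le> sqrt (M + d)" for y
    using k1[of y] k2[of y] M[of "c y"] W_nonneg[of "c y"] d(1) by (cases "\<bar>y\<bar> < T"; simp)+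
  show ?thesis
  \<comment> \<open>Below this threshold the half-width \<open>\<epsilon> * T\<close> of a layer is
    less than \<open>l/2\<close>, so both layers stay clear of 0 and of the endpoints.\<close>
  proof (rule that[of "l / (2 * T)"])
    show "l / (2 * T) > 0" using assms T by simp
    fix \<epsilon> :: real assume \<epsilon>: "0 < \<epsilon>" "\<epsilon> < l / (2 * T)"
    then have \<epsilon>T: "\<epsilon> * T < l / 2" using T by (simp add: field_simps)
    define \<theta> where "\<theta> x = c ((l/2 - \<bar>x\<bar>) / \<epsilon>)" for x
    define h where "h x = - sgn x / \<epsilon> * k ((l/2 - \<bar>x\<bar>) / \<epsilon>)" for x
    define I where "I = {-l<..<l}"
    have ll: "-l < l" using assms by simp
    have \<theta>c: "continuous_on S \<theta>" for S
      unfolding \<theta>_def[abs_def] by (rule continuous_on_compose2[OF cc]) (use \<epsilon> in \<open>auto intro!: continuous_intros\<close>)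
    have hm: "h \<in> borel_measurable borel"
      unfolding h_def[abs_def] using km by measurable
    have hb: "\<bar>h x\<bar> \<le> 1 / \<epsilon> * sqrt (M + d)" for x
      unfolding h_def abs_mult using kb[of "(l/2 - \<bar>x\<bar>) / \<epsilon>"] \<epsilon> by (intro mult_mono) (auto simp: sgn_if)
    have hi: "h absolutely_integrable_on {a..b}" for a b
      by (rule absolutely_integrable_bounded_measurable[OF borel_measurable_lebesgue_onI[OF hm] hb])
    have h2: "in_Lp 2 I h" unfolding I_def
      by (rule in_Lp_bounded[OF borel_measurable_lebesgue_onI[OF hm] hb])
    have \<theta>h: "AC_deriv (-l) l \<theta> h"
    \<comment> \<open>The exceptional points are the kinks where a layer meets a well, and 0, where
      \<open>\<bar>x\<bar>\<close> is not differentiable.\<close>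
    proof (rule AC_deriv_finite[where S="{0, l/2 - \<epsilon>*T, l/2 + \<epsilon>*T, -(l/2 - \<epsilon>*T), -(l/2 + \<epsilon>*T)}"])
      fix x assume x: "x \<in> {-l<..<l} - {0, l/2 - \<epsilon>*T, l/2 + \<epsilon>*T, -(l/2 - \<epsilon>*T), -(l/2 + \<epsilon>*T)}"
      have "\<bar>(l/2 - \<bar>x\<bar>) / \<epsilon>\<bar> \<noteq> T"
      proof
        assume "\<bar>(l/2 - \<bar>x\<bar>) / \<epsilon>\<bar> = T"
        then have "\<bar>l/2 - \<bar>x\<bar>\<bar> = \<epsilon> * T" using \<epsilon> by (simp add: field_simps)
        then show False using x by (auto simp: abs_if split: if_splits)
      qed
      then have 1: "(c has_real_derivative k ((l/2 - \<bar>x\<bar>) / \<epsilon>)) (at ((l/2 - \<bar>x\<bar>) / \<epsilon>))" by (rule cD)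
      have 2: "((\<lambda>x. (l/2 - \<bar>x\<bar>) / \<epsilon>) has_real_derivative - sgn x / \<epsilon>) (at x)"
      proof (cases "x > 0")
        case True
        have "((\<lambda>x. (l/2 - x) / \<epsilon>) has_real_derivative - sgn x / \<epsilon>) (at x)"
          using True \<epsilon> by (auto intro!: derivative_eq_intros)
        then show ?thesis
          by (rule has_field_derivative_transform_within_open[where S="{0<..}"]) (use True in auto)
      next
        case False
        then have "x < 0" using x by auto
        then have "((\<lambda>x. (l/2 + x) / \<epsilon>) has_real_derivative - sgn x / \<epsilon>) (at x)"
          using \<epsilon> by (auto intro!: derivative_eq_intros)
        then show ?thesis
          by (rule has_field_derivative_transform_within_open[where S="{..<0}"]) (use \<open>x < 0\<close> in auto)
      qed
      show "(\<theta> has_real_derivative h x) (at x)"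
        using DERIV_chain2[where f=c and g="\<lambda>x. (l/2 - \<bar>x\<bar>) / \<epsilon>" and x=x, OF 1 2]
        unfolding \<theta>_def[abs_def] h_def by (simp add: mult.commute)
    qed (use \<theta>c hi in auto)
    \<comment> \<open>With \<open>g' = p\<close> both \<open>g' + sin \<theta>\<close> and its
      derivative \<open>g'' + cos \<theta> * \<theta>'\<close> vanish, and only the last two terms
      of the energy remain.\<close>
    define p where "p x = - sin (\<theta> x)" for x
    define g where "g x = 0 + integral {-l..x} p" for x
    have pc: "continuous_on S p" for S unfolding p_def[abs_def] by (intro continuous_intros \<theta>c)
    have gp: "AC_deriv (-l) l g p" unfolding g_def[abs_def] by (rule AC_deriv_integral[OF pc])
    have ph: "AC_deriv (-l) l p (\<lambda>x. - cos (\<theta> x) * h x)"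
      unfolding p_def[abs_def] by (rule AC_deriv_chain[OF \<theta>h]) (use ll in \<open>auto intro!: derivative_eq_intros continuous_intros\<close>)
    have p2: "in_Lp 2 I p" unfolding I_def by (rule in_Lp_continuous[OF pc])
    have q2: "in_Lp 2 I (\<lambda>x. - cos (\<theta> x) * h x)"
      unfolding I_def
    proof (rule in_Lp_bounded)
      show "(\<lambda>x. - cos (\<theta> x) * h x) \<in> borel_measurable (lebesgue_on {-l<..<l})"
        by (intro borel_measurable_lebesgue_onI borel_measurable_times hm borel_measurable_continuous_onI continuous_intros \<theta>c)
      show "\<bar>- cos (\<theta> x) * h x\<bar> \<le> 1 * (1 / \<epsilon> * sqrt (M + d))" for x
        unfolding abs_mult by (rule mult_mono) (use hb in auto)
    qed
    note w\<theta> = AC_deriv_W12[OF \<theta>h ll h2[unfolded I_def], folded I_def]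
    note wg = AC_deriv_W12[OF gp ll p2[unfolded I_def], folded I_def]
    note wp = in_W12_AE[OF ph ll q2[unfolded I_def] wg(2)[unfolded I_def], folded I_def]
    have per: "\<theta> (-l) = \<theta> l" "p (-l) = p l" by (auto simp: \<theta>_def p_def)
    have gper: "g (-l) = g l"
    proof -
      \<comment> \<open>On each half of the interval \<open>p\<close> is a translate or a reflected
        translate of \<open>q\<close> on \<open>[-l/2, l/2]\<close>. Since \<open>q\<close> is odd,
        its primitive \<open>K\<close> is even and both halves contribute zero to the increment of
        \<open>g\<close>.\<close>
      define q where "q y = - sin (c (y / \<epsilon>))" for y
      have "continuous_on UNIV (\<lambda>y. c (y / \<epsilon>))"
        by (rule continuous_on_compose2[OF cc]) (use \<epsilon> in \<open>auto intro!: continuous_intros\<close>)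
      then have "continuous_on UNIV q" unfolding q_def[abs_def] by (intro continuous_intros)
      then obtain K where K: "\<And>y. (K has_real_derivative q y) (at y)" using ex_antiderivative by metis
      have qo: "q (-y) = - q y" for y using co[of "y/\<epsilon>"] by (simp add: q_def)
      have "((\<lambda>y. K y - K (-y)) has_real_derivative 0) (at y)" for y
        by (rule derivative_eq_intros DERIV_chain2[OF K] K refl | simp add: qo)+
      then have "K (l/2) - K (-(l/2)) = K 0 - K (-0)" using DERIV_isconst_all[of "\<lambda>y. K y - K (-y)" "l/2" 0] by blast
      then have Ke: "K (l/2) = K (-l/2)" by simp
      have "(p has_integral K (l/2 + 0) - K (l/2 + -l)) {-l..0}"
      proof (rule fundamental_theorem_of_calculus[where f="\<lambda>x. K (l/2 + x)"])
        fix x assume "x \<in> {-l..0}"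
        then have "p x = q (l/2 + x)" by (simp add: p_def q_def \<theta>_def)
        moreover have "((\<lambda>x. K (l/2 + x)) has_real_derivative q (l/2 + x) * 1) (at x)"
          by (rule DERIV_chain2[OF K]) (auto intro!: derivative_eq_intros)
        ultimately show "((\<lambda>x. K (l/2 + x)) has_vector_derivative p x) (at x within {-l..0})"
          by (metis has_real_derivative_iff_has_vector_derivative has_vector_derivative_at_within mult.right_neutral)
      qed (use assms in simp)
      moreover have "(p has_integral (- K (l/2 - l)) - (- K (l/2 - 0))) {0..l}"
      proof (rule fundamental_theorem_of_calculus[where f="\<lambda>x. - K (l/2 - x)"])
        fix x assume "x \<in> {0..l}"
        then have "p x = q (l/2 - x)" by (simp add: p_def q_def \<theta>_def)
        moreover have "((\<lambda>x. - K (l/2 - x)) has_real_derivative - (q (l/2 - x) * (-1))) (at x)"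
          by (rule DERIV_minus, rule DERIV_chain2[OF K]) (auto intro!: derivative_eq_intros)
        ultimately show "((\<lambda>x. - K (l/2 - x)) has_vector_derivative p x) (at x within {0..l})"
          by (simp add: has_real_derivative_iff_has_vector_derivative has_vector_derivative_at_within)
      qed (use assms in simp)
      ultimately have "(p has_integral (K (l/2 + 0) - K (l/2 + -l)) + ((- K (l/2 - l)) - (- K (l/2 - 0)))) {-l..l}"
        by (rule has_integral_combine[rotated 2]) (use assms in auto)
      then have "integral {-l..l} p = 0" using Ke by (auto dest: integral_unique)
      then show ?thesis by (simp add: g_def)
    qed
    have Y: "(\<theta>, g) \<in> Y_C l"
      unfolding Y_C_def Let_def in_W22_def
    proof (clarsimp simp flip: I_def, intro conjI)
      show "in_W12 I \<theta>" "in_W12 I g" "in_W12 I (weak_deriv I g)" using w\<theta> wg wp by auto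
      show "bdry_trace I \<theta> (-l) = bdry_trace I \<theta> l"
        using per bdry_trace_continuous[OF ll _ \<theta>c, of _ \<theta>] by (simp add: I_def)
      show "bdry_trace I g (-l) = bdry_trace I g l"
        using gper bdry_trace_continuous[OF ll _ AC_deriv_continuous[OF gp], of _ g] by (simp add: I_def)
      show "bdry_trace I (weak_deriv I g) (-l) = bdry_trace I (weak_deriv I g) l"
        using per bdry_trace_continuous[OF ll _ pc wg(2)[unfolded I_def]] by (simp add: I_def)
    qed
    define e where "e x = \<epsilon> * (h x)\<^sup>2 + 1 / \<epsilon> * V (\<theta> x)" for x
    have ei: "e absolutely_integrable_on {-l..l}"
      unfolding e_def[abs_def]
    proof (intro set_integral_add set_integrable_mult_right)
      show "(\<lambda>x. (h x)\<^sup>2) absolutely_integrable_on {-l..l}" using in_L2D(2) h2 I_def by blast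
      show "(\<lambda>x. V (\<theta> x)) absolutely_integrable_on {-l..l}"
        by (intro absolutely_integrable_continuous_real continuous_on_compose2[OF V_continuous \<theta>c]) auto
    qed
    have "F_C \<sigma> D1 D2 a0 l \<epsilon> \<theta> g = integral {-l..l} e"
      unfolding F_C_def Let_def
    proof (rule LINT_Ioo_AE(2)[OF _ ei], fold I_def)
      show "AE x in lebesgue_on I. D1 * \<epsilon> * (weak_deriv I (weak_deriv I g) x + cos (\<theta> x) * weak_deriv I \<theta> x)\<^sup>2 +
              D2 / (2 * \<epsilon>) * (weak_deriv I g x + sin (\<theta> x)) ^ 4 +
              1 / \<epsilon> * (weak_deriv I g x + sin (\<theta> x))\<^sup>2 +
              4 * D2 / \<epsilon> * (weak_deriv I g x + sin (\<theta> x))\<^sup>2 * sin (\<theta> x / 2) ^ 4 +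
              \<epsilon> * (weak_deriv I \<theta> x)\<^sup>2 + 1 / \<epsilon> * V (\<theta> x) = e x"
        using w\<theta>(2) wg(2) wp(2) by eventually_elim (simp add: e_def p_def)
    qed
    also have "\<dots> \<le> 2 * P \<beta> + \<delta>"
    proof -
      define \<phi> where "\<phi> t = 2 * sqrt (V t + d)" for t
      have \<phi>c: "continuous_on UNIV \<phi>" unfolding \<phi>_def[abs_def] by (intro continuous_intros V_continuous)
      then obtain G where G: "\<And>t. (G has_real_derivative \<phi> t) (at t)" using ex_antiderivative by metis
      have G\<beta>: "G \<beta> - G (-\<beta>) \<le> P \<beta> + 4 * \<beta> * sqrt d"
      proof -
        have "P (-\<beta>) + 2 * sqrt d * (-\<beta>) - G (-\<beta>) \<le> P \<beta> + 2 * sqrt d * \<beta> - G \<beta>"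
        proof (rule DERIV_nonneg_imp_nondecreasing[where f="\<lambda>t. P t + 2 * sqrt d * t - G t"])
          fix t
          have "((\<lambda>t. P t + 2 * sqrt d * t - G t) has_real_derivative 2 * sqrt (V t) + 2 * sqrt d - \<phi> t) (at t)"
            using P_deriv[of t] G[of t] by (auto intro!: derivative_eq_intros)
          moreover have "\<phi> t \<le> 2 * sqrt (V t) + 2 * sqrt d"
            unfolding \<phi>_def using sqrt_add_le_add_sqrt[of "V t" d] W_nonneg[of t] d(1) by simp
          ultimately show "\<exists>y. ((\<lambda>t. P t + 2 * sqrt d * t - G t) has_real_derivative y) (at t) \<and> 0 \<le> y"
            by (intro exI[of _ "2 * sqrt (V t) + 2 * sqrt d - \<phi> t"]) simp
        qed (use \<beta>_pos in simp)
        then show ?thesis by (simp add: algebra_simps)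
      qed
      have GA: "AC_deriv (-l) l (\<lambda>x. G (\<theta> x)) (\<lambda>x. \<phi> (\<theta> x) * h x)"
        by (rule AC_deriv_chain[OF \<theta>h _ G \<phi>c]) (use ll in simp)
      \<comment> \<open>Inside a layer
        \<open>\<epsilon> * \<bar>h x\<bar> = k y = sqrt (V (c y) + d)\<close>, so each term of
        \<open>e\<close> is at most \<open>(k y)^2 / \<epsilon>\<close> and the sum is dominated by
        the absolute derivative of \<open>G \<circ> \<theta>\<close>. Outside the layers
        \<open>e\<close> vanishes. Each half of the energy thus becomes a difference of values of
        \<open>G\<close>.\<close>
      have le: "e x \<le> \<bar>\<phi> (\<theta> x) * h x\<bar>" if "x \<noteq> 0" for x
      proof -
        define y where "y = (l/2 - \<bar>x\<bar>) / \<epsilon>"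
        show ?thesis
        proof (cases "\<bar>y\<bar> < T")
          case True
          have "e x = (k y)^2 / \<epsilon> + V (c y) / \<epsilon>"
            using that \<epsilon> by (simp add: e_def h_def \<theta>_def y_def[symmetric] power_mult_distrib power_divide power2_eq_square sgn_if)
          also have "\<dots> \<le> (k y)^2 / \<epsilon> + (k y)^2 / \<epsilon>"
            using k1[OF True] W_nonneg[of "c y"] d(1) \<epsilon> by (intro add_mono divide_right_mono) auto
          also have "(k y)^2 / \<epsilon> + (k y)^2 / \<epsilon> = \<bar>\<phi> (\<theta> x) * h x\<bar>"
          proof -
            have "\<phi> (c y) = 2 * k y" by (simp add: \<phi>_def k1[OF True])
            then show ?thesis
              using kb(1)[of y] that \<epsilon>
              by (simp add: h_def \<theta>_def y_def[symmetric] abs_mult sgn_if power2_eq_square)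
          qed
          finally show ?thesis .
        next
          case False
          then show ?thesis using k2[of y] cV[of y] by (simp add: e_def h_def \<theta>_def y_def[symmetric])
        qed
      qed
      have \<phi>0: "\<phi> t \<ge> 0" for t using W_nonneg[of t] d(1) by (simp add: \<phi>_def)
      have e1: "integral {-l..0} e \<le> G \<beta> - G (-\<beta>)"
      proof -
        have "integral {-l..0} e \<le> integral {-l..0} (\<lambda>x. \<phi> (\<theta> x) * h x)"
        proof (rule integral_le_AE)
          show "AE x in lebesgue_on {-l..0}. e x \<le> \<phi> (\<theta> x) * h x"
          proof -
            have "{x \<in> {-l..0}. \<not> e x \<le> \<phi> (\<theta> x) * h x} \<subseteq> {0}"
            proof
              fix x assume x: "x \<in> {x \<in> {-l..0}. \<not> e x \<le> \<phi> (\<theta> x) * h x}"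
              have "h x \<ge> 0" if "x < 0" using that kb(1) \<epsilon> by (simp add: h_def)
              then show "x \<in> {0}" using x le[of x] \<phi>0[of "\<theta> x"] by (cases "x < 0") (auto simp: abs_mult)
            qed
            then have "negligible {x \<in> {-l..0}. \<not> e x \<le> \<phi> (\<theta> x) * h x}" using negligible_subset negligible_sing by blast
            then show ?thesis by (simp add: AE_lebesgue_on_iff)
          qed
        qed (use AC_deriv_integrable(2)[OF GA, of "-l" 0] absolutely_integrable_on_subinterval[OF ei, of "-l" 0] assms
              in \<open>auto simp: set_lebesgue_integral_eq_integral(1)\<close>)
        also have "\<dots> = G (\<theta> 0) - G (\<theta> (-l))"
          using AC_deriv_diff[OF GA, of "-l" 0] assms by simp
        also have "\<theta> 0 = \<beta>" unfolding \<theta>_def using \<epsilon>T \<epsilon> by (intro cT) (simp add: field_simps)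
        also have "\<theta> (-l) = -\<beta>"
          using cT[of "(l/2) / \<epsilon>"] co[of "(l/2)/\<epsilon>"] \<epsilon>T \<epsilon> assms(1) by (simp add: \<theta>_def field_simps)
        finally show ?thesis .
      qed
      have e2: "integral {0..l} e = integral {-l..0} e"
      proof -
        have "integral {-l..-0} (\<lambda>x. e (-x)) = integral {0..l} e"
          using Henstock_Kurzweil_Integration.integral_reflect_real[where f=e and a=0 and b=l] .
        moreover have "e (-x) = e x" for x by (simp add: e_def h_def \<theta>_def)
        ultimately show ?thesis by simp
      qed
      have "integral {-l..l} e = integral {-l..0} e + integral {0..l} e"
        by (rule Henstock_Kurzweil_Integration.integral_combine[symmetric])
          (use assms ei in \<open>auto simp: set_lebesgue_integral_eq_integral(1)\<close>)
      also have "\<dots> \<le> 2 * (P \<beta> + 4 * \<beta> * sqrt d)" using e1 e2 G\<beta> by simp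
      also have "\<dots> = 2 * P \<beta> + \<delta>" using d(2) by simp
      finally show ?thesis .
    qed
    finally show "\<exists>\<theta> g. (\<theta>, g) \<in> Y_C l \<and> F_C \<sigma> D1 D2 a0 l \<epsilon> \<theta> g \<le> 2 * P \<beta> + \<delta>" using Y by blast
  qed
qed

end

subsection \<open>Energy estimates\<close>

lemma AC_deriv_AE:
  assumes F: "AC_deriv a b F h" and "AE x in lebesgue_on {a<..<b}. k x = h x"
  shows "AC_deriv a b F k"
proof (rule AC_derivI)
  show "k absolutely_integrable_on {a..b}" by (rule LINT_Ioo_AE(1)[OF assms(2) AC_derivD(1)[OF F]])
  fix x assume x: "a \<le> x" "x \<le> b"
  have N: "negligible {x \<in> {a..b}. k x \<noteq> h x}"
    using assms(2) unfolding AE_interior_iff by (simp add: AE_lebesgue_on_iff)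
  have "integral {a..x} h = integral {a..x} k" by (rule integral_spike[OF N]) (use x in auto)
  then show "F x = F a + integral {a..x} k" using AC_derivD(2)[OF F x] by simp
qed

text \<open>For a function with equal values at \<open>- l\<close> and \<open>l\<close> this bounds the variation along the circle.\<close>

definition cyclic_variation_le :: "real \<Rightarrow> (real \<Rightarrow> real) \<Rightarrow> real \<Rightarrow> bool" where
  "cyclic_variation_le l f E \<longleftrightarrow> (\<forall>x1 x2 x3 x4. -l \<le> x1 \<longrightarrow> x1 \<le> x2 \<longrightarrow> x2 \<le> x3 \<longrightarrow> x3 \<le> x4 \<longrightarrow> x4 \<le> l \<longrightarrow>
     \<bar>f x2 - f x1\<bar> + \<bar>f x3 - f x2\<bar> + \<bar>f x4 - f x3\<bar> + \<bar>f x1 - f x4\<bar> \<le> E)"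

context wells
begin

text \<open>The Modica-Mortola inequality: \<open>2 * sqrt V * \<bar>h\<bar>\<close>, the absolute
  derivative of \<open>P \<circ> F\<close>, is at most
  \<open>\<epsilon> * h^2 + V / \<epsilon>\<close> by completing the square.\<close>

lemma AC_deriv_P_le:
  assumes F: "AC_deriv a b F h" and "(\<lambda>x. (h x)\<^sup>2) absolutely_integrable_on {a..b}" "\<epsilon> > 0" "a \<le> x" "x \<le> y" "y \<le> b"
  shows "\<bar>P (F y) - P (F x)\<bar> \<le> integral {x..y} (\<lambda>x. \<epsilon> * (h x)\<^sup>2 + 1 / \<epsilon> * V (F x))"
proof -
  have c: "continuous_on UNIV (\<lambda>s. 2 * sqrt (V s))" by (intro continuous_intros V_continuous)
  have PF: "AC_deriv a b (\<lambda>x. P (F x)) (\<lambda>x. 2 * sqrt (V (F x)) * h x)"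
    by (rule AC_deriv_chain[OF F _ P_deriv c]) (use assms in simp)
  have "(\<lambda>x. (h x)\<^sup>2) absolutely_integrable_on {x..y}"
    by (rule absolutely_integrable_on_subinterval[OF assms(2)]) (use assms in auto)
  moreover have "(\<lambda>x. V (F x)) absolutely_integrable_on {x..y}"
    by (intro absolutely_integrable_continuous_real continuous_on_compose2[OF V_continuous]
        continuous_on_subset[OF AC_deriv_continuous[OF F]]) (use assms in auto)
  ultimately have i: "(\<lambda>x. \<epsilon> * (h x)\<^sup>2 + 1 / \<epsilon> * V (F x)) integrable_on {x..y}"
    by (intro integrable_add integrable_on_mult_right) (auto simp: set_lebesgue_integral_eq_integral(1))
  have "\<bar>P (F y) - P (F x)\<bar> = \<bar>integral {x..y} (\<lambda>x. 2 * sqrt (V (F x)) * h x)\<bar>"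
    using AC_deriv_diff[OF PF] assms by simp
  also have "\<dots> \<le> integral {x..y} (\<lambda>x. \<epsilon> * (h x)\<^sup>2 + 1 / \<epsilon> * V (F x))"
    unfolding real_norm_def[symmetric]
  proof (rule integral_norm_bound_integral[OF _ i])
    show "(\<lambda>x. 2 * sqrt (V (F x)) * h x) integrable_on {x..y}"
      by (rule AC_deriv_integrable(2)[OF PF]) (use assms in auto)
    fix t
    define s where "s = sqrt (V (F t))"
    have s: "s \<ge> 0" "V (F t) = s\<^sup>2" using W_nonneg[of "F t"] by (auto simp: s_def)
    have "0 \<le> (\<epsilon> * \<bar>h t\<bar> - s)\<^sup>2 / \<epsilon>" using assms(3) by simp
    also have "\<dots> = \<epsilon> * (h t)\<^sup>2 + 1 / \<epsilon> * s\<^sup>2 - 2 * s * \<bar>h t\<bar>"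
      using assms(3) by (simp add: power2_diff power_mult_distrib field_simps power2_eq_square)
    finally show "norm (2 * sqrt (V (F t)) * h t) \<le> \<epsilon> * (h t)\<^sup>2 + 1 / \<epsilon> * V (F t)"
      unfolding s(2) using s by (simp add: s_def[symmetric] abs_mult)
  qed
  finally show ?thesis .
qed

text \<open>Translates membership in \<open>Y_C\<close> and the energy into statements about
  continuous functions: \<open>F\<close>, \<open>G\<close> and \<open>p\<close> represent
  \<open>\<theta>\<close>, \<open>g\<close> and \<open>g'\<close>. The last three conclusions are
  the information that the later rigidity argument draws from the energy.\<close>

lemma Y_C_structure:
  assumes "l > 0" "D1 > 0" "\<epsilon> > 0" and Y: "(\<theta>, g) \<in> Y_C l"
  obtains F p G where
    "continuous_on {-l..l} F" "AE x in lebesgue_on {-l<..<l}. \<theta> x = F x"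
    "continuous_on {-l..l} p" "AC_deriv (-l) l G p" "AE x in lebesgue_on {-l<..<l}. g x = G x" "G (-l) = G l"
    "cyclic_variation_le l (\<lambda>x. P (F x)) (F_C \<sigma> D1 D2 a0 l \<epsilon> \<theta> g)"
    "integral {-l..l} (\<lambda>x. (p x + sin (F x))\<^sup>2) \<le> \<epsilon> * F_C \<sigma> D1 D2 a0 l \<epsilon> \<theta> g"
    "integral {-l..l} (\<lambda>x. V (F x)) \<le> \<epsilon> * F_C \<sigma> D1 D2 a0 l \<epsilon> \<theta> g"
proof -
  define I where "I = {-l<..<l}"
  have ll: "-l < l" using assms by simp
  have Y': "in_W12 I \<theta>" "in_W12 I g" "in_W12 I (weak_deriv I g)"
    "bdry_trace I \<theta> (-l) = bdry_trace I \<theta> l" "bdry_trace I g (-l) = bdry_trace I g l"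
    using Y unfolding Y_C_def Let_def in_W22_def I_def by auto
  define h where "h = weak_deriv I \<theta>"
  define q where "q = weak_deriv I (weak_deriv I g)"
  obtain F where F: "AC_deriv (-l) l F h" "AE x in lebesgue_on I. \<theta> x = F x" "in_Lp 2 I h"
    using in_W12_AC[OF ll Y'(1)[unfolded I_def]] unfolding I_def h_def by blast
  obtain G where G: "AC_deriv (-l) l G (weak_deriv I g)" "AE x in lebesgue_on I. g x = G x"
    using in_W12_AC[OF ll Y'(2)[unfolded I_def]] unfolding I_def by blast
  obtain p where p: "AC_deriv (-l) l p q" "AE x in lebesgue_on I. weak_deriv I g x = p x" "in_Lp 2 I q"
    using in_W12_AC[OF ll Y'(3)[unfolded I_def]] unfolding I_def q_def by blast
  note Fc = AC_deriv_continuous[OF F(1)] and pc = AC_deriv_continuous[OF p(1)]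
  have "AE x in lebesgue_on {-l<..<l}. p x = weak_deriv I g x" using p(2) unfolding I_def by (auto elim: AE_mp)
  note Gp = AC_deriv_AE[OF G(1) this]
  define e where "e x = \<epsilon> * (h x)\<^sup>2 + 1 / \<epsilon> * V (F x)" for x
  define r where "r x = D1 * \<epsilon> * (q x + cos (F x) * h x)\<^sup>2 + D2 / (2 * \<epsilon>) * (p x + sin (F x)) ^ 4
      + 4 * D2 / \<epsilon> * (p x + sin (F x))\<^sup>2 * sin (F x / 2) ^ 4" for x
  define s where "s x = 1 / \<epsilon> * (p x + sin (F x))\<^sup>2" for x
  have h2: "(\<lambda>x. (h x)\<^sup>2) absolutely_integrable_on {-l..l}" and q2: "(\<lambda>x. (q x)\<^sup>2) absolutely_integrable_on {-l..l}"
    using in_L2D(2) F(3) p(3) I_def by blast+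
  have VF: "(\<lambda>x. V (F x)) absolutely_integrable_on {-l..l}"
    by (intro absolutely_integrable_continuous_real continuous_on_compose2[OF V_continuous Fc]) auto
  have ei: "e absolutely_integrable_on {-l..l}"
    unfolding e_def[abs_def] by (intro set_integral_add set_integrable_mult_right h2 VF)
  have si: "s absolutely_integrable_on {-l..l}"
    unfolding s_def[abs_def] by (intro absolutely_integrable_continuous_real continuous_intros Fc pc)
  \<comment> \<open>The integral in \<open>F_C\<close> would default to 0 for an integrand that is
    not integrable, so bounds from below by parts of the energy require every summand to be
    integrable.\<close>
  have qi: "(\<lambda>x. (q x + cos (F x) * h x)\<^sup>2) absolutely_integrable_on {-l..l}"
    unfolding absolutely_integrable_on_Icc_iff_Ioo
  proof (rule measurable_bounded_by_integrable_imp_absolutely_integrable)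
    have "(\<lambda>x. cos (F x)) \<in> borel_measurable (lebesgue_on {-l<..<l})"
      by (rule continuous_imp_measurable_on_sets_lebesgue)
        (auto intro!: continuous_intros continuous_on_subset[OF Fc])
    then show "(\<lambda>x. (q x + cos (F x) * h x)\<^sup>2) \<in> borel_measurable (lebesgue_on {-l<..<l})"
      using in_L2D(3)[OF F(3)[unfolded I_def]] in_L2D(3)[OF p(3)[unfolded I_def]] by measurable
    show "(\<lambda>x. 2 * (q x)\<^sup>2 + 2 * (h x)\<^sup>2) integrable_on {-l<..<l}"
      using h2 q2 unfolding absolutely_integrable_on_Icc_iff_Ioo
      by (intro integrable_add integrable_on_mult_right) (auto simp: set_lebesgue_integral_eq_integral(1))
    fix x
    have "(cos (F x) * h x)\<^sup>2 \<le> 1 * (h x)\<^sup>2"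
      unfolding power_mult_distrib by (intro mult_right_mono) (auto simp: abs_square_le_1)
    moreover have "(q x + cos (F x) * h x)\<^sup>2 \<le> 2 * (q x)\<^sup>2 + 2 * (cos (F x) * h x)\<^sup>2"
      using sum_squares_bound[of "q x" "cos (F x) * h x"] by (simp add: power2_sum)
    ultimately show "norm ((q x + cos (F x) * h x)\<^sup>2) \<le> 2 * (q x)\<^sup>2 + 2 * (h x)\<^sup>2" by simp
  qed auto
  have ri: "r absolutely_integrable_on {-l..l}"
    unfolding r_def[abs_def]
  proof (intro set_integral_add(1) set_integrable_mult_right qi)
    show "(\<lambda>x. (p x + sin (F x)) ^ 4) absolutely_integrable_on {-l..l}"
      by (intro absolutely_integrable_continuous_real continuous_intros Fc pc)
    show "(\<lambda>x. 4 * D2 / \<epsilon> * (p x + sin (F x))\<^sup>2 * sin (F x / 2) ^ 4) absolutely_integrable_on {-l..l}"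
      by (intro absolutely_integrable_continuous_real continuous_intros Fc pc) auto
  qed
  let ?E = "F_C \<sigma> D1 D2 a0 l \<epsilon> \<theta> g"
  have "?E = integral {-l..l} (\<lambda>x. r x + s x + e x)"
    unfolding F_C_def Let_def
  proof (rule LINT_Ioo_AE(2), fold I_def)
    show "(\<lambda>x. r x + s x + e x) absolutely_integrable_on {-l..l}" by (intro set_integral_add(1) ri si ei)
    show "AE x in lebesgue_on I. D1 * \<epsilon> * (weak_deriv I (weak_deriv I g) x + cos (\<theta> x) * weak_deriv I \<theta> x)\<^sup>2 +
              D2 / (2 * \<epsilon>) * (weak_deriv I g x + sin (\<theta> x)) ^ 4 +
              1 / \<epsilon> * (weak_deriv I g x + sin (\<theta> x))\<^sup>2 +
              4 * D2 / \<epsilon> * (weak_deriv I g x + sin (\<theta> x))\<^sup>2 * sin (\<theta> x / 2) ^ 4 +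
              \<epsilon> * (weak_deriv I \<theta> x)\<^sup>2 + 1 / \<epsilon> * V (\<theta> x) = r x + s x + e x"
      using F(2) p(2) by eventually_elim (simp add: e_def r_def s_def h_def q_def)
  qed
  then have E: "?E = integral {-l..l} r + integral {-l..l} s + integral {-l..l} e"
    using ri si ei by (simp add: Henstock_Kurzweil_Integration.integral_add integrable_add set_lebesgue_integral_eq_integral(1))
  have r0: "0 \<le> r x" and s0: "0 \<le> s x" and e0: "0 \<le> e x" and eV: "1 / \<epsilon> * V (F x) \<le> e x" for x
    unfolding r_def s_def e_def using assms D2_pos W_nonneg[of "F x"]
    by (auto intro!: add_nonneg_nonneg mult_nonneg_nonneg divide_nonneg_nonneg)
  have pos: "0 \<le> integral {-l..l} r" "0 \<le> integral {-l..l} s" "0 \<le> integral {-l..l} e"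
    using r0 s0 e0 ri si ei by (auto intro!: integral_nonneg simp: set_lebesgue_integral_eq_integral(1))
  show ?thesis
  proof (rule that[of F p G])
    have Fl: "F (-l) = F l"
      using Y'(4) bdry_trace_continuous[OF ll _ Fc F(2)[unfolded I_def]] by (simp add: I_def)
    show "G (-l) = G l"
      using Y'(5) bdry_trace_continuous[OF ll _ AC_deriv_continuous[OF Gp] G(2)[unfolded I_def]] by (simp add: I_def)
    show "AE x in lebesgue_on {-l<..<l}. \<theta> x = F x" by (rule F(2)[unfolded I_def])
    show "AE x in lebesgue_on {-l<..<l}. g x = G x" by (rule G(2)[unfolded I_def])
    show "integral {-l..l} (\<lambda>x. (p x + sin (F x))\<^sup>2) \<le> \<epsilon> * ?E"
    proof -
      have "integral {-l..l} (\<lambda>x. (p x + sin (F x))\<^sup>2) = \<epsilon> * integral {-l..l} s"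
        using assms(3) by (simp add: s_def[abs_def])
      also have "\<dots> \<le> \<epsilon> * ?E" using E pos assms(3) by (intro mult_left_mono) auto
      finally show ?thesis .
    qed
    show "integral {-l..l} (\<lambda>x. V (F x)) \<le> \<epsilon> * ?E"
    proof -
      have "integral {-l..l} (\<lambda>x. V (F x)) = \<epsilon> * integral {-l..l} (\<lambda>x. 1 / \<epsilon> * V (F x))"
        using assms(3) by simp
      also have "integral {-l..l} (\<lambda>x. 1 / \<epsilon> * V (F x)) \<le> integral {-l..l} e"
        by (intro integral_le) (use VF ei eV in \<open>auto intro!: integrable_on_mult_right simp: set_lebesgue_integral_eq_integral(1)\<close>)
      also have "\<dots> \<le> ?E" using E pos by linarith
      finally show ?thesis using assms(3) by simp
    qed
    have e_sub: "e integrable_on {a..b}" if "-l \<le> a" "b \<le> l" for a b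
      using absolutely_integrable_on_subinterval[OF ei, of a b] that by (auto simp: set_lebesgue_integral_eq_integral(1))
    have cmb: "integral {a..b} e + integral {b..c} e = integral {a..c} e" if "-l \<le> a" "a \<le> b" "b \<le> c" "c \<le> l" for a b c
      by (rule Henstock_Kurzweil_Integration.integral_combine) (use that e_sub in auto)
    have st: "\<bar>P (F y) - P (F x)\<bar> \<le> integral {x..y} e" if "-l \<le> x" "x \<le> y" "y \<le> l" for x y
      unfolding e_def[abs_def] by (rule AC_deriv_P_le[OF F(1) h2 assms(3) that])
    show "cyclic_variation_le l (\<lambda>x. P (F x)) ?E"
      unfolding cyclic_variation_le_def
    proof (intro allI impI)
      fix x1 x2 x3 x4 assume x: "-l \<le> x1" "x1 \<le> x2" "x2 \<le> x3" "x3 \<le> x4" "x4 \<le> l"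
      have tot: "integral {x1..x2} e + integral {x2..x3} e + integral {x3..x4} e + (integral {-l..x1} e + integral {x4..l} e)
          = integral {-l..l} e"
        using cmb[of "-l" x1 x2] cmb[of "-l" x2 x3] cmb[of "-l" x3 x4] cmb[of "-l" x4 l] x by linarith
      \<comment> \<open>The fourth arc of the circle runs from \<open>x4\<close> to \<open>l\<close>
        and on from \<open>-l\<close> to \<open>x1\<close>; equality of the endpoint values of
        \<open>F\<close> joins the two pieces.\<close>
      have "\<bar>P (F x1) - P (F x4)\<bar> \<le> \<bar>P (F x1) - P (F (-l))\<bar> + \<bar>P (F l) - P (F x4)\<bar>"
        using Fl by simp
      also have "\<dots> \<le> integral {-l..x1} e + integral {x4..l} e"
        by (intro add_mono st) (use x in auto)
      finally have "\<bar>P (F x2) - P (F x1)\<bar> + \<bar>P (F x3) - P (F x2)\<bar> + \<bar>P (F x4) - P (F x3)\<bar> + \<bar>P (F x1) - P (F x4)\<bar> \<le> integral {-l..l} e"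
        unfolding tot[symmetric] by (intro add_mono st) (use x in auto)
      also have "\<dots> \<le> ?E" using E pos by linarith
      finally show "\<bar>P (F x2) - P (F x1)\<bar> + \<bar>P (F x3) - P (F x2)\<bar> + \<bar>P (F x4) - P (F x3)\<bar> + \<bar>P (F x1) - P (F x4)\<bar> \<le> ?E" .
    qed
  qed (use Fc pc Gp in auto)
qed

end

subsection \<open>Structure of functions of low energy\<close>

text \<open>If both sets were split, there would be a pattern A-B-A starting at \<open>a\<close> and
  a pattern B-A-B starting at \<open>b1\<close>. Prepending the earlier of the two starting points
  to the other pattern gives four alternating points.\<close>

lemma noncrossing_cases:
  fixes A B :: "real set"
  assumes "A \<inter> B = {}"
    and "\<And>a b a' b'. a \<in> A \<Longrightarrow> b \<in> B \<Longrightarrow> a' \<in> A \<Longrightarrow> b' \<in> B \<Longrightarrow> a < b \<Longrightarrow> b < a' \<Longrightarrow> a' < b' \<Longrightarrow> False"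
    and "\<And>a b a' b'. b \<in> B \<Longrightarrow> a \<in> A \<Longrightarrow> b' \<in> B \<Longrightarrow> a' \<in> A \<Longrightarrow> b < a \<Longrightarrow> a < b' \<Longrightarrow> b' < a' \<Longrightarrow> False"
  shows "(\<forall>a\<in>A. \<forall>b\<in>B. \<forall>a'\<in>A. \<not> (a < b \<and> b < a')) \<or> (\<forall>b\<in>B. \<forall>a\<in>A. \<forall>b'\<in>B. \<not> (b < a \<and> a < b'))"
proof (rule ccontr)
  assume "\<not> ?thesis"
  then obtain a b a' b1 a1 b2 where x: "a \<in> A" "b \<in> B" "a' \<in> A" "a < b" "b < a'"
    "b1 \<in> B" "a1 \<in> A" "b2 \<in> B" "b1 < a1" "a1 < b2" by blast
  consider "b1 > a" | "b1 < a" | "b1 = a" by linarith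
  then show False
  proof cases
    case 1 then show False using assms(2)[of a b1 a1 b2] x by blast
  next
    case 2 then show False using assms(3)[of b1 a b a'] x by blast
  next
    case 3 then show False using x assms(1) by blast
  qed
qed

lemma measure_le_length:
  assumes "A \<in> lmeasurable" "A \<subseteq> {a..b::real}" "a \<le> b"
  shows "measure lebesgue A \<le> b - a"
  using measure_mono_fmeasurable[of A "{a..b}" lebesgue] assms by (simp add: fmeasurableD lmeasurable_interval[of a b, unfolded box_real])

text \<open>No point of \<open>B\<close> lies strictly inside the hull \<open>{u..v}\<close> of
  \<open>A\<close>. So the hull has length at least the measure of \<open>A\<close>, and at most
  \<open>2 * l\<close> minus the measure of \<open>B\<close>; both are within
  \<open>\<kappa>\<close> of \<open>l\<close>. The midpoint of the hull, slightly corrected, serves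
  as \<open>c\<close>.\<close>

lemma middle_block:
  fixes A B :: "real set"
  assumes "l > 0" "0 < \<kappa>" "2 * \<kappa> \<le> l"
    and A: "A \<in> lmeasurable" "A \<subseteq> {-l..l}" "l - \<kappa> \<le> measure lebesgue A"
    and B: "B \<in> lmeasurable" "B \<subseteq> {-l..l}" "l - \<kappa> \<le> measure lebesgue B"
    and no: "\<forall>a\<in>A. \<forall>b\<in>B. \<forall>a'\<in>A. \<not> (a < b \<and> b < a')"
  obtains c where "c \<in> {-l/2..l/2}" "c \<noteq> 0" "\<And>a. a \<in> A \<Longrightarrow> \<bar>a - c\<bar> \<le> l/2 + 2 * \<kappa>"
    "\<And>b. b \<in> B \<Longrightarrow> \<bar>b - c\<bar> \<ge> l/2 - 2 * \<kappa>"
proof -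
  have ne: "A \<noteq> {}" using A(3) assms by auto
  have bd: "bdd_below A" "bdd_above A" using A(2) by (meson bdd_above_Icc bdd_above_mono bdd_below_Icc bdd_below_mono)+
  define u v where "u = Inf A" and "v = Sup A"
  have Auv: "A \<subseteq> {u..v}" using bd by (auto simp: u_def v_def intro: cInf_lower cSup_upper)
  have uv: "-l \<le> u" "v \<le> l" unfolding u_def v_def using ne A(2) by (auto intro!: cInf_greatest cSup_least)
  have uv': "u \<le> v" using ne Auv by auto
  have Bout: "b \<le> u \<or> v \<le> b" if b: "b \<in> B" for b
  proof (rule ccontr)
    assume "\<not> (b \<le> u \<or> v \<le> b)"
    then obtain a a' where "a \<in> A" "a < b" "a' \<in> A" "b < a'"
      unfolding u_def v_def using cInf_lessD[OF ne, of b] less_cSupD[OF ne, of b] by (auto simp: not_le)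
    then show False using no b by blast
  qed
  have 1: "l - \<kappa> \<le> v - u" using measure_le_length[OF A(1) Auv uv'] A(3) by simp
  have 2: "v - u \<le> l + \<kappa>"
  proof -
    have "measure lebesgue B \<le> measure lebesgue ({-l..u} \<union> {v..l})"
    proof (rule measure_mono_fmeasurable)
      show "B \<subseteq> {-l..u} \<union> {v..l}" using Bout B(2) by force
    qed (use B in \<open>auto simp: fmeasurableD intro!: fmeasurable.Un lmeasurable_interval[unfolded box_real]\<close>)
    also have "\<dots> \<le> measure lebesgue {-l..u} + measure lebesgue {v..l}"
      by (rule measure_Un_le) auto
    also have "\<dots> = (u + l) + (l - v)" using uv by simp
    finally show ?thesis using B(3) by simp
  qed
  define m where "m = (u + v) / 2"
  have m: "-l/2 - \<kappa>/2 \<le> m" "m \<le> l/2 + \<kappa>/2" using uv 1 by (auto simp: m_def field_simps)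
  \<comment> \<open>Two corrections of the midpoint, each costing at most \<open>\<kappa>/2\<close>:
    clamping to \<open>[-l/2, l/2]\<close>, and moving away from 0. Together with the uncertainty of
    the length of the hull they stay within the margin \<open>2 * \<kappa>\<close>.\<close>
  define c0 where "c0 = max (-l/2) (min (l/2) m)"
  define c where "c = (if c0 = 0 then \<kappa> / 2 else c0)"
  have c0: "\<bar>c0 - m\<bar> \<le> \<kappa>/2" "c0 \<in> {-l/2..l/2}" using m assms(1,2) by (auto simp: c0_def max_def min_def abs_if)
  then have c: "\<bar>c - m\<bar> \<le> \<kappa>" "c \<in> {-l/2..l/2}" "c \<noteq> 0" using assms(1-3) by (auto simp: c_def)
  show ?thesis
  proof (rule that[OF c(2,3)])
    fix a assume "a \<in> A"
    then have "u \<le> a" "a \<le> v" using Auv by auto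
    then have "\<bar>a - m\<bar> \<le> (v - u) / 2" by (auto simp: m_def abs_if field_simps)
    then have "\<bar>a - m\<bar> + \<bar>c - m\<bar> \<le> (v - u) / 2 + \<kappa>" using c(1) by (rule add_mono)
    moreover have "\<bar>a - c\<bar> \<le> \<bar>a - m\<bar> + \<bar>c - m\<bar>" using abs_triangle_ineq4[of "a - m" "c - m"] by simp
    moreover have "(v - u) / 2 + \<kappa> \<le> l/2 + 2 * \<kappa>" using 2 assms(2) by (simp add: field_simps)
    ultimately show "\<bar>a - c\<bar> \<le> l/2 + 2 * \<kappa>" by (meson order_trans)
  next
    fix b assume "b \<in> B"
    then have "\<bar>b - m\<bar> \<ge> (v - u) / 2" using Bout[of b] uv' by (auto simp: m_def abs_if field_simps)
    then have "(v - u) / 2 - \<kappa> \<le> \<bar>b - m\<bar> - \<bar>c - m\<bar>" using c(1) by (rule diff_mono)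
    moreover have "\<bar>b - m\<bar> - \<bar>c - m\<bar> \<le> \<bar>b - c\<bar>" using abs_triangle_ineq2[of "b - m" "c - m"] by simp
    moreover have "l/2 - 2 * \<kappa> \<le> (v - u) / 2 - \<kappa>" using 1 assms(2) by (simp add: field_simps)
    ultimately show "\<bar>b - c\<bar> \<ge> l/2 - 2 * \<kappa>" by (meson order_trans)
  qed
qed

lemma lmeasurable_continuous_preimage:
  assumes "continuous_on {a..b::real} F" "open (U :: real set)"
  shows "{x \<in> {a..b}. F x \<in> U} \<in> lmeasurable"
proof -
  have "{x \<in> {a..b}. F x \<in> U} = {a..b} \<inter> F -` U" by auto
  then have "openin (top_of_set {a..b}) {x \<in> {a..b}. F x \<in> U}"
    using continuous_openin_preimage_gen[OF assms] by simp
  then obtain T where "open T" "{x \<in> {a..b}. F x \<in> U} = {a..b} \<inter> T" by (auto simp: openin_open)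
  then have "{x \<in> {a..b}. F x \<in> U} \<in> sets lebesgue" by auto
  then show ?thesis
    by (rule fmeasurableI2[of "{a..b}", rotated 2]) (auto simp: lmeasurable_interval[of a b, unfolded box_real])
qed

lemma integral_indicator_Icc:
  assumes "S \<in> lmeasurable" "S \<subseteq> {a..b::real}"
  shows "(indicat_real S has_integral measure lebesgue S) {a..b}"
proof -
  have "(indicat_real S has_integral measure lebesgue S) UNIV"
    using assms(1) lmeasurable_iff_has_integral by blast
  then have "((\<lambda>x. if x \<in> {a..b} then indicat_real S x else 0) has_integral measure lebesgue S) UNIV"
    by (rule has_integral_eq[rotated]) (use assms(2) in \<open>auto simp: indicator_def\<close>)
  then show ?thesis by (simp only: has_integral_restrict_UNIV)
qed

text \<open>A single block instead of a periodic function: for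
  \<open>\<bar>c\<bar> \<le> l/2\<close> the translated block stays in \<open>[-l, l]\<close>, and
  the translate agrees there, off the jumps, with that of the square wave introduced below.\<close>

definition prof :: "real \<Rightarrow> real \<Rightarrow> real \<Rightarrow> real" where
  "prof \<beta> l x = (if \<bar>x\<bar> < l / 2 then \<beta> else - \<beta>)"

lemma integrable_prof: "(\<lambda>x. prof \<beta> l (x - c)) absolutely_integrable_on {a..b}"
proof (rule absolutely_integrable_bounded_measurable)
  show "(\<lambda>x. prof \<beta> l (x - c)) \<in> borel_measurable (lebesgue_on {a..b})"
    unfolding prof_def by (intro borel_measurable_lebesgue_onI) measurable
  show "\<bar>prof \<beta> l (x - c)\<bar> \<le> \<bar>\<beta>\<bar>" for x by (simp add: prof_def)
qed

section \<open>Low energy leaves two blocks of nearly equal length\<close>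

context wells
begin

lemma P_lipschitz: obtains C where "C > 0" "\<And>x y. \<bar>P x - P y\<bar> \<le> C * \<bar>x - y\<bar>"
proof -
  obtain M where M: "M > 0" "\<And>t. V t \<le> M" using V_bounded by metis
  show ?thesis
  proof (rule that[of "2 * sqrt M"])
    show "2 * sqrt M > 0" using M by simp
    fix x y
    have "norm (P x - P y) \<le> 2 * sqrt M * norm (x - y)"
    proof (rule field_differentiable_bound[of UNIV P "\<lambda>s. 2 * sqrt (V s)"])
      show "norm (2 * sqrt (V z)) \<le> 2 * sqrt M" for z using M(2)[of z] W_nonneg[of z] by simp
    qed (use P_deriv in auto)
    then show "\<bar>P x - P y\<bar> \<le> 2 * sqrt M * \<bar>x - y\<bar>" by simp
  qed
qed

abbreviation "L \<equiv> P (2 * pi - \<beta>) - P \<beta>"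

text \<open>Four cyclically ordered points suffice: an energy below \<open>min (4 P(\<beta>)) (2 L)\<close> confines
  the values near the wells of one period and forbids the crossing pattern \<open>\<beta>, -\<beta>, \<beta>, -\<beta>\<close>.\<close>

lemma two_blocks:
  assumes "l > 0" and Fc: "continuous_on {-l..l} F"
    and cyc: "cyclic_variation_le l (\<lambda>x. P (F x)) E"
    and C: "C > 0" "\<And>x y. \<bar>P x - P y\<bar> \<le> C * \<bar>x - y\<bar>"
    and \<eta>: "0 < \<eta>" "\<eta> < \<beta>" "E < 4 * (P \<beta> - 2 * C * \<eta>)" "E < 2 * (L - 2 * C * \<eta>)"
    and w: "w > 0" "\<And>t. (\<And>k::int. \<eta> \<le> \<bar>t - 2 * pi * of_int k - \<beta>\<bar> \<and> \<eta> \<le> \<bar>t - 2 * pi * of_int k + \<beta>\<bar>) \<Longrightarrow> w \<le> V t"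
    and \<tau>: "0 < \<tau>" "integral {-l..l} (\<lambda>x. V (F x)) \<le> w * \<tau>" "\<bar>integral {-l..l} (\<lambda>x. sin (F x))\<bar> \<le> \<tau>"
    and \<kappa>: "\<kappa> = (2 * \<tau> + 2 * l * \<eta>) / sin \<beta> + \<tau>" "2 * \<kappa> \<le> l"
  obtains k :: int and s c :: real where "s = 1 \<or> s = -1" "c \<in> {-l/2..l/2}" "c \<noteq> 0"
    "integral {-l..l} (\<lambda>x. \<bar>F x - 2 * pi * of_int k - s * prof \<beta> l (x - c)\<bar>) \<le> 2 * l * \<eta> + 10 * \<tau> + 16 * \<beta> * \<kappa>"
proof -
  have sb: "sin \<beta> > 0" using \<beta>_pos \<beta>_less by (intro sin_gt_zero) auto
  have \<kappa>0: "\<kappa> > 0" using \<kappa>(1) sb \<tau>(1) \<eta>(1) assms(1) by (auto intro!: add_pos_pos divide_pos_pos)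
  have \<tau>\<kappa>: "\<tau> \<le> \<kappa>" unfolding \<kappa>(1) using sb \<tau>(1) \<eta>(1) assms(1) by (auto intro!: divide_nonneg_nonneg)
  note four = cyc[unfolded cyclic_variation_le_def, rule_format]
  have two: "2 * \<bar>P (F x) - P (F y)\<bar> \<le> E" if "x \<in> {-l..l}" "y \<in> {-l..l}" for x y
    using four[of x y y y] four[of y x x x] that by (cases "x \<le> y") (auto simp: abs_minus_commute)
  define A where "A = {x \<in> {-l..l}. F x \<in> (\<Union>k::int. {t. \<bar>t - 2 * pi * of_int k - \<beta>\<bar> < \<eta>})}"
  define B where "B = {x \<in> {-l..l}. F x \<in> (\<Union>k::int. {t. \<bar>t - 2 * pi * of_int k + \<beta>\<bar> < \<eta>})}"
  have o: "open {t::real. \<bar>t - 2 * pi * of_int k - \<beta>\<bar> < \<eta>}" "open {t::real. \<bar>t - 2 * pi * of_int k + \<beta>\<bar> < \<eta>}" for k :: int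
    by (intro open_Collect_less continuous_intros)+
  have mA: "A \<in> lmeasurable" and mB: "B \<in> lmeasurable"
    unfolding A_def B_def by (intro lmeasurable_continuous_preimage Fc open_UN ballI o)+
  have sub: "A \<subseteq> {-l..l}" "B \<subseteq> {-l..l}" by (auto simp: A_def B_def)
  define R where "R = {-l..l} - (A \<union> B)"
  have mI: "{-l..l} \<in> lmeasurable" by (simp add: lmeasurable_interval[of "-l" l, unfolded box_real])
  have mR: "R \<in> lmeasurable" unfolding R_def by (intro fmeasurable_Diff mI fmeasurableD fmeasurable.Un mA mB)
  have subR: "R \<subseteq> {-l..l}" by (auto simp: R_def)
  note iA = integral_indicator_Icc[OF mA sub(1)] and iB = integral_indicator_Icc[OF mB sub(2)]
    and iR = integral_indicator_Icc[OF mR subR]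
  have VF: "(\<lambda>x. V (F x)) integrable_on {-l..l}"
    by (intro integrable_continuous_interval continuous_on_compose2[OF V_continuous Fc]) auto
  have Rle: "measure lebesgue R \<le> \<tau>"
  proof -
    have "w * measure lebesgue R \<le> integral {-l..l} (\<lambda>x. V (F x))"
    proof (rule has_integral_le[OF has_integral_mult_right[OF iR, of w] integrable_integral[OF VF]])
      fix x assume "x \<in> {-l..l}"
      show "w * indicat_real R x \<le> V (F x)"
      proof (cases "x \<in> R")
        case True
        then have "w \<le> V (F x)" by (intro w(2)) (auto simp: R_def A_def B_def not_less)
        then show ?thesis using True by simp
      qed (use W_nonneg in auto)
    qed
    also have "\<dots> \<le> w * \<tau>" by (rule \<tau>(2))
    finally show ?thesis using w(1) by simp
  qed
  have sink: "sin (t - 2 * pi * of_int k) = sin t" for t and k :: int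
  proof -
    have "sin (t - 2 * pi * of_int k) = sin t * cos (2 * pi * of_int k) - cos t * sin (2 * pi * of_int k)"
      by (simp add: sin_diff)
    then show ?thesis using cos_int_2pin[of k] sin_int_2pin[of k] by simp
  qed
  have lip: "\<bar>sin a - sin b\<bar> \<le> \<bar>a - b\<bar>" for a b :: real
  proof -
    have "norm (sin a - sin b) \<le> 1 * norm (a - b)"
      by (rule field_differentiable_bound[of UNIV sin cos]) (auto intro: DERIV_sin)
    then show ?thesis by simp
  qed
  have sA: "\<bar>sin (F x) - sin \<beta>\<bar> \<le> \<eta>" if x: "x \<in> A" for x
  proof -
    obtain k :: int where "\<bar>F x - 2 * pi * of_int k - \<beta>\<bar> < \<eta>" using x by (auto simp: A_def)
    then show ?thesis using lip[of "F x - 2 * pi * of_int k" \<beta>] sink[of "F x" k] by simp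
  qed
  have sB: "\<bar>sin (F x) + sin \<beta>\<bar> \<le> \<eta>" if x: "x \<in> B" for x
  proof -
    obtain k :: int where "\<bar>F x - 2 * pi * of_int k + \<beta>\<bar> < \<eta>" using x by (auto simp: B_def)
    then show ?thesis using lip[of "F x - 2 * pi * of_int k" "-\<beta>"] sink[of "F x" k] by simp
  qed
  have disj: "A \<inter> B = {}"
  proof (rule ccontr)
    assume "A \<inter> B \<noteq> {}"
    then obtain x where x: "x \<in> A" "x \<in> B" by auto
    obtain k :: int where k: "\<bar>F x - 2 * pi * of_int k - \<beta>\<bar> < \<eta>" using x by (auto simp: A_def)
    obtain k' :: int where k': "\<bar>F x - 2 * pi * of_int k' + \<beta>\<bar> < \<eta>" using x by (auto simp: B_def)
    have "\<bar>2 * pi * of_int (k' - k) - 2 * \<beta>\<bar> < 2 * \<eta>" using k k' by (simp add: algebra_simps abs_less_iff)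
    then have 0: "0 < 2 * pi * of_int (k' - k)" "2 * pi * of_int (k' - k) < 2 * pi * 1"
      using \<eta>(2) \<beta>_less by linarith+
    then have "0 < k' - k" by (simp add: zero_less_mult_iff)
    moreover have "real_of_int (k' - k) < 1" using 0(2) by (subst (asm) mult_less_cancel_left_pos) auto
    ultimately show False by simp
  qed
  have sum: "measure lebesgue A + measure lebesgue B + measure lebesgue R = 2 * l"
  proof -
    have "((\<lambda>x. indicat_real A x + indicat_real B x + indicat_real R x) has_integral
        measure lebesgue A + measure lebesgue B + measure lebesgue R) {-l..l}"
      by (intro has_integral_add iA iB iR)
    moreover have "((\<lambda>x. indicat_real A x + indicat_real B x + indicat_real R x) has_integral 2 * l) {-l..l}"
    proof (rule has_integral_eq)
      show "((\<lambda>x. 1) has_integral 2 * l) {-l..l}" using has_integral_const_real[of "1::real" "-l" l] assms(1) by simp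
      show "1 = indicat_real A x + indicat_real B x + indicat_real R x" if "x \<in> {-l..l}" for x
        using that disj by (auto simp: R_def indicator_def)
    qed
    ultimately show ?thesis by (rule has_integral_unique)
  qed
  \<comment> \<open>Near the wells \<open>sin \<circ> F\<close> is within \<open>\<eta>\<close> of
    \<open>sin \<beta>\<close> on \<open>A\<close> and of \<open>- sin \<beta>\<close> on
    \<open>B\<close>, whatever the period. One \<open>\<tau>\<close> comes from the integral of
    \<open>sin \<circ> F\<close> and one from the remainder \<open>R\<close>; division by
    \<open>sin \<beta>\<close> gives the first term of \<open>\<kappa>\<close>.\<close>
  have bal: "\<bar>sin \<beta> * (measure lebesgue A - measure lebesgue B)\<bar> \<le> 2 * \<tau> + 2 * l * \<eta>"
  proof -
    have sF: "(\<lambda>x. sin (F x)) integrable_on {-l..l}" by (intro integrable_continuous_interval continuous_intros Fc)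
    have d: "((\<lambda>x. sin \<beta> * (indicat_real A x - indicat_real B x) - sin (F x)) has_integral
      sin \<beta> * (measure lebesgue A - measure lebesgue B) - integral {-l..l} (\<lambda>x. sin (F x))) {-l..l}"
      by (intro has_integral_diff has_integral_mult_right iA iB integrable_integral sF)
    have "((\<lambda>x. \<eta>) has_integral 2 * l * \<eta>) {-l..l}" using has_integral_const_real[of \<eta> "-l" l] assms(1) by simp
    then have u: "((\<lambda>x. \<eta> + indicat_real R x) has_integral 2 * l * \<eta> + measure lebesgue R) {-l..l}"
      by (intro has_integral_add iR)
    have "norm (sin \<beta> * (measure lebesgue A - measure lebesgue B) - integral {-l..l} (\<lambda>x. sin (F x))) \<le> 2 * l * \<eta> + measure lebesgue R"
      unfolding integral_unique[OF d, symmetric] integral_unique[OF u, symmetric]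
    proof (rule integral_norm_bound_integral)
      fix x assume x: "x \<in> {-l..l}"
      consider "x \<in> A" | "x \<in> B" | "x \<in> R" using x by (auto simp: R_def)
      then show "norm (sin \<beta> * (indicat_real A x - indicat_real B x) - sin (F x)) \<le> \<eta> + indicat_real R x"
      proof cases
        case 1
        then show ?thesis using sA[of x] disj by (auto simp: indicator_def R_def abs_minus_commute)
      next
        case 2
        then show ?thesis using sB[of x] disj by (auto simp: indicator_def R_def abs_minus_commute)
      next
        case 3
        then have "x \<notin> A" "x \<notin> B" by (auto simp: R_def)
        then show ?thesis using 3 abs_sin_le_one[of "F x"] \<eta>(1) by (simp del: abs_sin_le_one)
      qed
    qed (use d u in \<open>auto simp: integrable_on_def\<close>)
    then show ?thesis using \<tau>(3) Rle by simp
  qed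
  have bal': "\<bar>measure lebesgue A - measure lebesgue B\<bar> \<le> \<kappa> - \<tau>"
  proof -
    have "sin \<beta> * \<bar>measure lebesgue A - measure lebesgue B\<bar> \<le> 2 * \<tau> + 2 * l * \<eta>"
      using bal sb by (simp only: abs_mult abs_of_pos)
    then have "\<bar>measure lebesgue A - measure lebesgue B\<bar> \<le> (2 * \<tau> + 2 * l * \<eta>) / sin \<beta>"
      using sb by (simp only: pos_le_divide_eq mult.commute)
    then show ?thesis by (simp only: \<kappa>(1) add_diff_cancel_right')
  qed
  have lA: "l - \<kappa> \<le> measure lebesgue A" and lB: "l - \<kappa> \<le> measure lebesgue B"
    using bal' sum Rle \<tau>\<kappa> \<tau>(1) by linarith+
  have neA: "A \<noteq> {}" and neB: "B \<noteq> {}" using lA lB \<kappa>(2) assms(1) by auto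
  obtain x0 y0 where x0: "x0 \<in> A" and y0: "y0 \<in> B" using neA neB by auto
  have shiftL: "P (2 * pi * of_int k + 2 * pi - \<beta>) - P (2 * pi * of_int k + \<beta>) = L" for k :: int
    using P_shift[of "2 * pi - \<beta>" k \<beta>] by (simp add: algebra_simps)
  \<comment> \<open>Values on both sides of the gap between \<open>2*pi*k + \<beta>\<close> and the
    next well cost the long way twice, there and back around the circle, up to an error from
    \<open>\<eta>\<close>. This exceeds \<open>E\<close>.\<close>
  have far: False if "x \<in> {-l..l}" "y \<in> {-l..l}"
    "F x \<le> 2 * pi * of_int k + \<beta> + \<eta>" "2 * pi * of_int k + 2 * pi - \<beta> - \<eta> \<le> F y" for x y and k :: int
  proof -
    have "P (F x) \<le> P (2 * pi * of_int k + \<beta> + \<eta>)" "P (2 * pi * of_int k + 2 * pi - \<beta> - \<eta>) \<le> P (F y)"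
      using that by (auto intro: P_mono)
    moreover have "\<bar>P (2 * pi * of_int k + \<beta> + \<eta>) - P (2 * pi * of_int k + \<beta>)\<bar> \<le> C * \<eta>"
      using C(2)[of "2 * pi * of_int k + \<beta> + \<eta>" "2 * pi * of_int k + \<beta>"] \<eta>(1) by simp
    moreover have "\<bar>P (2 * pi * of_int k + 2 * pi - \<beta> - \<eta>) - P (2 * pi * of_int k + 2 * pi - \<beta>)\<bar> \<le> C * \<eta>"
      using C(2)[of "2 * pi * of_int k + 2 * pi - \<beta> - \<eta>" "2 * pi * of_int k + 2 * pi - \<beta>"] \<eta>(1) by simp
    ultimately have "L - 2 * (C * \<eta>) \<le> P (F y) - P (F x)" using shiftL[of k] by linarith
    also have "\<dots> \<le> \<bar>P (F x) - P (F y)\<bar>" by simp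
    finally have "2 * (L - 2 * (C * \<eta>)) \<le> E" using two[OF that(1,2)] by (meson order_trans mult_left_mono zero_le_numeral)
    then show False using \<eta>(4) by (simp add: mult.assoc)
  qed
  have same: "k = k'" if "x \<in> {-l..l}" "y \<in> {-l..l}"
    "\<bar>F x - 2 * pi * of_int k - \<beta>\<bar> < \<eta>" "\<bar>F y - 2 * pi * of_int k' + \<beta>\<bar> < \<eta>" for x y and k k' :: int
  proof (rule ccontr)
    assume "k \<noteq> k'"
    then consider "k + 1 \<le> k'" | "k' + 1 \<le> k" by linarith
    then show False
    proof cases
      case 1
      then have "of_int k + 1 \<le> (of_int k' :: real)" by linarith
      then have "2 * pi * (of_int k + 1) \<le> 2 * pi * (of_int k' :: real)" by (intro mult_left_mono) auto
      then have "2 * pi * of_int k + 2 * pi \<le> 2 * pi * (of_int k' :: real)" by (simp add: algebra_simps)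
      then show False using far[OF that(1,2), of k] that(3,4) by linarith
    next
      case 2
      then have "of_int k' + 1 \<le> (of_int k :: real)" by linarith
      then have "2 * pi * (of_int k' + 1) \<le> 2 * pi * (of_int k :: real)" by (intro mult_left_mono) auto
      then have "2 * pi * of_int k' + 2 * pi \<le> 2 * pi * (of_int k :: real)" by (simp add: algebra_simps)
      then show False using far[OF that(2,1), of k'] that(3,4) \<beta>_pos by linarith
    qed
  qed
  obtain k :: int where k: "\<bar>F x0 - 2 * pi * of_int k - \<beta>\<bar> < \<eta>" using x0 by (auto simp: A_def)
  have Bk: "\<bar>F y - 2 * pi * of_int k + \<beta>\<bar> < \<eta>" if x: "y \<in> B" for y
  proof -
    obtain k' :: int where k': "\<bar>F y - 2 * pi * of_int k' + \<beta>\<bar> < \<eta>" using x by (auto simp: B_def)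
    have "x0 \<in> {-l..l}" "y \<in> {-l..l}" using x x0 sub by blast+
    from same[OF this k k'] k' show ?thesis by simp
  qed
  have Ak: "\<bar>F x - 2 * pi * of_int k - \<beta>\<bar> < \<eta>" if x: "x \<in> A" for x
  proof -
    obtain k' :: int where k': "\<bar>F x - 2 * pi * of_int k' - \<beta>\<bar> < \<eta>" using x by (auto simp: A_def)
    have "x \<in> {-l..l}" "y0 \<in> {-l..l}" using x y0 sub by blast+
    from same[OF this k' Bk[OF y0]] k' show ?thesis by simp
  qed
  \<comment> \<open>On \<open>R\<close> the values are not near a well, so smallness of
    \<open>R\<close> helps only with a uniform bound. A value beyond \<open>2 * pi\<close> would lie
    across the long gap above \<open>\<beta>\<close> or below \<open>- \<beta>\<close>.\<close>
  have bdd: "\<bar>F x - 2 * pi * of_int k\<bar> \<le> 2 * pi" if x: "x \<in> {-l..l}" for x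
  proof (rule ccontr)
    assume "\<not> ?thesis"
    then consider "F x > 2 * pi * of_int k + 2 * pi" | "F x < 2 * pi * of_int k - 2 * pi" by linarith
    then show False
    proof cases
      case 1
      then show False using far[of x0 x k] x subsetD[OF sub(1) x0] Ak[OF x0] \<eta>(1) \<beta>_pos by linarith
    next
      case 2
      have "2 * pi * (of_int (k - 1) :: real) = 2 * pi * of_int k - 2 * pi" by (simp add: algebra_simps)
      then show False using far[of x y0 "k - 1"] 2 x subsetD[OF sub(2) y0] Bk[OF y0] \<eta>(1) \<beta>_pos by linarith
    qed
  qed
  have sep: "P \<beta> - 2 * C * \<eta> \<le> P (F a) - P (F b)" if "a \<in> A" "b \<in> B" for a b
  proof -
    have "\<bar>P (F a) - P (2 * pi * of_int k + \<beta>)\<bar> \<le> C * \<eta>"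
      by (rule order_trans[OF C(2)]) (use Ak[OF that(1)] C(1) in \<open>auto intro!: mult_left_mono simp: algebra_simps\<close>)
    moreover have "\<bar>P (F b) - P (2 * pi * of_int k - \<beta>)\<bar> \<le> C * \<eta>"
      by (rule order_trans[OF C(2)]) (use Bk[OF that(2)] C(1) in \<open>auto intro!: mult_left_mono simp: algebra_simps\<close>)
    moreover have "P (2 * pi * of_int k + \<beta>) - P (2 * pi * of_int k - \<beta>) = P \<beta>"
      using P_shift[of \<beta> k "-\<beta>"] by (simp add: algebra_simps)
    ultimately show ?thesis by linarith
  qed
  have "(\<forall>a\<in>A. \<forall>b\<in>B. \<forall>a'\<in>A. \<not> (a < b \<and> b < a')) \<or> (\<forall>b\<in>B. \<forall>a\<in>A. \<forall>b'\<in>B. \<not> (b < a \<and> a < b'))"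
  proof (rule noncrossing_cases[OF disj])
    fix a b a' b' assume x: "a \<in> A" "b \<in> B" "a' \<in> A" "b' \<in> B" "a < b" "b < a'" "a' < b'"
    have "\<bar>P (F b) - P (F a)\<bar> + \<bar>P (F a') - P (F b)\<bar> + \<bar>P (F b') - P (F a')\<bar> + \<bar>P (F a) - P (F b')\<bar> \<le> E"
      by (rule four) (use x sub in auto)
    then show False using sep[OF x(1,2)] sep[OF x(3,2)] sep[OF x(3,4)] sep[OF x(1,4)] \<eta>(3) by (smt (verit))
  next
    fix a b a' b' assume x: "b \<in> B" "a \<in> A" "b' \<in> B" "a' \<in> A" "b < a" "a < b'" "b' < a'"
    have "\<bar>P (F a) - P (F b)\<bar> + \<bar>P (F b') - P (F a)\<bar> + \<bar>P (F a') - P (F b')\<bar> + \<bar>P (F b) - P (F a')\<bar> \<le> E"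
      by (rule four) (use x sub in auto)
    then show False using sep[OF x(2,1)] sep[OF x(2,3)] sep[OF x(4,3)] sep[OF x(4,1)] \<eta>(3) by (smt (verit))
  qed
  \<comment> \<open>The set that is not split by the other one is the middle block:
    \<open>s = 1\<close> if it is \<open>A\<close>, \<open>s = -1\<close> if it is
    \<open>B\<close>.\<close>
  then obtain s c where s: "s = 1 \<or> s = -1" and c: "c \<in> {-l/2..l/2}" "c \<noteq> 0"
    and sc: "\<And>x. x \<in> A \<Longrightarrow> \<not> (l/2 - 2*\<kappa> \<le> \<bar>x - c\<bar> \<and> \<bar>x - c\<bar> \<le> l/2 + 2*\<kappa>) \<Longrightarrow> s * prof \<beta> l (x - c) = \<beta>"
    "\<And>x. x \<in> B \<Longrightarrow> \<not> (l/2 - 2*\<kappa> \<le> \<bar>x - c\<bar> \<and> \<bar>x - c\<bar> \<le> l/2 + 2*\<kappa>) \<Longrightarrow> s * prof \<beta> l (x - c) = -\<beta>"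
  proof (elim disjE)
    assume "\<forall>a\<in>A. \<forall>b\<in>B. \<forall>a'\<in>A. \<not> (a < b \<and> b < a')"
    then obtain c where c: "c \<in> {-l/2..l/2}" "c \<noteq> 0" "\<And>a. a \<in> A \<Longrightarrow> \<bar>a - c\<bar> \<le> l/2 + 2 * \<kappa>"
      "\<And>b. b \<in> B \<Longrightarrow> \<bar>b - c\<bar> \<ge> l/2 - 2 * \<kappa>"
      using middle_block[OF assms(1) \<kappa>0 \<kappa>(2) mA sub(1) lA mB sub(2) lB] by blast
    show thesis
    proof (rule that[of 1 c, OF _ c(1,2)])
      fix x assume nx: "\<not> (l/2 - 2*\<kappa> \<le> \<bar>x - c\<bar> \<and> \<bar>x - c\<bar> \<le> l/2 + 2*\<kappa>)"
      { assume "x \<in> A" from c(3)[OF this] show "1 * prof \<beta> l (x - c) = \<beta>" using nx \<kappa>0 unfolding prof_def by auto }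
      { assume "x \<in> B" from c(4)[OF this] show "1 * prof \<beta> l (x - c) = -\<beta>" using nx \<kappa>0 unfolding prof_def by auto }
    qed simp
  next
    assume "\<forall>b\<in>B. \<forall>a\<in>A. \<forall>b'\<in>B. \<not> (b < a \<and> a < b')"
    then obtain c where c: "c \<in> {-l/2..l/2}" "c \<noteq> 0" "\<And>a. a \<in> B \<Longrightarrow> \<bar>a - c\<bar> \<le> l/2 + 2 * \<kappa>"
      "\<And>b. b \<in> A \<Longrightarrow> \<bar>b - c\<bar> \<ge> l/2 - 2 * \<kappa>"
      using middle_block[OF assms(1) \<kappa>0 \<kappa>(2) mB sub(2) lB mA sub(1) lA] by blast
    show thesis
    proof (rule that[of "-1" c, OF _ c(1,2)])
      fix x assume nx: "\<not> (l/2 - 2*\<kappa> \<le> \<bar>x - c\<bar> \<and> \<bar>x - c\<bar> \<le> l/2 + 2*\<kappa>)"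
      { assume "x \<in> A" from c(4)[OF this] show "-1 * prof \<beta> l (x - c) = \<beta>" using nx \<kappa>0 unfolding prof_def by auto }
      { assume "x \<in> B" from c(3)[OF this] show "-1 * prof \<beta> l (x - c) = -\<beta>" using nx \<kappa>0 unfolding prof_def by auto }
    qed simp
  qed
  have "integral {-l..l} (\<lambda>x. \<bar>F x - 2 * pi * of_int k - s * prof \<beta> l (x - c)\<bar>) \<le> 2 * l * \<eta> + 10 * \<tau> + 16 * \<beta> * \<kappa>"
  proof -
    \<comment> \<open>Strips of width \<open>4 * \<kappa>\<close> around the two jumps, where the
      positions of \<open>A\<close> and \<open>B\<close> are undetermined and the error is at most
      \<open>\<eta> + 2 * \<beta>\<close>. This yields \<open>16 * \<beta> * \<kappa>\<close>; the
      term \<open>10 * \<tau>\<close> bounds the error \<open>2 * pi + \<beta> < 10\<close> on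
      \<open>R\<close>.\<close>
    define S1 S2 where "S1 = {c - l/2 - 2*\<kappa>..c - l/2 + 2*\<kappa>} \<inter> {-l..l}" and "S2 = {c + l/2 - 2*\<kappa>..c + l/2 + 2*\<kappa>} \<inter> {-l..l}"
    have S: "S1 \<in> lmeasurable" "S2 \<in> lmeasurable" "S1 \<subseteq> {-l..l}" "S2 \<subseteq> {-l..l}"
      unfolding S1_def S2_def by (auto intro!: fmeasurable.Int lmeasurable_interval[unfolded box_real])
    have mS: "measure lebesgue S1 \<le> 4 * \<kappa>" "measure lebesgue S2 \<le> 4 * \<kappa>"
      using measure_le_length[OF S(1), of "c - l/2 - 2*\<kappa>" "c - l/2 + 2*\<kappa>"] measure_le_length[OF S(2), of "c + l/2 - 2*\<kappa>" "c + l/2 + 2*\<kappa>"] \<kappa>0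
      by (auto simp: S1_def S2_def)
    note iS1 = integral_indicator_Icc[OF S(1,3)] and iS2 = integral_indicator_Icc[OF S(2,4)]
    have "((\<lambda>x. \<eta>) has_integral 2 * l * \<eta>) {-l..l}" using has_integral_const_real[of \<eta> "-l" l] assms(1) by simp
    then have u: "((\<lambda>x. \<eta> + 10 * indicat_real R x + 2 * \<beta> * (indicat_real S1 x + indicat_real S2 x)) has_integral
        2 * l * \<eta> + 10 * measure lebesgue R + 2 * \<beta> * (measure lebesgue S1 + measure lebesgue S2)) {-l..l}"
      by (intro has_integral_add has_integral_mult_right iR iS1 iS2)
    have "integral {-l..l} (\<lambda>x. \<bar>F x - 2 * pi * of_int k - s * prof \<beta> l (x - c)\<bar>) \<le>
       2 * l * \<eta> + 10 * measure lebesgue R + 2 * \<beta> * (measure lebesgue S1 + measure lebesgue S2)"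
    proof (rule has_integral_le[OF integrable_integral u])
      have "(\<lambda>x. F x - 2 * pi * of_int k - s * prof \<beta> l (x - c)) absolutely_integrable_on {-l..l}"
        by (intro set_integral_diff(1) set_integrable_mult_right integrable_prof absolutely_integrable_continuous_real Fc) auto
      then show "(\<lambda>x. \<bar>F x - 2 * pi * of_int k - s * prof \<beta> l (x - c)\<bar>) integrable_on {-l..l}"
        by (simp add: absolutely_integrable_on_def)
      fix x assume x: "x \<in> {-l..l}"
      have ps: "\<bar>s * prof \<beta> l (x - c)\<bar> \<le> \<beta>" using s \<beta>_pos by (auto simp: prof_def)
      consider "x \<in> R" | "x \<in> A \<union> B" "x \<in> S1 \<union> S2" | "x \<in> A" "x \<notin> S1 \<union> S2" | "x \<in> B" "x \<notin> S1 \<union> S2"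
        using x by (auto simp: R_def)
      then show "\<bar>F x - 2 * pi * of_int k - s * prof \<beta> l (x - c)\<bar> \<le>
        \<eta> + 10 * indicat_real R x + 2 * \<beta> * (indicat_real S1 x + indicat_real S2 x)"
      proof cases
        case 1
        have "\<bar>F x - 2 * pi * of_int k - s * prof \<beta> l (x - c)\<bar> \<le> 2 * pi + \<beta>"
          using bdd[OF x] ps by linarith
        also have "\<dots> \<le> 10" using pi_less_4 \<beta>_less by linarith
        also have "\<dots> \<le> \<eta> + 10 * indicat_real R x + 2 * \<beta> * (indicat_real S1 x + indicat_real S2 x)"
          using 1 \<eta>(1) \<beta>_pos by simp
        finally show ?thesis .
      next
        case 2
        have "\<bar>F x - 2 * pi * of_int k\<bar> \<le> \<beta> + \<eta>" using 2(1) Ak[of x] Bk[of x] \<beta>_pos by auto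
        then have "\<bar>F x - 2 * pi * of_int k - s * prof \<beta> l (x - c)\<bar> \<le> \<eta> + 0 + 2 * \<beta> * 1" using ps by linarith
        also have "\<dots> \<le> \<eta> + 10 * indicat_real R x + 2 * \<beta> * (indicat_real S1 x + indicat_real S2 x)"
          using 2(2) \<beta>_pos by (intro add_mono mult_left_mono) (auto simp: indicator_def)
        finally show ?thesis .
      next
        case 3
        have "\<not> (l/2 - 2*\<kappa> \<le> \<bar>x - c\<bar> \<and> \<bar>x - c\<bar> \<le> l/2 + 2*\<kappa>)"
          using 3(2) x by (auto simp: S1_def S2_def abs_if split: if_splits)
        then have "\<bar>F x - 2 * pi * of_int k - s * prof \<beta> l (x - c)\<bar> \<le> \<eta>" using sc(1)[OF 3(1)] Ak[OF 3(1)] by simp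
        then show ?thesis using \<beta>_pos by (auto simp: indicator_def)
      next
        case 4
        have "\<not> (l/2 - 2*\<kappa> \<le> \<bar>x - c\<bar> \<and> \<bar>x - c\<bar> \<le> l/2 + 2*\<kappa>)"
          using 4(2) x by (auto simp: S1_def S2_def abs_if split: if_splits)
        then have "\<bar>F x - 2 * pi * of_int k - s * prof \<beta> l (x - c)\<bar> \<le> \<eta>" using sc(2)[OF 4(1)] Bk[OF 4(1)] by simp
        then show ?thesis using \<beta>_pos by (auto simp: indicator_def)
      qed
    qed
    also have "\<dots> \<le> 2 * l * \<eta> + 10 * \<tau> + 2 * \<beta> * (4 * \<kappa> + 4 * \<kappa>)"
      using Rle mS \<beta>_pos by (intro add_mono mult_left_mono order_refl) auto
    finally show ?thesis by simp
  qed
  with s c show ?thesis by (intro that[of s c k])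
qed

end

section \<open>Triangle and square waves, the periodic models of the limit pair\<close>

definition tri :: "real \<Rightarrow> real \<Rightarrow> real" where
  "tri l x = l / pi * arcsin (sin (pi * x / l))"

text \<open>The periodic continuation of the sign of \<open>prof\<close>, with value 0 at the jumps;
  \<open>tri\<close> is its primitive. Both change sign under a shift by \<open>l\<close>, which
  closed trigonometric formulas on the whole line make immediate.\<close>

definition sq :: "real \<Rightarrow> real \<Rightarrow> real" where
  "sq l x = sgn (cos (pi * x / l))"

lemma tri_continuous: "l > 0 \<Longrightarrow> continuous_on S (tri l)"
  unfolding tri_def[abs_def] by (intro continuous_intros) auto

lemma tri_shift: "l > 0 \<Longrightarrow> tri l (x + l) = - tri l x" "l > 0 \<Longrightarrow> tri l (x - l) = - tri l x"
  by (simp_all add: tri_def distrib_left right_diff_distrib add_divide_distrib diff_divide_distrib arcsin_minus sin_diff sin_add)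

lemma sq_shift: "l > 0 \<Longrightarrow> sq l (x + l) = - sq l x" "l > 0 \<Longrightarrow> sq l (x - l) = - sq l x"
  by (simp_all add: sq_def distrib_left right_diff_distrib add_divide_distrib diff_divide_distrib cos_diff cos_add sgn_minus)

lemma periodic_int:
  fixes f :: "real \<Rightarrow> 'a"
  assumes "\<And>x. f (x + d) = f x"
  shows "f (x + of_int k * d) = f x"
proof -
  have n: "f (x + real n * d) = f x" for n x
  proof (induction n)
    case (Suc n)
    then show ?case using assms[of "x + real n * d"] by (simp add: algebra_simps)
  qed simp
  show ?thesis
  proof (cases "k \<ge> 0")
    case True then show ?thesis using n[of x "nat k"] by simp
  next
    case False then show ?thesis using n[of "x + of_int k * d" "nat (-k)"] by simp
  qed
qed

lemma tri_periodic: "l > 0 \<Longrightarrow> tri l (x + 2 * l) = tri l x"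
  using tri_shift(1)[of l "x + l"] tri_shift(1)[of l x] by (simp add: algebra_simps)

lemma sq_periodic: "l > 0 \<Longrightarrow> sq l (x + 2 * l) = sq l x"
  using sq_shift(1)[of l "x + l"] sq_shift(1)[of l x] by (simp add: algebra_simps)

lemma sq_borel: "sq l \<in> borel_measurable borel"
  unfolding sq_def[abs_def] by measurable

lemma sq_bound: "\<bar>sq l x\<bar> \<le> 1"
  by (simp add: sq_def abs_sgn_eq)

lemma tri_bound: "l > 0 \<Longrightarrow> \<bar>tri l x\<bar> \<le> l"
proof -
  assume l: "l > 0"
  have "\<bar>arcsin (sin (pi * x / l))\<bar> \<le> pi / 2" using arcsin_bounded[OF sin_ge_minus_one sin_le_one, of "pi * x / l"] by linarith
  then have "l / pi * \<bar>arcsin (sin (pi * x / l))\<bar> \<le> l / pi * (pi / 2)" using l by (intro mult_left_mono) auto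
  then have "\<bar>tri l x\<bar> \<le> l / 2" using l by (simp add: tri_def abs_mult)
  then show ?thesis using l by linarith
qed

lemma sq_eq:
  assumes "l > 0" "\<bar>x\<bar> < 3 * l / 2" "\<bar>x\<bar> \<noteq> l / 2"
  shows "sq l x = (if \<bar>x\<bar> < l / 2 then 1 else -1)"
proof (cases "\<bar>x\<bar> < l / 2")
  case True
  then have "pi * x < pi * (l / 2)" "pi * (- (l / 2)) < pi * x" by (intro mult_strict_left_mono; simp)+
  then have "- (pi/2) < pi * x / l" "pi * x / l < pi / 2" using assms(1) by (simp_all add: field_simps)
  then have "cos (pi * x / l) > 0" by (rule cos_gt_zero_pi)
  then show ?thesis using True by (simp add: sq_def)
next
  case False
  then have "\<bar>x\<bar> > l / 2" using assms(3) by simp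
  then have "- (pi/2) < pi * \<bar>x\<bar> / l - pi" "pi * \<bar>x\<bar> / l - pi < pi / 2"
    using assms(1,2) by (simp_all add: field_simps)
  then have "cos (pi * \<bar>x\<bar> / l - pi) > 0" by (intro cos_gt_zero_pi) auto
  then have "cos (pi * \<bar>x\<bar> / l) < 0" by (simp add: cos_diff)
  moreover have "cos (pi * \<bar>x\<bar> / l) = cos (pi * x / l)" by (cases "x \<ge> 0") auto
  ultimately show ?thesis using False by (simp add: sq_def)
qed

lemma prof_eq_sq:
  assumes "l > 0" "\<bar>x\<bar> < 3 * l / 2" "\<bar>x\<bar> \<noteq> l / 2"
  shows "prof \<beta> l x = \<beta> * sq l x"
  using sq_eq[OF assms] by (simp add: prof_def)

lemma tri_deriv:
  assumes "l > 0" "cos (pi * x / l) \<noteq> 0"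
  shows "(tri l has_real_derivative sq l x) (at x)"
proof -
  define z where "z = pi * x / l"
  have "(sin z)\<^sup>2 < 1" using assms(2) sin_cos_squared_add[of z] by (simp add: z_def[symmetric] sin_squared_eq)
  then have s: "-1 < sin z" "sin z < 1" using abs_square_less_1[of "sin z"] by auto
  have c: "sqrt (1 - (sin z)\<^sup>2) = \<bar>cos z\<bar>" by (simp add: cos_squared_eq[symmetric])
  have "(tri l has_real_derivative l / pi * (inverse (sqrt (1 - (sin z)\<^sup>2)) * (cos z * (pi / l)))) (at x)"
    unfolding tri_def[abs_def] z_def
    by (rule derivative_eq_intros DERIV_chain2[OF DERIV_arcsin] refl s[unfolded z_def] | use assms(1) in simp)+
  moreover have "l / pi * (inverse \<bar>cos z\<bar> * (cos z * (pi / l))) = sgn (cos z)"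
    using assms by (cases "cos z > 0") (auto simp: z_def[symmetric] field_simps)
  ultimately show ?thesis unfolding c by (simp add: sq_def z_def[symmetric])
qed

text \<open>Since \<open>sin\<close> is odd, \<open>sin\<close> of the step is
  \<open>sin \<beta>\<close> times the square wave. So this multiple of the triangle wave is the
  \<open>g\<close> that belongs to the step through \<open>g' = - sin \<theta>\<close>.\<close>

lemma AC_deriv_tri:
  assumes "l > 0" "c \<in> {-l/2..l/2}"
  shows "AC_deriv (-l) l (\<lambda>x. - sin \<beta> * tri l (x - c)) (\<lambda>x. - sin (prof \<beta> l (x - c)))"
proof (rule AC_deriv_finite[where S="{c - l/2, c + l/2}"])
  show "continuous_on {-l..l} (\<lambda>x. - sin \<beta> * tri l (x - c))"
    by (intro continuous_intros continuous_on_compose2[OF tri_continuous[OF assms(1)]]) auto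
  show "(\<lambda>x. - sin (prof \<beta> l (x - c))) absolutely_integrable_on {-l..l}"
  proof (rule absolutely_integrable_bounded_measurable[where B=1])
    show "(\<lambda>x. - sin (prof \<beta> l (x - c))) \<in> borel_measurable (lebesgue_on {-l..l})"
      unfolding prof_def by (intro borel_measurable_lebesgue_onI) measurable
  qed auto
  fix x assume x: "x \<in> {-l<..<l} - {c - l/2, c + l/2}"
  have b: "\<bar>x - c\<bar> < 3 * l / 2" "\<bar>x - c\<bar> \<noteq> l / 2" using x assms(2) by (auto simp: abs_if)
  have "sq l (x - c) \<noteq> 0" using sq_eq[OF assms(1) b] by simp
  then have "cos (pi * (x - c) / l) \<noteq> 0" by (simp add: sq_def sgn_zero_iff)
  from tri_deriv[OF assms(1) this]
  have "((\<lambda>x. tri l (x - c)) has_real_derivative sq l (x - c) * 1) (at x)"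
    by (rule DERIV_chain2) (auto intro!: derivative_eq_intros)
  then have "((\<lambda>x. - sin \<beta> * tri l (x - c)) has_real_derivative - sin \<beta> * sq l (x - c)) (at x)"
    by (auto intro!: derivative_eq_intros)
  moreover have "- sin \<beta> * sq l (x - c) = - sin (prof \<beta> l (x - c))"
    using sq_eq[OF assms(1) b] by (simp add: prof_def)
  ultimately show "((\<lambda>x. - sin \<beta> * tri l (x - c)) has_real_derivative - sin (prof \<beta> l (x - c))) (at x)" by simp
qed simp

text \<open>By antiperiodicity the integrals over two consecutive intervals of length
  \<open>l\<close> cancel. Hence removing the wave from \<open>g\<close> preserves its mean.\<close>

lemma integral_tri:
  assumes "l > 0"
  shows "integral {-l..l} (\<lambda>x. tri l (x - c)) = 0"
proof -
  have "continuous_on UNIV (\<lambda>x. tri l (x - c))"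
    by (rule continuous_on_compose2[OF tri_continuous[OF assms]]) (auto intro!: continuous_intros)
  then obtain K where K: "\<And>x. (K has_real_derivative tri l (x - c)) (at x)"
    "\<And>x y. x \<le> y \<Longrightarrow> integral {x..y} (\<lambda>x. tri l (x - c)) = K y - K x" using ex_antiderivative by metis
  have s: "tri l (x + l - c) = - tri l (x - c)" for x using tri_shift(1)[OF assms, of "x - c"] by (simp add: algebra_simps)
  have "((\<lambda>x. K (x + l) + K x) has_real_derivative tri l (x + l - c) * 1 + tri l (x - c)) (at x)" for x
    by (intro DERIV_add K(1) DERIV_chain2[OF K(1)]) (auto intro!: derivative_eq_intros)
  then have "((\<lambda>x. K (x + l) + K x) has_real_derivative 0) (at x)" for x by (simp add: s)
  then have "K (0 + l) + K 0 = K (-l + l) + K (-l)" using DERIV_isconst_all[of "\<lambda>x. K (x + l) + K x" 0 "-l"] by blast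
  then show ?thesis using K(2)[of "-l" l] assms by simp
qed

lemma integral_prof:
  assumes "l > 0" "c \<in> {-l/2..l/2}"
  shows "integral {-l..l} (\<lambda>x. prof \<beta> l (x - c)) = 0"
proof -
  define J where "J = {c - l/2<..<c + l/2}"
  have J: "J \<in> lmeasurable" "J \<subseteq> {-l..l}" "measure lebesgue J = l"
    using assms unfolding J_def by (auto simp: lmeasurable_interval[unfolded box_real])
  have "((\<lambda>x. \<beta>) has_integral 2 * l * \<beta>) {-l..l}" using has_integral_const_real[of \<beta> "-l" l] assms(1) by simp
  then have "((\<lambda>x. 2 * \<beta> * indicat_real J x - \<beta>) has_integral 2 * \<beta> * l - 2 * l * \<beta>) {-l..l}"
    using integral_indicator_Icc[OF J(1,2)] unfolding J(3) by (intro has_integral_diff has_integral_mult_right)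
  moreover have "(\<lambda>x. 2 * \<beta> * indicat_real J x - \<beta>) = (\<lambda>x. prof \<beta> l (x - c))"
    by (auto simp: prof_def J_def indicator_def abs_if fun_eq_iff)
  ultimately show ?thesis by (simp add: integral_unique)
qed

text \<open>\<open>c \<noteq> 0\<close> keeps \<open>c + l\<close> or \<open>c - l\<close> inside the open interval when the sign \<open>s\<close> is to be changed.\<close>

definition near_step :: "real \<Rightarrow> real \<Rightarrow> real \<Rightarrow> (real \<Rightarrow> real) \<Rightarrow> (real \<Rightarrow> real) \<Rightarrow> bool" where
  "near_step \<beta> l \<rho> f h \<longleftrightarrow> (\<exists>s c. (s = 1 \<or> s = -1) \<and> c \<in> {-l/2..l/2} \<and> c \<noteq> 0 \<and>
     (LINT x|lebesgue_on {-l<..<l}. \<bar>f x - s * prof \<beta> l (x - c)\<bar>) \<le> \<rho> \<and>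
     (AE x in lebesgue_on {-l<..<l}. \<bar>h x - s * (- sin \<beta> * tri l (x - c))\<bar> \<le> \<rho>))"

section \<open>Quantitative closeness to a step\<close>

context wells
begin

lemma sin_diff_period: "\<bar>sin x - sin y\<bar> \<le> \<bar>x - 2 * pi * of_int k - y\<bar>"
proof -
  have "norm (sin (x - 2 * pi * of_int k) - sin y) \<le> 1 * norm (x - 2 * pi * of_int k - y)"
    by (rule field_differentiable_bound[of UNIV sin cos]) (auto intro: DERIV_sin)
  moreover have "sin (x - 2 * pi * of_int k) = sin x"
    using cos_int_2pin[of k] sin_int_2pin[of k] by (simp add: sin_diff)
  ultimately show ?thesis by simp
qed

text \<open>The excess \<open>\<delta>\<close> depends on the potential only and does not shrink
  with \<open>\<rho>\<close>: it just has to exclude further transitions. All accuracy is obtained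
  from \<open>\<epsilon>\<close>. The constants are chosen in the order \<open>\<eta>\<close>
  (distance to the wells), \<open>w\<close>, \<open>\<tau>\<close> (size of the remainder),
  \<open>t\<close>, \<open>\<epsilon>1\<close>.\<close>

lemma low_energy_profile:
  assumes "l > 0" "D1 > 0"
  obtains \<delta> where "\<delta> > 0" "\<And>\<rho>. \<rho> > 0 \<Longrightarrow> \<exists>\<epsilon>1>0. \<forall>\<epsilon> \<theta> g. 0 < \<epsilon> \<and> \<epsilon> < \<epsilon>1 \<and> (\<theta>, g) \<in> Y_C l \<and>
      F_C \<sigma> D1 D2 a0 l \<epsilon> \<theta> g \<le> 2 * P \<beta> + \<delta> \<longrightarrow>
      (\<exists>k::int. near_step \<beta> l \<rho> (\<lambda>x. \<theta> x - 2 * pi * of_int k) (\<lambda>x. g x - mean l g) \<and>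
        \<bar>mean l \<theta> - 2 * pi * of_int k\<bar> \<le> \<rho>)"
proof -
  obtain C where C: "C > 0" "\<And>x y. \<bar>P x - P y\<bar> \<le> C * \<bar>x - y\<bar>" using P_lipschitz by blast
  have sb: "sin \<beta> > 0" using \<beta>_pos \<beta>_less by (intro sin_gt_zero) auto
  \<comment> \<open>Keeps \<open>2 * P \<beta> + \<delta>\<close> strictly below
    \<open>4 * P \<beta>\<close> and below \<open>2 * L\<close>, the two thresholds of
    \<open>two_blocks\<close>, with room for errors of order \<open>C * \<eta>\<close>. It is
    positive because of \<open>P_long_way\<close>.\<close>
  define \<delta> where "\<delta> = min (P \<beta> / 2) (L - P \<beta>)"
  have \<delta>: "\<delta> > 0" "\<delta> \<le> P \<beta> / 2" "\<delta> \<le> L - P \<beta>"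
  proof -
    show "\<delta> > 0" using P_beta_pos P_long_way by (simp add: \<delta>_def)
    show "\<delta> \<le> P \<beta> / 2" "\<delta> \<le> L - P \<beta>" unfolding \<delta>_def by (rule min.cobounded1, rule min.cobounded2)
  qed
  define E where "E = 2 * P \<beta> + \<delta>"
  have E: "E > 0" using P_beta_pos \<delta> by (simp add: E_def)
  have ll: "-l < l" using assms by simp
  show ?thesis
  proof (rule that[OF \<delta>(1)])
    fix \<rho> :: real assume \<rho>: "\<rho> > 0"
    text \<open>\<open>\<rho>'\<close> bounds the \<open>L\<^sup>1\<close> distances of \<open>\<theta>\<close> to the step and of \<open>g'\<close> to \<open>- sin \<theta>\<close>.\<close>
    define \<rho>' where "\<rho>' = min (\<rho> / 2) (l * \<rho>)"
    have \<rho>': "\<rho>' > 0" "\<rho>' \<le> \<rho> / 2" "\<rho>' \<le> l * \<rho>" using \<rho> assms by (auto simp: \<rho>'_def)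
    \<comment> \<open>\<open>N\<close>, and later \<open>M\<close>, majorize the coefficients of
      \<open>2 * \<eta>\<close> and of \<open>\<tau>\<close> both in \<open>4 * \<kappa>\<close> and
      in twice the error bound of \<open>two_blocks\<close>. Making \<open>2 * \<eta> * N\<close>
      and \<open>\<tau> * M\<close> at most \<open>l\<close> and at most \<open>\<rho>'\<close> then
      gives \<open>2 * \<kappa> \<le> l\<close> and an error of at most
      \<open>\<rho>'\<close>.\<close>
    define N where "N = 1 + 2 * l + 32 * \<beta> * l / sin \<beta> + 4 * l / sin \<beta>"
    have N: "N \<ge> 1" using assms \<beta>_pos sb by (auto simp: N_def intro!: add_nonneg_nonneg divide_nonneg_nonneg)
    define \<eta> where "\<eta> = min (min (\<beta>/2) (\<delta> / (8 * C))) (min (\<rho>' / (2 * N)) (l / (2 * N)))"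
    have \<eta>: "\<eta> > 0" "\<eta> < \<beta>" "\<eta> \<le> \<delta> / (8 * C)" "\<eta> \<le> \<rho>' / (2 * N)" "\<eta> \<le> l / (2 * N)"
      using \<delta> C(1) N \<rho>' assms \<beta>_pos by (auto simp: \<eta>_def)
    have \<eta>N: "2 * \<eta> * N \<le> \<rho>'" "2 * \<eta> * N \<le> l" using \<eta>(4,5) N by (simp_all add: field_simps)
    have C\<eta>: "8 * (C * \<eta>) \<le> \<delta>" using \<eta>(3) C(1) by (simp add: field_simps)
    have E1: "E < 4 * (P \<beta> - 2 * C * \<eta>)" "E < 2 * (L - 2 * C * \<eta>)"
    proof -
      have gap: "2 * q + \<delta> < 4 * (q - 2 * y)" "2 * q + \<delta> < 2 * (z - 2 * y)"
        if "8 * y \<le> \<delta>" "\<delta> \<le> q / 2" "\<delta> \<le> z - q" for q y z :: real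
        using that \<delta>(1) by argo+
      have "E < 4 * (P \<beta> - 2 * (C * \<eta>))" "E < 2 * (L - 2 * (C * \<eta>))"
        unfolding E_def by (rule gap[OF C\<eta> \<delta>(2,3)])+
      then show "E < 4 * (P \<beta> - 2 * C * \<eta>)" "E < 2 * (L - 2 * C * \<eta>)" by (simp_all only: mult.assoc)
    qed
    obtain w where w: "w > 0" "\<And>t. (\<And>k::int. \<eta> \<le> \<bar>t - 2 * pi * of_int k - \<beta>\<bar> \<and> \<eta> \<le> \<bar>t - 2 * pi * of_int k + \<beta>\<bar>) \<Longrightarrow> w \<le> V t"
      using V_away[OF \<eta>(1)] by metis
    define M where "M = 20 + 64 * \<beta> / sin \<beta> + 32 * \<beta> + 8 / sin \<beta> + 4"
    have M: "M \<ge> 24" using \<beta>_pos sb by (auto simp: M_def intro!: add_nonneg_nonneg divide_nonneg_nonneg)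
    define \<tau> where "\<tau> = min (\<rho>' / M) (l / M)"
    have \<tau>: "\<tau> > 0" "\<tau> \<le> \<rho>' / M" "\<tau> \<le> l / M" using \<rho>' assms M by (auto simp: \<tau>_def)
    have \<tau>M: "\<tau> * M \<le> \<rho>'" "\<tau> * M \<le> l" using \<tau>(2,3) M by (simp_all add: field_simps)
    define \<kappa> where "\<kappa> = (2 * \<tau> + 2 * l * \<eta>) / sin \<beta> + \<tau>"
    have \<kappa>2: "2 * \<kappa> \<le> l"
    proof -
      have "4 * \<kappa> = \<tau> * (8 / sin \<beta> + 4) + 2 * \<eta> * (4 * l / sin \<beta>)"
        using sb by (simp add: \<kappa>_def field_simps)
      also have "\<dots> \<le> \<tau> * M + 2 * \<eta> * N" using \<tau>(1) \<eta>(1) assms \<beta>_pos sb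
        by (intro add_mono mult_left_mono) (auto simp: M_def N_def intro!: add_nonneg_nonneg divide_nonneg_nonneg)
      finally show ?thesis using \<tau>M \<eta>N by simp
    qed
    have small: "2 * l * \<eta> + 10 * \<tau> + 16 * \<beta> * \<kappa> \<le> \<rho>'"
    proof -
      have "2 * (2 * l * \<eta> + 10 * \<tau> + 16 * \<beta> * \<kappa>) = \<tau> * (20 + 64 * \<beta> / sin \<beta> + 32 * \<beta>) + 2 * \<eta> * (2 * l + 32 * \<beta> * l / sin \<beta>)"
        using sb by (simp add: \<kappa>_def field_simps)
      also have "\<dots> \<le> \<tau> * M + 2 * \<eta> * N" using \<tau>(1) \<eta>(1) assms \<beta>_pos sb
        by (intro add_mono mult_left_mono) (auto simp: M_def N_def intro!: add_nonneg_nonneg divide_nonneg_nonneg)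
      finally show ?thesis using \<tau>M \<eta>N by simp
    qed
    have "\<tau> * 1 \<le> \<tau> * M" using M \<tau>(1) by (intro mult_left_mono) auto
    then have \<tau>\<rho>: "\<tau> \<le> \<rho>'" using \<tau>M(1) by simp
    \<comment> \<open>The weight in \<open>\<bar>y\<bar> \<le> t + y^2 / t\<close>, which turns the
      square integral of \<open>p + sin F\<close> into an L1 bound. The constant contributes
      \<open>2 * l * t = \<tau> / 2\<close>, and the choice of \<open>\<epsilon>1\<close> makes the
      quadratic part contribute at most as much.\<close>
    define t where "t = \<tau> / (4 * l)"
    have t: "t > 0" "2 * l * t = \<tau> / 2" using \<tau>(1) assms by (auto simp: t_def)
    define \<epsilon>1 where "\<epsilon>1 = min (w * \<tau> / E) (t * \<tau> / (2 * E))"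
    have \<epsilon>1: "\<epsilon>1 > 0" using w \<tau> E t by (simp add: \<epsilon>1_def)
    show "\<exists>\<epsilon>1>0. \<forall>\<epsilon> \<theta> g. 0 < \<epsilon> \<and> \<epsilon> < \<epsilon>1 \<and> (\<theta>, g) \<in> Y_C l \<and>
      F_C \<sigma> D1 D2 a0 l \<epsilon> \<theta> g \<le> 2 * P \<beta> + \<delta> \<longrightarrow>
      (\<exists>k::int. near_step \<beta> l \<rho> (\<lambda>x. \<theta> x - 2 * pi * of_int k) (\<lambda>x. g x - mean l g) \<and>
        \<bar>mean l \<theta> - 2 * pi * of_int k\<bar> \<le> \<rho>)"
    proof (intro exI[of _ \<epsilon>1] conjI \<epsilon>1 allI impI, elim conjE)
      fix \<epsilon> \<theta> g assume \<epsilon>: "0 < \<epsilon>" "\<epsilon> < \<epsilon>1" and Y: "(\<theta>, g) \<in> Y_C l" and en: "F_C \<sigma> D1 D2 a0 l \<epsilon> \<theta> g \<le> 2 * P \<beta> + \<delta>"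
      let ?E = "F_C \<sigma> D1 D2 a0 l \<epsilon> \<theta> g"
      have \<epsilon>E: "\<epsilon> * ?E \<le> w * \<tau>" "\<epsilon> * ?E \<le> t * \<tau> / 2"
      proof -
        have "\<epsilon> * ?E \<le> \<epsilon> * E" using \<epsilon> en by (simp add: E_def)
        also have "\<dots> \<le> \<epsilon>1 * E" using \<epsilon> E by simp
        finally have 1: "\<epsilon> * ?E \<le> \<epsilon>1 * E" .
        have "\<epsilon>1 * E \<le> (w * \<tau> / E) * E" "\<epsilon>1 * E \<le> (t * \<tau> / (2 * E)) * E"
          using E by (intro mult_right_mono; simp add: \<epsilon>1_def)+
        with 1 E show "\<epsilon> * ?E \<le> w * \<tau>" "\<epsilon> * ?E \<le> t * \<tau> / 2" by auto
      qed
      obtain F p G where Fc: "continuous_on {-l..l} F" and \<theta>F: "AE x in lebesgue_on {-l<..<l}. \<theta> x = F x"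
        and pc: "continuous_on {-l..l} p" and Gp: "AC_deriv (-l) l G p" and gG: "AE x in lebesgue_on {-l<..<l}. g x = G x" and Gl: "G (-l) = G l"
        and cyc: "cyclic_variation_le l (\<lambda>x. P (F x)) ?E"
        and ps: "integral {-l..l} (\<lambda>x. (p x + sin (F x))\<^sup>2) \<le> \<epsilon> * ?E"
        and VF: "integral {-l..l} (\<lambda>x. V (F x)) \<le> \<epsilon> * ?E"
      proof -
        show ?thesis by (rule Y_C_structure[OF assms \<epsilon>(1) Y], rule that; assumption)
      qed
      have i1: "(\<lambda>x. \<bar>p x + sin (F x)\<bar>) integrable_on {-l..l}"
        by (intro integrable_continuous_interval continuous_intros pc Fc)
      have g1: "integral {-l..l} (\<lambda>x. \<bar>p x + sin (F x)\<bar>) \<le> \<tau>"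
      proof -
        have i2: "(\<lambda>x. (p x + sin (F x))\<^sup>2) integrable_on {-l..l}"
          by (intro integrable_continuous_interval continuous_intros pc Fc)
        have "integral {-l..l} (\<lambda>x. \<bar>p x + sin (F x)\<bar>) \<le> integral {-l..l} (\<lambda>x. t + 1 / t * (p x + sin (F x))\<^sup>2)"
        proof (rule integral_le[OF i1])
          show "(\<lambda>x. t + 1 / t * (p x + sin (F x))\<^sup>2) integrable_on {-l..l}"
            using i2 by (intro integrable_add integrable_on_mult_right) auto
          fix x
          define y where "y = \<bar>p x + sin (F x)\<bar>"
          have "t * y \<le> t * t + y * y"
          proof -
            have "0 \<le> (t - y)\<^sup>2" by simp
            then have "2 * (t * y) \<le> t * t + y * y" by (simp add: power2_eq_square algebra_simps)
            moreover have "0 \<le> t * y" using t by (simp add: y_def)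
            ultimately show ?thesis by linarith
          qed
          then have "y \<le> t + 1 / t * y\<^sup>2" using t(1) by (simp add: field_simps power2_eq_square)
          then show "\<bar>p x + sin (F x)\<bar> \<le> t + 1 / t * (p x + sin (F x))\<^sup>2" by (simp add: y_def)
        qed
        also have "\<dots> = integral {-l..l} (\<lambda>x. t) + integral {-l..l} (\<lambda>x. 1 / t * (p x + sin (F x))\<^sup>2)"
          by (intro Henstock_Kurzweil_Integration.integral_add integrable_on_mult_right i2 integrable_const_ivl)
        also have "\<dots> = 2 * l * t + 1 / t * integral {-l..l} (\<lambda>x. (p x + sin (F x))\<^sup>2)"
          unfolding Henstock_Kurzweil_Integration.integral_mult_right using assms(1) by simp
        also have "\<dots> \<le> \<tau> / 2 + 1 / t * (t * \<tau> / 2)"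
          unfolding t(2) using ps \<epsilon>E(2) t(1) by (intro add_left_mono mult_left_mono) auto
        finally show ?thesis using t(1) by simp
      qed
      have sF: "(\<lambda>x. sin (F x)) integrable_on {-l..l}" by (intro integrable_continuous_interval continuous_intros Fc)
      have pi: "p integrable_on {-l..l}" by (intro integrable_continuous_interval pc)
      have p0: "integral {-l..l} p = 0" using AC_deriv_diff[OF Gp, of "-l" l] Gl assms by simp
      have sF\<tau>: "\<bar>integral {-l..l} (\<lambda>x. sin (F x))\<bar> \<le> \<tau>"
      proof -
        have "integral {-l..l} (\<lambda>x. sin (F x)) = integral {-l..l} (\<lambda>x. p x + sin (F x))"
          using p0 pi sF by (simp add: Henstock_Kurzweil_Integration.integral_add)
        also have "\<bar>\<dots>\<bar> \<le> integral {-l..l} (\<lambda>x. \<bar>p x + sin (F x)\<bar>)"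
          unfolding real_norm_def[symmetric]
          by (rule integral_norm_bound_integral) (use pi sF i1 in \<open>auto intro!: integrable_add\<close>)
        finally show ?thesis using g1 by simp
      qed
      have cyc': "cyclic_variation_le l (\<lambda>x. P (F x)) E"
        using cyc en unfolding cyclic_variation_le_def E_def by (meson order_trans)
      obtain k :: int and s c :: real where s: "s = 1 \<or> s = -1" and c: "c \<in> {-l/2..l/2}" "c \<noteq> 0" and
        dist: "integral {-l..l} (\<lambda>x. \<bar>F x - 2 * pi * of_int k - s * prof \<beta> l (x - c)\<bar>) \<le> 2 * l * \<eta> + 10 * \<tau> + 16 * \<beta> * \<kappa>"
        by (rule two_blocks[OF assms(1) Fc cyc' C \<eta>(1,2) E1 w \<tau>(1) order_trans[OF VF \<epsilon>E(1)] sF\<tau> \<kappa>_def \<kappa>2])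
      define d where "d x = F x - 2 * pi * of_int k - s * prof \<beta> l (x - c)" for x
      have di: "d absolutely_integrable_on {-l..l}"
        unfolding d_def[abs_def] by (intro set_integral_diff(1) set_integrable_mult_right integrable_prof absolutely_integrable_continuous_real Fc) auto
      have dai: "(\<lambda>x. \<bar>d x\<bar>) absolutely_integrable_on {-l..l}" using di by (rule set_integrable_abs)
      have d\<rho>: "integral {-l..l} (\<lambda>x. \<bar>d x\<bar>) \<le> \<rho>'" using dist small by (simp add: d_def)
      have 1: "(LINT x|lebesgue_on {-l<..<l}. \<bar>\<theta> x - 2 * pi * of_int k - s * prof \<beta> l (x - c)\<bar>) \<le> \<rho>"
      proof -
        have "(LINT x|lebesgue_on {-l<..<l}. \<bar>\<theta> x - 2 * pi * of_int k - s * prof \<beta> l (x - c)\<bar>) = integral {-l..l} (\<lambda>x. \<bar>d x\<bar>)"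
          by (rule LINT_Ioo_AE(2)[OF _ dai]) (use \<theta>F in \<open>eventually_elim, simp add: d_def\<close>)
        then show ?thesis using d\<rho> \<rho>' \<rho> by simp
      qed
      have 2: "\<bar>mean l \<theta> - 2 * pi * of_int k\<bar> \<le> \<rho>"
      proof -
        have "integral {-l..l} d = integral {-l..l} (\<lambda>x. F x - 2 * pi * of_int k) - integral {-l..l} (\<lambda>x. s * prof \<beta> l (x - c))"
          unfolding d_def[abs_def]
          by (rule Henstock_Kurzweil_Integration.integral_diff)
            (auto intro!: integrable_continuous_interval continuous_intros Fc integrable_on_mult_right set_lebesgue_integral_eq_integral(1)[OF integrable_prof])
        also have "integral {-l..l} (\<lambda>x. s * prof \<beta> l (x - c)) = 0"
          using integral_prof[OF assms(1) c(1), of \<beta>] by simp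
        also have "integral {-l..l} (\<lambda>x. F x - 2 * pi * of_int k) = integral {-l..l} F - 2 * l * (2 * pi * of_int k)"
          using assms(1) by (subst Henstock_Kurzweil_Integration.integral_diff) (auto intro!: integrable_continuous_interval Fc)
        also have "integral {-l..l} F = 2 * l * mean l \<theta>"
          using LINT_Ioo_AE(2)[OF \<theta>F absolutely_integrable_continuous_real[OF Fc]] assms(1) by (simp add: mean_def)
        finally have "2 * l * (mean l \<theta> - 2 * pi * of_int k) = integral {-l..l} d" by (simp add: algebra_simps)
        then have "\<bar>2 * l * (mean l \<theta> - 2 * pi * of_int k)\<bar> = \<bar>integral {-l..l} d\<bar>" by (rule arg_cong)
        then have "2 * l * \<bar>mean l \<theta> - 2 * pi * of_int k\<bar> = \<bar>integral {-l..l} d\<bar>" using assms(1) by (simp add: abs_mult)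
        also have "\<dots> \<le> integral {-l..l} (\<lambda>x. \<bar>d x\<bar>)"
          unfolding real_norm_def[symmetric]
          by (rule integral_norm_bound_integral) (use di dai in \<open>auto simp: set_lebesgue_integral_eq_integral(1)\<close>)
        also have "\<dots> \<le> l * \<rho>" using d\<rho> \<rho>'(3) by linarith
        finally have "l * (2 * \<bar>mean l \<theta> - 2 * pi * of_int k\<bar>) \<le> l * \<rho>" by simp
        then have "2 * \<bar>mean l \<theta> - 2 * pi * of_int k\<bar> \<le> \<rho>" using assms(1) by (simp only: mult_le_cancel_left_pos)
        then show ?thesis by (rule order_trans[rotated]) simp
      qed
      have 3: "AE x in lebesgue_on {-l<..<l}. \<bar>g x - mean l g - s * (- sin \<beta> * tri l (x - c))\<bar> \<le> \<rho>"
      proof -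
        \<comment> \<open>The difference of \<open>g\<close> and its model wave. Its derivative has
          L1 norm at most \<open>\<rho>\<close>, so \<open>D\<close> oscillates by at most
          \<open>\<rho>\<close>; the mean of \<open>D\<close> is that of \<open>g\<close>, because
          the wave has mean zero.\<close>
        define D where "D x = G x + (-s) * (- sin \<beta> * tri l (x - c))" for x
        define D' where "D' x = p x + (-s) * (- sin (prof \<beta> l (x - c)))" for x
        have DD: "AC_deriv (-l) l D D'"
          unfolding D_def[abs_def] D'_def[abs_def] by (intro AC_deriv_add AC_deriv_cmult Gp AC_deriv_tri assms(1) c(1))
        have bound: "\<bar>D y - D x\<bar> \<le> \<rho>" if xy: "-l \<le> x" "x \<le> y" "y \<le> l" for x y
        proof -
          have "\<bar>D y - D x\<bar> = norm (integral {x..y} D')" using AC_deriv_diff[OF DD xy] by simp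
          also have "\<dots> \<le> integral {x..y} (\<lambda>x. \<bar>D' x\<bar>)"
            by (rule integral_norm_bound_integral) (use AC_deriv_integrable[OF DD] xy in auto)
          also have "\<dots> \<le> integral {-l..l} (\<lambda>x. \<bar>D' x\<bar>)"
            by (rule integral_subset_le) (use AC_deriv_integrable[OF DD] xy in auto)
          also have "\<dots> \<le> integral {-l..l} (\<lambda>x. \<bar>p x + sin (F x)\<bar> + \<bar>d x\<bar>)"
          proof (rule integral_le)
            show "(\<lambda>x. \<bar>D' x\<bar>) integrable_on {-l..l}" using AC_deriv_integrable[OF DD] by auto
            show "(\<lambda>x. \<bar>p x + sin (F x)\<bar> + \<bar>d x\<bar>) integrable_on {-l..l}"
              by (intro integrable_add i1 set_lebesgue_integral_eq_integral(1)[OF dai])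
            fix x
            have "s * sin (prof \<beta> l (x - c)) = sin (s * prof \<beta> l (x - c))" using s by auto
            then have "D' x = (p x + sin (F x)) - (sin (F x) - sin (s * prof \<beta> l (x - c)))" by (simp add: D'_def)
            then have "\<bar>D' x\<bar> \<le> \<bar>p x + sin (F x)\<bar> + \<bar>sin (F x) - sin (s * prof \<beta> l (x - c))\<bar>" by linarith
            also have "\<bar>sin (F x) - sin (s * prof \<beta> l (x - c))\<bar> \<le> \<bar>d x\<bar>"
              unfolding d_def by (rule sin_diff_period)
            finally show "\<bar>D' x\<bar> \<le> \<bar>p x + sin (F x)\<bar> + \<bar>d x\<bar>" by simp
          qed
          also have "\<dots> = integral {-l..l} (\<lambda>x. \<bar>p x + sin (F x)\<bar>) + integral {-l..l} (\<lambda>x. \<bar>d x\<bar>)"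
            by (intro Henstock_Kurzweil_Integration.integral_add i1 set_lebesgue_integral_eq_integral(1)[OF dai])
          also have "\<dots> \<le> \<rho>" using g1 d\<rho> \<tau>\<rho> \<rho>'(2) by linarith
          finally show ?thesis .
        qed
        note Dc = AC_deriv_continuous[OF DD] and Gc = AC_deriv_continuous[OF Gp]
        have tc: "continuous_on {-l..l} (\<lambda>x. tri l (x - c))"
          by (intro continuous_on_compose2[OF tri_continuous[OF assms(1)]] continuous_intros) auto
        have "integral {-l..l} D = integral {-l..l} G + integral {-l..l} (\<lambda>x. (-s) * (- sin \<beta> * tri l (x - c)))"
          unfolding D_def[abs_def]
          by (rule Henstock_Kurzweil_Integration.integral_add) (intro integrable_continuous_interval continuous_intros Gc tc)+
        also have "integral {-l..l} (\<lambda>x. (-s) * (- sin \<beta> * tri l (x - c))) = 0"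
          using integral_tri[OF assms(1), of c] by simp
        also have "integral {-l..l} G = 2 * l * mean l g"
          using LINT_Ioo_AE(2)[OF gG absolutely_integrable_continuous_real[OF Gc]] assms(1) by (simp add: mean_def)
        finally have mD: "integral {-l..l} D = 2 * l * mean l g" by simp
        have Db: "\<bar>D x - mean l g\<bar> \<le> \<rho>" if x: "x \<in> {-l..l}" for x
        proof -
          have "2 * l * (D x - mean l g) = integral {-l..l} (\<lambda>y. D x - D y)"
            using mD assms(1) by (subst Henstock_Kurzweil_Integration.integral_diff) (auto intro!: integrable_continuous_interval Dc simp: algebra_simps)
          then have "\<bar>2 * l * (D x - mean l g)\<bar> = \<bar>integral {-l..l} (\<lambda>y. D x - D y)\<bar>" by (rule arg_cong)
          then have "2 * l * \<bar>D x - mean l g\<bar> = norm (integral {-l..l} (\<lambda>y. D x - D y))" using assms(1) by (simp add: abs_mult)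
          also have "\<dots> \<le> integral {-l..l} (\<lambda>y. \<rho>)"
          proof (rule integral_norm_bound_integral)
            show "(\<lambda>y. D x - D y) integrable_on {-l..l}" by (intro integrable_continuous_interval continuous_intros Dc)
            show "norm (D x - D y) \<le> \<rho>" if "y \<in> {-l..l}" for y
              using bound[of x y] bound[of y x] x that by (cases "x \<le> y") (auto simp: abs_minus_commute)
          qed auto
          also have "\<dots> = 2 * l * \<rho>" using assms(1) by simp
          finally show ?thesis using assms(1) by simp
        qed
        show ?thesis
        proof (rule lebesgue_on_mono[OF gG])
          fix x assume "g x = G x" "x \<in> {-l<..<l}"
          then show "\<bar>g x - mean l g - s * (- sin \<beta> * tri l (x - c))\<bar> \<le> \<rho>"
            using Db[of x] by (simp add: D_def algebra_simps)
        qed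
      qed
      have "near_step \<beta> l \<rho> (\<lambda>x. \<theta> x - 2 * pi * of_int k) (\<lambda>x. g x - mean l g)"
        unfolding near_step_def using s c 1 3 by blast
      with 2 show "\<exists>k::int. near_step \<beta> l \<rho> (\<lambda>x. \<theta> x - 2 * pi * of_int k) (\<lambda>x. g x - mean l g) \<and>
        \<bar>mean l \<theta> - 2 * pi * of_int k\<bar> \<le> \<rho>" by blast
    qed
  qed
qed

end

subsection \<open>Translation of periodic extensions\<close>

lemma integrable_shift_interval:
  fixes f :: "real \<Rightarrow> real"
  assumes "f absolutely_integrable_on {a + c..b + c}"
  shows "(\<lambda>x. f (x + c)) absolutely_integrable_on {a..b}"
    "integral {a..b} (\<lambda>x. f (x + c)) = integral {a + c..b + c} f"
proof -
  have im: "(\<lambda>x. x + c) ` {a..b} = {a + c..b + c}" by (simp add: image_add_atLeastAtMost')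
  have "((\<lambda>x. \<bar>1\<bar> * f (x + c)) absolutely_integrable_on {a..b} \<and> integral {a..b} (\<lambda>x. \<bar>1\<bar> * f (x + c)) = integral {a + c..b + c} f)
     = (f absolutely_integrable_on (\<lambda>x. x + c) ` {a..b} \<and> integral ((\<lambda>x. x + c) ` {a..b}) f = integral {a + c..b + c} f)"
    by (rule has_absolute_integral_change_of_variables_1') (auto intro!: derivative_eq_intros inj_onI)
  with assms im show "(\<lambda>x. f (x + c)) absolutely_integrable_on {a..b}"
    "integral {a..b} (\<lambda>x. f (x + c)) = integral {a + c..b + c} f" by auto
qed

lemma periodic_ext_eq:
  assumes "l > 0" "-l \<le> x - 2 * l * of_int k" "x - 2 * l * of_int k < l"
  shows "periodic_ext l f x = f (x - 2 * l * of_int k)"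
proof -
  have "\<lfloor>(x + l) / (2 * l)\<rfloor> = k"
    by (rule floor_unique) (use assms in \<open>auto simp: field_simps\<close>)
  then show ?thesis by (simp add: periodic_ext_def)
qed

lemma ex_periodic_ext:
  assumes "l > 0"
  obtains k :: int where "-l \<le> x - 2 * l * of_int k" "x - 2 * l * of_int k < l"
    "\<And>f. periodic_ext l f x = f (x - 2 * l * of_int k)"
proof -
  define k where "k = \<lfloor>(x + l) / (2 * l)\<rfloor>"
  have "of_int k \<le> (x + l) / (2 * l)" "(x + l) / (2 * l) < of_int k + 1" by (auto simp: k_def)
  then have "-l \<le> x - 2 * l * of_int k" "x - 2 * l * of_int k < l" using assms by (auto simp: field_simps)
  then show ?thesis using that periodic_ext_eq[OF assms] by metis
qed

text \<open>With \<open>c\<close> reduced modulo \<open>2 * l\<close> to \<open>c'\<close> in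
  \<open>[0, 2 * l)\<close>, the translate runs through \<open>f\<close> on
  \<open>[-l + c', l]\<close> and, after wrapping around at \<open>l - c'\<close>, on
  \<open>[-l, -l + c']\<close>. The half-open convention of \<open>periodic_ext\<close> matters only
  at the endpoints of these pieces, a null set.\<close>

lemma periodic_ext_translate:
  fixes f :: "real \<Rightarrow> real"
  assumes "l > 0" "c \<in> {-l<..<l}" and f: "f absolutely_integrable_on {-l..l}"
  shows "(\<lambda>x. periodic_ext l f (x + c)) absolutely_integrable_on {-l..l}"
    "integral {-l..l} (\<lambda>x. periodic_ext l f (x + c)) = integral {-l..l} f"
proof -
  obtain k :: int and c' where c': "0 \<le> c'" "c' < 2 * l" "c' = c - 2 * l * of_int k"
  proof (cases "c \<ge> 0")
    case True
    show ?thesis by (rule that[of c 0]) (use True assms(1,2) in simp_all)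
  next
    case False
    show ?thesis by (rule that[of "c + 2 * l" "-1"]) (use False assms(1,2) in simp_all)
  qed
  let ?g = "\<lambda>x. periodic_ext l f (x + c)"
  have e1: "?g x = f (x + c')" if "x \<in> {-l..l-c'} - {l-c'}" for x
  proof -
    have eq: "x + c - 2 * l * of_int k = x + c'" using c'(3) by simp
    have "periodic_ext l f (x + c) = f (x + c - 2 * l * of_int k)"
      by (rule periodic_ext_eq[OF assms(1)]; unfold eq) (use that c'(1,2) in auto)
    then show ?thesis by (simp only: eq)
  qed
  have e2: "?g x = f (x + (c' - 2 * l))" if "x \<in> {l-c'..l} - {l}" for x
  proof -
    have eq: "x + c - 2 * l * of_int (k + 1) = x + (c' - 2 * l)" using c'(3) by (simp add: algebra_simps)
    have "periodic_ext l f (x + c) = f (x + c - 2 * l * of_int (k + 1))"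
      by (rule periodic_ext_eq[OF assms(1)]; unfold eq) (use that c'(1,2) in auto)
    then show ?thesis by (simp only: eq)
  qed
  have s1: "f absolutely_integrable_on {-l + c'..(l - c') + c'}"
    by (rule absolutely_integrable_on_subinterval[OF f]) (use c' in auto)
  have s2: "f absolutely_integrable_on {(l - c') + (c' - 2 * l)..l + (c' - 2 * l)}"
    by (rule absolutely_integrable_on_subinterval[OF f]) (use c' in auto)
  note i1 = integrable_shift_interval[OF s1] and i2 = integrable_shift_interval[OF s2]
  have g1: "?g absolutely_integrable_on {-l..l-c'}"
    by (rule absolutely_integrable_spike[OF i1(1), of "{l-c'}"]) (use e1 in auto)
  have g2: "?g absolutely_integrable_on {l-c'..l}"
    by (rule absolutely_integrable_spike[OF i2(1), of "{l}"]) (use e2 in auto)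
  have j1: "integral {-l..l-c'} ?g = integral {-l + c'..l} f"
    using integral_spike[of "{l-c'}" "{-l..l-c'}" ?g "\<lambda>x. f (x + c')"] e1 i1(2) by simp
  have j2: "integral {l-c'..l} ?g = integral {-l..-l + c'} f"
    using integral_spike[of "{l}" "{l-c'..l}" ?g "\<lambda>x. f (x + (c' - 2 * l))"] e2 i2(2) by (simp add: algebra_simps)
  show G: "?g absolutely_integrable_on {-l..l}"
    by (rule absolutely_integrable_on_combine[OF g1 g2]) (use c' in auto)
  have "integral {-l..l} ?g = integral {-l..l-c'} ?g + integral {l-c'..l} ?g"
    by (rule Henstock_Kurzweil_Integration.integral_combine[symmetric]) (use c' G in \<open>auto simp: set_lebesgue_integral_eq_integral(1)\<close>)
  also have "\<dots> = integral {-l..-l + c'} f + integral {-l + c'..l} f" using j1 j2 by simp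
  also have "\<dots> = integral {-l..l} f"
    by (rule Henstock_Kurzweil_Integration.integral_combine) (use c' f in \<open>auto simp: set_lebesgue_integral_eq_integral(1)\<close>)
  finally show "integral {-l..l} ?g = integral {-l..l} f" .
qed

text \<open>Composition with \<open>arctan\<close> makes \<open>f\<close> bounded, hence integrable,
  so that \<open>periodic_ext_translate\<close> gives measurability; \<open>tan\<close> then undoes
  the composition.\<close>

lemma borel_measurable_periodic_ext_translate:
  fixes f :: "real \<Rightarrow> real"
  assumes "l > 0" "c \<in> {-l<..<l}" and f: "f \<in> borel_measurable (lebesgue_on {-l<..<l})"
  shows "(\<lambda>x. periodic_ext l f (x + c)) \<in> borel_measurable (lebesgue_on {-l<..<l})"
proof -
  have "in_Lp 1 {-l<..<l} (\<lambda>x. arctan (f x))"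
  proof (rule in_Lp_bounded)
    show "(\<lambda>x. arctan (f x)) \<in> borel_measurable (lebesgue_on {-l<..<l})"
      using f by measurable
    show "\<bar>arctan (f x)\<bar> \<le> pi / 2" for x using arctan_bounded[of "f x"] by linarith
  qed
  then have "(\<lambda>x. arctan (f x)) absolutely_integrable_on {-l<..<l}"
    by (auto simp: in_Lp_def absolutely_integrable_measurable_real)
  then have "(\<lambda>x. arctan (f x)) absolutely_integrable_on {-l..l}"
    by (simp add: absolutely_integrable_on_Icc_iff_Ioo)
  from periodic_ext_translate(1)[OF assms(1,2) this]
  have "(\<lambda>x. periodic_ext l (\<lambda>x. arctan (f x)) (x + c)) absolutely_integrable_on {-l<..<l}"
    by (simp add: absolutely_integrable_on_Icc_iff_Ioo)
  then have m: "(\<lambda>x. periodic_ext l (\<lambda>x. arctan (f x)) (x + c)) \<in> borel_measurable (lebesgue_on {-l<..<l})"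
    by (rule absolutely_integrable_imp_borel_measurable) auto
  have "tan \<in> borel_measurable (borel :: real measure)"
    unfolding tan_def[abs_def] by measurable
  then have "(\<lambda>x. tan (periodic_ext l (\<lambda>x. arctan (f x)) (x + c))) \<in> borel_measurable (lebesgue_on {-l<..<l})"
    using m by measurable
  then show ?thesis by (simp add: periodic_ext_def tan_arctan)
qed

text \<open>A change of variables on the circle moves the translation, and the sign since
  \<open>\<bar>a j\<bar> = 1\<close>, from \<open>f j\<close> to the periodic function
  \<open>h\<close>. The function \<open>h'\<close> represents the same class on the interval, in the
  form that the statement prescribes.\<close>

lemma tendsto_Lp_translate:
  fixes f :: "nat \<Rightarrow> real \<Rightarrow> real"
  assumes "l > 0" and c: "\<And>j. c j \<in> {-l<..<l}" and a: "\<And>j. a j \<in> {-1, 1}"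
    and f: "\<And>j. in_Lp p {-l<..<l} (f j)" and p: "p > 0"
    and h: "h \<in> borel_measurable borel" "\<And>x. \<bar>h x\<bar> \<le> B" "\<And>x. h (x + 2 * l) = h x"
    and h': "AE x in lebesgue_on {-l<..<l}. h' x = h x"
    and lim: "(\<lambda>j. LINT x|lebesgue_on {-l<..<l}. \<bar>f j x - a j * h (x - c j)\<bar> ^ p) \<longlonglongrightarrow> 0"
  shows "tendsto_Lp p {-l<..<l} (\<lambda>j x. a j * periodic_ext l (f j) (x + c j)) h'"
proof -
  let ?I = "{-l<..<l}"
  have hp: "h (x - 2 * l * of_int k) = h x" for x and k :: int
    using periodic_int[of h "2 * l", OF h(3), of x "- k"] by (simp add: algebra_simps)
  have in1: "in_Lp p ?I (\<lambda>x. a j * periodic_ext l (f j) (x + c j))" for j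
  proof -
    have m: "(\<lambda>x. periodic_ext l (f j) (x + c j)) \<in> borel_measurable (lebesgue_on ?I)"
      by (rule borel_measurable_periodic_ext_translate[OF assms(1) c]) (use f in_Lp_def in blast)
    have "(\<lambda>x. \<bar>f j x\<bar> ^ p) absolutely_integrable_on {-l..l}"
      using f[of j] by (simp add: in_Lp_def integrable_lebesgue_on_iff absolutely_integrable_on_Icc_iff_Ioo)
    from periodic_ext_translate(1)[OF assms(1) c this]
    have "(\<lambda>x. \<bar>a j * periodic_ext l (f j) (x + c j)\<bar> ^ p) absolutely_integrable_on ?I"
      using a[of j] by (auto simp: periodic_ext_def absolutely_integrable_on_Icc_iff_Ioo)
    then show ?thesis using m by (auto simp: in_Lp_def integrable_lebesgue_on_iff)
  qed
  have hm: "h \<in> borel_measurable (lebesgue_on S)" for S by (rule borel_measurable_lebesgue_onI[OF h(1)])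
  have hin: "in_Lp p ?I h" by (rule in_Lp_bounded[OF hm h(2)])
  have in2: "in_Lp p ?I h'"
    by (rule in_Lp_AE[OF hin]) (use h' in \<open>auto elim: AE_mp\<close>)
  have eq: "(LINT x|lebesgue_on ?I. \<bar>a j * periodic_ext l (f j) (x + c j) - h' x\<bar> ^ p) =
      (LINT x|lebesgue_on ?I. \<bar>f j x - a j * h (x - c j)\<bar> ^ p)" for j
  proof -
    define F where "F x = \<bar>f j x - a j * h (x - c j)\<bar> ^ p" for x
    have Fi: "F absolutely_integrable_on {-l..l}"
      unfolding absolutely_integrable_on_Icc_iff_Ioo
    proof (rule measurable_bounded_by_integrable_imp_absolutely_integrable)
      have "f j \<in> borel_measurable (lebesgue_on ?I)" using f in_Lp_def by blast
      moreover have "(\<lambda>x. h (x - c j)) \<in> borel_measurable (lebesgue_on ?I)"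
        by (rule borel_measurable_lebesgue_onI) (use h(1) in measurable)
      ultimately show "F \<in> borel_measurable (lebesgue_on ?I)"
        unfolding F_def[abs_def] by measurable
      show "(\<lambda>x. 2 ^ p * (\<bar>f j x\<bar> ^ p + \<bar>B\<bar> ^ p)) integrable_on ?I"
      proof (intro integrable_on_mult_right integrable_add)
        show "(\<lambda>x. \<bar>f j x\<bar> ^ p) integrable_on ?I"
          using f[of j] by (auto simp: in_Lp_def intro: integrable_on_lebesgue_on)
        show "(\<lambda>x. \<bar>B\<bar> ^ p) integrable_on ?I"
          by (intro integrable_on_const) (simp add: lmeasurable_interval[of "-l" l, unfolded box_real])
      qed
      fix x
      have "\<bar>f j x - a j * h (x - c j)\<bar> \<le> \<bar>f j x\<bar> + \<bar>B\<bar>"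
        using h(2)[of "x - c j"] a[of j] by auto
      also have "\<dots> \<le> 2 * max \<bar>f j x\<bar> \<bar>B\<bar>" by simp
      finally have "F x \<le> (2 * max \<bar>f j x\<bar> \<bar>B\<bar>) ^ p" unfolding F_def by (rule power_mono) simp
      also have "\<dots> \<le> 2 ^ p * (\<bar>f j x\<bar> ^ p + \<bar>B\<bar> ^ p)"
        by (auto simp: power_mult_distrib max_def)
      finally show "norm (F x) \<le> 2 ^ p * (\<bar>f j x\<bar> ^ p + \<bar>B\<bar> ^ p)" by (simp add: F_def)
    qed auto
    note T = periodic_ext_translate[OF assms(1) c[of j] Fi]
    have "(LINT x|lebesgue_on ?I. \<bar>a j * periodic_ext l (f j) (x + c j) - h' x\<bar> ^ p)
       = integral {-l..l} (\<lambda>x. periodic_ext l F (x + c j))"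
    proof (rule LINT_Ioo_AE(2)[OF _ T(1)], rule lebesgue_on_mono[OF h'])
      fix x assume x: "h' x = h x"
      obtain k :: int where k: "\<And>f. periodic_ext l f (x + c j) = f (x + c j - 2 * l * of_int k)"
        using ex_periodic_ext[OF assms(1), of "x + c j"] by metis
      have "h (x + c j - 2 * l * of_int k - c j) = h x" using hp[of x k] by (simp add: algebra_simps)
      then have "periodic_ext l F (x + c j) = \<bar>periodic_ext l (f j) (x + c j) - a j * h x\<bar> ^ p"
        unfolding k F_def by simp
      also have "\<bar>periodic_ext l (f j) (x + c j) - a j * h x\<bar> = \<bar>a j * periodic_ext l (f j) (x + c j) - h x\<bar>"
        using a[of j] by (auto simp: abs_if)
      finally show "\<bar>a j * periodic_ext l (f j) (x + c j) - h' x\<bar> ^ p = periodic_ext l F (x + c j)" by (simp add: x)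
    qed
    also have "\<dots> = integral {-l..l} F" by (rule T(2))
    also have "\<dots> = (LINT x|lebesgue_on ?I. F x)" using LINT_Ioo[OF Fi] by simp
    finally show ?thesis by (simp add: F_def)
  qed
  show ?thesis unfolding tendsto_Lp_def eq using in1 in2 lim by blast
qed

subsection \<open>The limit profile\<close>

text \<open>Against a test function the step integrates to
  \<open>(u - v) * (\<phi> (l/2) - \<phi> (-l/2))\<close>, so the supremum is governed by the two
  point values at the jumps.\<close>

lemma total_variation_step:
  assumes "l > 0" "AE x in lebesgue_on {-l<..<l}. f x = (if \<bar>x\<bar> < l / 2 then u else v)"
  shows "total_variation {-l<..<l} f = ereal (2 * \<bar>u - v\<bar>)"
proof -
  let ?I = "{-l<..<l}"
  have test: "(LINT x|lebesgue_on ?I. f x * deriv \<phi> x) = (u - v) * (\<phi> (l/2) - \<phi> (-l/2))"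
    if \<phi>: "\<phi> \<in> C1_compact_support ?I" for \<phi>
  proof -
    have C1: "\<phi> C1_differentiable_on UNIV" using \<phi> by (simp add: C1_compact_support_def)
    note D = C1_has_deriv[OF C1]
    have FTC: "(deriv \<phi> has_integral \<phi> y - \<phi> x) {x..y}" if "x \<le> y" for x y
      by (rule fundamental_theorem_of_calculus[OF that])
        (use D(1) in \<open>auto simp: has_real_derivative_iff_has_vector_derivative[symmetric] intro: has_field_derivative_at_within\<close>)
    obtain c d where "-l < c" "d < l" "\<And>x. x \<notin> {c<..<d} \<Longrightarrow> \<phi> x = 0"
      using C1_compact_supportE[OF \<phi>] assms(1) by (metis less_trans neg_less_0_iff_less)
    then have \<phi>l: "\<phi> (-l) = 0" "\<phi> l = 0" by auto
    define g where "g x = (if \<bar>x\<bar> < l / 2 then u else v) * deriv \<phi> x" for x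
    have gi: "g absolutely_integrable_on {-l..l}"
      unfolding g_def
    proof (rule absolutely_integrable_bounded_measurable_product_real)
      show "(\<lambda>x. if \<bar>x\<bar> < l / 2 then u else v) \<in> borel_measurable (lebesgue_on {-l..l})"
        by (intro borel_measurable_lebesgue_onI) measurable
      show "bounded ((\<lambda>x. if \<bar>x\<bar> < l / 2 then u else v) ` {-l..l})"
        by (rule boundedI[of _ "max \<bar>u\<bar> \<bar>v\<bar>"]) auto
      show "deriv \<phi> absolutely_integrable_on {-l..l}"
        by (rule absolutely_integrable_continuous_real[OF continuous_on_subset[OF D(2)]]) simp
    qed simp
    have "(g has_integral v * (\<phi> (-l/2) - \<phi> (-l))) {-l..-l/2}"
      by (rule has_integral_spike_finite[of "{-l/2}", OF _ _ has_integral_mult_right[OF FTC]]) (use assms(1) in \<open>auto simp: g_def\<close>)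
    moreover have "(g has_integral u * (\<phi> (l/2) - \<phi> (-l/2))) {-l/2..l/2}"
      by (rule has_integral_spike_finite[of "{-l/2, l/2}", OF _ _ has_integral_mult_right[OF FTC]]) (use assms(1) in \<open>auto simp: g_def\<close>)
    ultimately have "(g has_integral v * (\<phi> (-l/2) - \<phi> (-l)) + u * (\<phi> (l/2) - \<phi> (-l/2))) {-l..l/2}"
      by (rule has_integral_combine[rotated 2]) (use assms(1) in auto)
    moreover have "(g has_integral v * (\<phi> l - \<phi> (l/2))) {l/2..l}"
      by (rule has_integral_spike_finite[of "{l/2}", OF _ _ has_integral_mult_right[OF FTC]]) (use assms(1) in \<open>auto simp: g_def\<close>)
    ultimately have "(g has_integral v * (\<phi> (-l/2) - \<phi> (-l)) + u * (\<phi> (l/2) - \<phi> (-l/2)) + v * (\<phi> l - \<phi> (l/2))) {-l..l}"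
      by (rule has_integral_combine[rotated 2]) (use assms(1) in auto)
    then have "integral {-l..l} g = (u - v) * (\<phi> (l/2) - \<phi> (-l/2))"
      using \<phi>l by (simp add: integral_unique algebra_simps)
    moreover have "(LINT x|lebesgue_on ?I. f x * deriv \<phi> x) = integral {-l..l} g"
      by (rule LINT_Ioo_AE(2)[OF _ gi]) (use assms(2) in \<open>eventually_elim, simp add: g_def\<close>)
    ultimately show ?thesis by simp
  qed
  show ?thesis
    unfolding total_variation_def
  proof (rule antisym)
    show "(SUP \<phi>\<in>{\<phi> \<in> C1_compact_support ?I. \<forall>x. \<bar>\<phi> x\<bar> \<le> 1}. ereal (LINT x|lebesgue_on ?I. f x * deriv \<phi> x)) \<le> ereal (2 * \<bar>u - v\<bar>)"
    proof (rule SUP_least)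
      fix \<phi> assume \<phi>: "\<phi> \<in> {\<phi> \<in> C1_compact_support ?I. \<forall>x. \<bar>\<phi> x\<bar> \<le> 1}"
      have "(u - v) * (\<phi> (l/2) - \<phi> (-l/2)) \<le> \<bar>u - v\<bar> * \<bar>\<phi> (l/2) - \<phi> (-l/2)\<bar>"
        by (simp only: abs_mult[symmetric] abs_ge_self)
      also have "\<dots> \<le> \<bar>u - v\<bar> * 2"
      proof (rule mult_left_mono)
        have "\<bar>\<phi> (l/2)\<bar> \<le> 1" "\<bar>\<phi> (-l/2)\<bar> \<le> 1" using \<phi> by blast+
        then show "\<bar>\<phi> (l/2) - \<phi> (-l/2)\<bar> \<le> 2" by linarith
      qed simp
      finally show "ereal (LINT x|lebesgue_on ?I. f x * deriv \<phi> x) \<le> ereal (2 * \<bar>u - v\<bar>)"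
        using test[of \<phi>] \<phi> by simp
    qed
    \<comment> \<open>The supremum is attained: opposite bumps of height 1 at the two jumps. The
      radius \<open>l/4\<close> keeps their supports disjoint and inside the interval.\<close>
    define s where "s = (if u \<ge> v then 1 else -1 :: real)"
    define r where "r = l / 4"
    have r: "r > 0" using assms(1) by (simp add: r_def)
    define \<phi> where "\<phi> x = s * (bump ((x - l/2) / r) - bump ((x + l/2) / r))" for x
    have D: "(\<phi> has_real_derivative s * (- 4 * ((x - l/2) / r) * max 0 (1 - ((x - l/2) / r)\<^sup>2) * (1 / r)
        - (- 4 * ((x + l/2) / r) * max 0 (1 - ((x + l/2) / r)\<^sup>2) * (1 / r)))) (at x)" for x
      unfolding \<phi>_def[abs_def] using r
      by (intro DERIV_cmult DERIV_diff DERIV_bump) (auto intro!: derivative_eq_intros)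
    have "\<phi> \<in> C1_compact_support ?I"
    proof (rule C1_compact_supportI[OF D])
      show "continuous_on UNIV (\<lambda>x. s * (- 4 * ((x - l/2) / r) * max 0 (1 - ((x - l/2) / r)\<^sup>2) * (1 / r)
        - (- 4 * ((x + l/2) / r) * max 0 (1 - ((x + l/2) / r)\<^sup>2) * (1 / r))))"
        using r by (intro continuous_intros) auto
      show "-l < - (3 * l / 4)" "3 * l / 4 < l" using assms(1) by auto
      fix x assume x: "x \<notin> {- (3 * l / 4)..3 * l / 4}"
      then have "1 \<le> \<bar>(x - l/2) / r\<bar>" "1 \<le> \<bar>(x + l/2) / r\<bar>"
        using r assms(1) unfolding abs_divide by (auto simp: r_def field_simps abs_if)
      then show "\<phi> x = 0" by (simp add: \<phi>_def bump_eq_0)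
    qed
    moreover have "\<bar>\<phi> x\<bar> \<le> 1" for x
    proof -
      have "\<bar>bump ((x - l/2) / r) - bump ((x + l/2) / r)\<bar> \<le> 1"
        using bump_bounds[of "(x - l/2) / r"] bump_bounds[of "(x + l/2) / r"] by linarith
      then show ?thesis by (simp add: \<phi>_def s_def abs_mult)
    qed
    moreover have "(u - v) * (\<phi> (l/2) - \<phi> (-l/2)) = 2 * \<bar>u - v\<bar>"
    proof -
      have "bump (l / r) = 0" "bump (- l / r) = 0" using r by (auto intro!: bump_eq_0 simp: r_def)
      then show ?thesis by (simp add: \<phi>_def s_def)
    qed
    ultimately show "ereal (2 * \<bar>u - v\<bar>) \<le> (SUP \<phi>\<in>{\<phi> \<in> C1_compact_support ?I. \<forall>x. \<bar>\<phi> x\<bar> \<le> 1}. ereal (LINT x|lebesgue_on ?I. f x * deriv \<phi> x))"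
      by (intro SUP_upper2[of \<phi>]) (auto simp: test)
  qed
qed

lemma AE_abs_diff_ne:
  fixes a b c r :: real
  shows "AE x in lebesgue_on {a<..<b}. \<bar>x - c\<bar> \<noteq> r"
proof -
  have "negligible {x \<in> {a<..<b}. \<not> \<bar>x - c\<bar> \<noteq> r}"
  proof (rule negligible_subset)
    show "negligible {c - r, c + r}" by (rule negligible_finite) simp
    show "{x \<in> {a<..<b}. \<not> \<bar>x - c\<bar> \<noteq> r} \<subseteq> {c - r, c + r}"
    proof
      fix x assume "x \<in> {x \<in> {a<..<b}. \<not> \<bar>x - c\<bar> \<noteq> r}"
      then have "\<bar>x - c\<bar> = r" by simp
      then have "x = c - r \<or> x = c + r" by arith
      then show "x \<in> {c - r, c + r}" by simp
    qed
  qed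
  then show ?thesis by (subst AE_lebesgue_on_iff) auto
qed

lemma tendsto_zeroI:
  fixes f :: "nat \<Rightarrow> real"
  assumes "\<And>\<rho>. \<rho> > 0 \<Longrightarrow> \<forall>\<^sub>F j in sequentially. \<bar>f j\<bar> \<le> \<rho>"
  shows "f \<longlonglongrightarrow> 0"
proof (rule tendstoI)
  fix e :: real assume "e > 0"
  then have "\<forall>\<^sub>F j in sequentially. \<bar>f j\<bar> \<le> e / 2" by (intro assms) simp
  then show "\<forall>\<^sub>F j in sequentially. dist (f j) 0 < e"
    by (rule eventually_mono) (use \<open>e > 0\<close> in auto)
qed

text \<open>A shift by half a period changes the sign of both waves simultaneously, so any
  prescribed sign \<open>a\<close> is reached by moving \<open>c\<close> to \<open>c + l\<close> or
  \<open>c - l\<close>, whichever lies in the interval.\<close>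

lemma translate_square_wave:
  assumes "l > 0" "c \<in> {-l/2..l/2}" "c \<noteq> 0" "s = 1 \<or> s = -1" "a = 1 \<or> a = (-1::real)"
  obtains c' where "c' \<in> {-l<..<l}" "\<And>x. a * tri l (x - c') = s * tri l (x - c)"
    "\<And>x. x \<in> {-l<..<l} \<Longrightarrow> \<bar>x - c\<bar> \<noteq> l / 2 \<Longrightarrow> a * (\<beta> * sq l (x - c')) = s * prof \<beta> l (x - c)"
proof -
  have pr: "prof \<beta> l (x - c) = \<beta> * sq l (x - c)" if "x \<in> {-l<..<l}" "\<bar>x - c\<bar> \<noteq> l / 2" for x
    by (rule prof_eq_sq) (use assms(1,2) that in \<open>auto simp: abs_if\<close>)
  show ?thesis
  proof (cases "a = s")
    case True
    then show ?thesis using that[of c] pr assms by auto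
  next
    case False
    then have as: "a = - s" using assms by auto
    show ?thesis
    proof (cases "c < 0")
      case True
      have "tri l (x - (c + l)) = - tri l (x - c)" "sq l (x - (c + l)) = - sq l (x - c)" for x
        using tri_shift(2)[OF assms(1), of "x - c"] sq_shift(2)[OF assms(1), of "x - c"] by (simp_all add: diff_diff_eq)
      then show ?thesis using that[of "c + l"] pr True assms(1,2) as by simp
    next
      case False
      then have "c > 0" using assms(3) by simp
      moreover have "tri l (x - (c - l)) = - tri l (x - c)" "sq l (x - (c - l)) = - sq l (x - c)" for x
        using tri_shift(1)[OF assms(1), of "x - c"] sq_shift(1)[OF assms(1), of "x - c"] by (simp_all add: algebra_simps)
      ultimately show ?thesis using that[of "c - l"] pr assms(1,2) as by simp
    qed
  qed
qed

context wells
begin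

text \<open>Both traces of the step are \<open>-\<beta>\<close>, so the boundary term vanishes. The
  two interior jumps contribute \<open>P \<beta>\<close> each, because
  \<open>P (-\<beta>) = 0\<close>.\<close>

lemma G_C0_step:
  assumes "l > 0"
  defines "J \<equiv> {-l/2<..<l/2}"
  shows "G_C0 \<sigma> D2 a0 \<beta> l (\<lambda>x. \<beta> * indicator J x - \<beta> * (1 - indicator J x), \<lambda>x. - sin \<beta> * tri l x + m) = ereal (2 * P \<beta>)"
proof -
  let ?I = "{-l<..<l}"
  have ll: "-l < l" using assms by simp
  define f where "f x = \<beta> * indicator J x - \<beta> * (1 - indicator J x)" for x :: real
  define g where "g x = - sin \<beta> * tri l x + m" for x
  have f: "f = prof \<beta> l" by (auto simp: f_def prof_def J_def fun_eq_iff indicator_def abs_if)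
  have fm: "prof \<beta> l \<in> borel_measurable (lebesgue_on S)" for S
    unfolding prof_def[abs_def] by (intro borel_measurable_lebesgue_onI) measurable
  have gA: "AC_deriv (-l) l g (\<lambda>x. - sin (prof \<beta> l x))"
    using AC_deriv_add_const[OF AC_deriv_tri[OF assms(1), of 0 \<beta>]] assms(1) by (simp add: g_def[abs_def])
  have s2: "in_Lp p ?I (\<lambda>x. - sin (prof \<beta> l x))" for p
  proof (rule in_Lp_bounded)
    show "(\<lambda>x. - sin (prof \<beta> l x)) \<in> borel_measurable (lebesgue_on ?I)" using fm by measurable
    show "\<bar>- sin (prof \<beta> l x)\<bar> \<le> 1" for x by simp
  qed
  note wg = AC_deriv_W12[OF gA ll s2]
  have bvf: "in_BV ?I f"
    unfolding in_BV_def f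
  proof
    show "in_Lp 1 ?I (prof \<beta> l)" by (rule in_Lp_bounded[OF fm, where B="\<bar>\<beta>\<bar>"]) (simp add: prof_def)
    show "total_variation ?I (prof \<beta> l) < \<infinity>"
      using total_variation_step[OF assms(1), of "prof \<beta> l" \<beta> "-\<beta>"] by (simp add: prof_def)
  qed
  have bvg: "in_BV ?I (weak_deriv ?I g)"
    unfolding in_BV_def
  proof
    show "in_Lp 1 ?I (weak_deriv ?I g)" by (rule in_Lp_AE[OF s2]) (use wg(2) in \<open>auto elim: AE_mp\<close>)
    have "AE x in lebesgue_on ?I. weak_deriv ?I g x = (if \<bar>x\<bar> < l/2 then - sin \<beta> else sin \<beta>)"
      using wg(2) by eventually_elim (simp add: prof_def)
    from total_variation_step[OF assms(1) this] show "total_variation ?I (weak_deriv ?I g) < \<infinity>" by simp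
  qed
  have "(LINT x|lebesgue_on ?I. f x) = 0"
    using LINT_Ioo[where f=f and a="-l" and b=l] integrable_prof[where \<beta>=\<beta> and l=l and c=0 and a="-l" and b=l] integral_prof[of l 0 \<beta>] assms(1) by (simp add: f)
  moreover have "AE x in lebesgue_on ?I. weak_deriv ?I g x + sin (f x) = 0"
    using wg(2) by eventually_elim (simp add: f)
  ultimately have A: "(f, g) \<in> A_C l" using bvf bvg wg(1) by (simp add: A_C_def Let_def)
  have tr: "bdry_trace ?I f z = -\<beta>" if z: "z = -l \<or> z = l" for z
  proof (rule bdry_trace_eq[OF ll z])
    show "f absolutely_integrable_on {-l..l}" using integrable_prof[where \<beta>=\<beta> and l=l and c=0 and a="-l" and b=l] by (simp add: f)
    fix \<eta> :: real assume "\<eta> > 0"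
    have "\<bar>x - z\<bar> < l/2 \<longrightarrow> \<bar>f x - - \<beta>\<bar> \<le> \<eta>" if "x \<in> ?I" for x
      using that z \<open>\<eta> > 0\<close> by (auto simp: f prof_def abs_if)
    then show "\<exists>d>0. AE x in lebesgue_on ?I. \<bar>x - z\<bar> < d \<longrightarrow> \<bar>f x - - \<beta>\<bar> \<le> \<eta>"
      using assms(1) by (intro exI[of _ "l/2"] conjI AE_I2) auto
  qed
  have "total_variation ?I (\<lambda>x. P (f x)) = ereal (2 * \<bar>P \<beta> - 0\<bar>)"
    by (rule total_variation_step[OF assms(1)]) (auto simp: f prof_def)
  then have "G_C0 \<sigma> D2 a0 \<beta> l (f, g) = ereal (2 * P \<beta>)"
    using A tr P_beta_pos by (simp add: G_C0_def Let_def)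
  then show ?thesis by (simp add: f_def[abs_def] g_def[abs_def])
qed

text \<open>The shifts \<open>m\<close> make both conclusions of the theorem instances of one statement: there \<open>m\<close>
  is \<open>0\<close>, respectively the limit of the means of \<open>g\<close>.\<close>

lemma converges_to_profileI:
  assumes "l > 0" and a: "\<And>j. a j = 1 \<or> a j = -1"
    and f1: "\<And>j. in_Lp 1 {-l<..<l} (f j)" and g2: "\<And>j. in_Lp 2 {-l<..<l} (g j)"
    and ev: "\<And>\<rho>. \<rho> > 0 \<Longrightarrow> \<forall>\<^sub>F j in sequentially. near_step \<beta> l \<rho> (f j) (\<lambda>x. g j x - a j * m)"
  shows "converges_to_profile \<sigma> D2 a0 \<beta> l f g"
proof -
  let ?I = "{-l<..<l}"
  define h where "h x = \<beta> * sq l x" for x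
  define k where "k x = - sin \<beta> * tri l x + m" for x
  define fd where "fd j c = (LINT x|lebesgue_on ?I. \<bar>f j x - a j * h (x - c)\<bar> ^ 1)" for j c
  define gd where "gd j c = (LINT x|lebesgue_on ?I. \<bar>g j x - a j * k (x - c)\<bar> ^ 2)" for j c
  have evc: "\<forall>\<^sub>F j in sequentially. \<exists>c\<in>?I. fd j c \<le> \<rho> \<and> gd j c \<le> 2 * l * \<rho>\<^sup>2" if \<rho>: "\<rho> > 0" for \<rho>
    using ev[OF \<rho>]
  proof eventually_elim
    fix j
    assume "near_step \<beta> l \<rho> (f j) (\<lambda>x. g j x - a j * m)"
    then obtain s c where s: "s = 1 \<or> s = -1" and c: "c \<in> {-l/2..l/2}" "c \<noteq> 0" and
      fl: "(LINT x|lebesgue_on ?I. \<bar>f j x - s * prof \<beta> l (x - c)\<bar>) \<le> \<rho>" and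
      gl: "AE x in lebesgue_on ?I. \<bar>g j x - a j * m - s * (- sin \<beta> * tri l (x - c))\<bar> \<le> \<rho>"
      unfolding near_step_def by blast
    obtain c' where c': "c' \<in> ?I" "\<And>x. a j * tri l (x - c') = s * tri l (x - c)"
      "\<And>x. x \<in> ?I \<Longrightarrow> \<bar>x - c\<bar> \<noteq> l / 2 \<Longrightarrow> a j * (\<beta> * sq l (x - c')) = s * prof \<beta> l (x - c)"
      using translate_square_wave[OF assms(1) c s a[of j], of \<beta>] by blast
    have "f j absolutely_integrable_on {-l..l}"
      using f1[of j] unfolding in_Lp_def absolutely_integrable_on_Icc_iff_Ioo by (simp add: absolutely_integrable_measurable_real)
    then have fi: "(\<lambda>x. \<bar>f j x - s * prof \<beta> l (x - c)\<bar>) absolutely_integrable_on {-l..l}"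
      by (intro set_integrable_abs set_integral_diff(1) set_integrable_mult_right integrable_prof)
    have "AE x in lebesgue_on ?I. \<bar>x - c\<bar> \<noteq> l / 2" by (rule AE_abs_diff_ne)
    then have "AE x in lebesgue_on ?I. \<bar>f j x - a j * h (x - c')\<bar> ^ 1 = \<bar>f j x - s * prof \<beta> l (x - c)\<bar>"
      by (rule lebesgue_on_mono) (simp add: h_def c'(3))
    from LINT_Ioo_AE(2)[OF this fi] have "fd j c' = (LINT x|lebesgue_on ?I. \<bar>f j x - s * prof \<beta> l (x - c)\<bar>)"
      using LINT_Ioo[OF fi] by (simp add: fd_def)
    then have 1: "fd j c' \<le> \<rho>" using fl by simp
    have keq: "a j * k (x - c') = a j * m + s * (- sin \<beta> * tri l (x - c))" for x
    proof -
      have "a j * k (x - c') = a j * m - sin \<beta> * (a j * tri l (x - c'))" by (simp add: k_def algebra_simps)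
      then show ?thesis by (simp add: c'(2))
    qed
    have "gd j c' \<le> (LINT x|lebesgue_on ?I. \<rho>\<^sup>2)"
      unfolding gd_def
    proof (rule Bochner_Integration.integral_mono_AE')
      show "integrable (lebesgue_on ?I) (\<lambda>x. \<rho>\<^sup>2)"
        by (simp add: integrable_lebesgue_on_iff lmeasurable_interval[of "-l" l, unfolded box_real])
      show "AE x in lebesgue_on ?I. \<bar>g j x - a j * k (x - c')\<bar>\<^sup>2 \<le> \<rho>\<^sup>2"
        using gl
      proof (rule lebesgue_on_mono)
        fix x assume "\<bar>g j x - a j * m - s * (- sin \<beta> * tri l (x - c))\<bar> \<le> \<rho>"
        then have "\<bar>g j x - a j * k (x - c')\<bar> \<le> \<rho>" unfolding keq by (simp only: diff_diff_eq)
        then show "\<bar>g j x - a j * k (x - c')\<bar>\<^sup>2 \<le> \<rho>\<^sup>2" by (rule power_mono) simp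
      qed
    qed simp
    also have "\<dots> = 2 * l * \<rho>\<^sup>2"
      using LINT_Ioo[where f="\<lambda>x. \<rho>\<^sup>2" and a="-l" and b=l] assms(1) by simp
    finally show "\<exists>c\<in>?I. fd j c \<le> \<rho> \<and> gd j c \<le> 2 * l * \<rho>\<^sup>2" using 1 c'(1) by blast
  qed
  text \<open>Choosing \<open>c j\<close> nearly optimal replaces a diagonal argument over \<open>\<rho>\<close>.\<close>
  define e where "e j c = max (fd j c) (gd j c)" for j c
  have e0: "0 \<le> fd j c" "0 \<le> gd j c" for j c by (auto simp: fd_def gd_def)
  have "\<exists>c\<in>?I. \<forall>c'\<in>?I. e j c \<le> e j c' + 1 / (real j + 1)" for j
  proof -
    have ne: "e j ` ?I \<noteq> {}" using assms(1) by auto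
    have "Inf (e j ` ?I) < Inf (e j ` ?I) + 1 / (real j + 1)" by simp
    from cInf_lessD[OF ne this] obtain c where c: "c \<in> ?I" "e j c < Inf (e j ` ?I) + 1 / (real j + 1)" by auto
    have "bdd_below (e j ` ?I)" using e0 by (intro bdd_belowI[of _ 0]) (auto simp: e_def le_max_iff_disj)
    then have "Inf (e j ` ?I) \<le> e j c'" if "c' \<in> ?I" for c' using that by (intro cInf_lower) auto
    then show ?thesis using c by (intro bexI[of _ c] ballI) (fastforce intro: order_trans[OF less_imp_le])+
  qed
  then obtain c where c: "\<And>j. c j \<in> ?I" "\<And>j c'. c' \<in> ?I \<Longrightarrow> e j (c j) \<le> e j c' + 1 / (real j + 1)" by metis
  have "(\<lambda>j. e j (c j)) \<longlonglongrightarrow> 0"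
  proof (rule tendsto_zeroI)
    fix r :: real assume r: "r > 0"
    define \<rho> where "\<rho> = min (r / 2) (min 1 (r / (4 * l)))"
    have \<rho>: "\<rho> > 0" "\<rho> \<le> r / 2" "\<rho> \<le> 1" "\<rho> \<le> r / (4 * l)" using r assms(1) by (auto simp: \<rho>_def)
    have "2 * l * \<rho>\<^sup>2 \<le> 2 * l * \<rho>" using \<rho> assms(1) by (simp add: power2_eq_square mult_left_le)
    also have "\<dots> \<le> r / 2" using \<rho>(4) assms(1) by (simp add: field_simps)
    finally have \<rho>2: "2 * l * \<rho>\<^sup>2 \<le> r / 2" .
    have "(\<lambda>j. 1 / (real j + 1)) \<longlonglongrightarrow> 0" using LIMSEQ_inverse_real_of_nat by (simp add: inverse_eq_divide add.commute)
    then have "\<forall>\<^sub>F j in sequentially. 1 / (real j + 1) < r / 2" by (rule order_tendstoD) (use r in simp)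
    with evc[OF \<rho>(1)] show "\<forall>\<^sub>F j in sequentially. \<bar>e j (c j)\<bar> \<le> r"
    proof eventually_elim
      fix j assume "\<exists>c\<in>?I. fd j c \<le> \<rho> \<and> gd j c \<le> 2 * l * \<rho>\<^sup>2" and j: "1 / (real j + 1) < r / 2"
      then obtain c' where c': "c' \<in> ?I" "fd j c' \<le> \<rho>" "gd j c' \<le> 2 * l * \<rho>\<^sup>2" by blast
      have "e j c' \<le> r / 2" using c' \<rho>(2) \<rho>2 by (simp add: e_def)
      then have "e j (c j) \<le> r" using c(2)[OF c'(1), of j] j by linarith
      moreover have "0 \<le> e j (c j)" using e0 by (simp add: e_def le_max_iff_disj)
      ultimately show "\<bar>e j (c j)\<bar> \<le> r" by simp
    qed
  qed
  then have lim: "(\<lambda>j. fd j (c j)) \<longlonglongrightarrow> 0" "(\<lambda>j. gd j (c j)) \<longlonglongrightarrow> 0"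
    using e0 by (auto intro: tendsto_sandwich[of "\<lambda>_. 0" _ _ "\<lambda>j. e j (c j)"] simp: e_def)
  have a': "a j \<in> {-1, 1}" for j using a[of j] by auto
  have T1: "tendsto_Lp 1 ?I (\<lambda>j x. a j * periodic_ext l (f j) (x + c j))
      (\<lambda>x. \<beta> * indicator {-l/2<..<l/2} x - \<beta> * (1 - indicator {-l/2<..<l/2} x))"
  proof (rule tendsto_Lp_translate[OF assms(1) c(1) a' f1])
    show "h \<in> borel_measurable borel" unfolding h_def[abs_def] using sq_borel by measurable
    show "\<bar>h x\<bar> \<le> \<beta>" for x using sq_bound[of l x] \<beta>_pos by (simp add: h_def abs_mult)
    show "h (x + 2 * l) = h x" for x using sq_periodic[OF assms(1)] by (simp add: h_def)
    have "AE x in lebesgue_on ?I. \<bar>x\<bar> \<noteq> l / 2" using AE_abs_diff_ne[where a="-l" and b=l and c=0 and r="l/2"] by simp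
    then show "AE x in lebesgue_on ?I. \<beta> * indicator {-l/2<..<l/2} x - \<beta> * (1 - indicator {-l/2<..<l/2} x) = h x"
    proof (rule lebesgue_on_mono)
      fix x assume x: "\<bar>x\<bar> \<noteq> l / 2" "x \<in> ?I"
      have "sq l x = (if \<bar>x\<bar> < l / 2 then 1 else -1)" by (rule sq_eq[OF assms(1) _ x(1)]) (use x(2) in auto)
      then show "\<beta> * indicator {-l/2<..<l/2} x - \<beta> * (1 - indicator {-l/2<..<l/2} x) = h x"
        by (auto simp: h_def indicator_def abs_if)
    qed
    show "(\<lambda>j. LINT x|lebesgue_on ?I. \<bar>f j x - a j * h (x - c j)\<bar> ^ 1) \<longlonglongrightarrow> 0" using lim(1) by (simp add: fd_def)
  qed simp
  have T2: "tendsto_Lp 2 ?I (\<lambda>j x. a j * periodic_ext l (g j) (x + c j)) k"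
  proof (rule tendsto_Lp_translate[OF assms(1) c(1) a' g2])
    show "k \<in> borel_measurable borel" unfolding k_def[abs_def]
      by (intro borel_measurable_continuous_onI continuous_intros tri_continuous[OF assms(1)])
    show "\<bar>k x\<bar> \<le> l + \<bar>m\<bar>" for x
    proof -
      have "\<bar>sin \<beta> * tri l x\<bar> \<le> 1 * l" unfolding abs_mult using tri_bound[OF assms(1), of x] by (intro mult_mono) auto
      then show ?thesis unfolding k_def by (simp add: abs_if split: if_splits)
    qed
    show "k (x + 2 * l) = k x" for x using tri_periodic[OF assms(1)] by (simp add: k_def)
    show "(\<lambda>j. LINT x|lebesgue_on ?I. \<bar>g j x - a j * k (x - c j)\<bar>\<^sup>2) \<longlonglongrightarrow> 0" using lim(2) by (simp add: gd_def)
  qed simp_all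
  have "G_C0 \<sigma> D2 a0 \<beta> l (\<lambda>x. \<beta> * indicator {-l/2<..<l/2} x - \<beta> * (1 - indicator {-l/2<..<l/2} x), k) = ereal (2 * P \<beta>)"
    unfolding k_def[abs_def] by (rule G_C0_step[OF assms(1)])
  then show ?thesis
    unfolding converges_to_profile_def Let_def using a' c(1) T1 T2 by blast
qed

end

subsection \<open>Convergence of minimizers\<close>

context wells
begin

lemma Y_C_in_Lp:
  assumes "l > 0" "(\<theta>, g) \<in> Y_C l"
  shows "in_Lp 2 {-l<..<l} \<theta>" "in_Lp 1 {-l<..<l} \<theta>" "in_Lp 2 {-l<..<l} g"
proof -
  show 1: "in_Lp 2 {-l<..<l} \<theta>" and "in_Lp 2 {-l<..<l} g"
    using assms(2) by (auto simp: Y_C_def Let_def in_W22_def in_W12_def)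
  have "\<theta> absolutely_integrable_on {-l<..<l}"
    using in_L2D(1)[OF 1] by (simp add: absolutely_integrable_on_Icc_iff_Ioo)
  then show "in_Lp 1 {-l<..<l} \<theta>" by (simp add: in_Lp_def absolutely_integrable_measurable_real)
qed

lemma in_L2_diff_const:
  assumes "in_Lp 2 {-l<..<l} g"
  shows "in_Lp 2 {-l<..<l} (\<lambda>x. g x - m)"
proof -
  have "(\<lambda>x. (g x)\<^sup>2 - 2 * m * g x + m\<^sup>2) absolutely_integrable_on {-l<..<l}"
    using in_L2D[OF assms]
    by (intro set_integral_add(1) set_integral_diff(1) set_integrable_mult_right)
      (auto simp: absolutely_integrable_on_Icc_iff_Ioo lmeasurable_interval[of "-l" l, unfolded box_real])
  moreover have "(\<lambda>x. (g x)\<^sup>2 - 2 * m * g x + m\<^sup>2) = (\<lambda>x. \<bar>g x - m\<bar>\<^sup>2)"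
    by (auto simp: power2_diff algebra_simps)
  ultimately show ?thesis using in_L2D(3)[OF assms] by (auto simp: in_Lp_def integrable_lebesgue_on_iff)
qed

text \<open>The tolerance 1 is below \<open>pi\<close>, so the rounding error stays below 1/2. In
  the second part \<open>pi + 1 < 2 * pi\<close> leaves no room for a nonzero
  \<open>k\<close>.\<close>

lemma round_near_int:
  fixes k :: int
  assumes "\<bar>x - 2 * pi * of_int k\<bar> \<le> 1"
  shows "round (x / (2 * pi)) = k" "\<bar>x\<bar> \<le> pi \<Longrightarrow> k = 0"
proof -
  have "x / (2 * pi) - of_int k = (x - 2 * pi * of_int k) / (2 * pi)" by (simp add: diff_divide_distrib)
  then have "\<bar>x / (2 * pi) - of_int k\<bar> = \<bar>x - 2 * pi * of_int k\<bar> / (2 * pi)" by (simp add: abs_divide)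
  also have "\<dots> \<le> 1 / (2 * pi)" using assms by (intro divide_right_mono) auto
  also have "\<dots> < 1 / 2" using pi_gt3 by (simp add: field_simps)
  finally show "round (x / (2 * pi)) = k" by (intro round_unique') (simp add: abs_minus_commute)
  assume "\<bar>x\<bar> \<le> pi"
  then have "\<bar>2 * pi * of_int k\<bar> \<le> pi + 1" using assms by linarith
  then have "2 * pi * \<bar>of_int k\<bar> \<le> pi + 1" by (simp add: abs_mult)
  also have "\<dots> < 2 * pi * 1" using pi_gt3 by simp
  finally have "\<bar>of_int k :: real\<bar> < 1" by (simp only: mult_less_cancel_left_pos pi_gt_zero mult_pos_pos zero_less_numeral)
  then show "k = 0" by linarith
qed

text \<open>One statement for normalized and unnormalized minimizers: \<open>n j\<close> is the
  period removed from \<open>\<theta> j\<close>, \<open>b j\<close> the constant removed from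
  \<open>g j\<close>, and \<open>a j\<close> an arbitrary sign. What remains of the mean of
  \<open>g j\<close> must be asymptotically \<open>a j * m\<close>, since the reflection also acts
  on constants.\<close>

lemma minimizers_converge:
  assumes "l > 0" "D1 > 0" and eps: "\<And>j. \<epsilon> j > 0" "\<epsilon> \<longlonglongrightarrow> 0"
    and Y: "\<And>j. (\<theta> j, g j) \<in> Y_C l"
    and min: "\<And>j. is_minimizer (G_C \<sigma> D1 D2 a0 l (\<epsilon> j)) (\<theta> j, g j)"
    and a: "\<And>j. a j = 1 \<or> a j = -1"
    and f: "\<And>j x. f j x = \<theta> j x - 2 * pi * of_int (n j)"
    and n: "\<forall>\<^sub>F j in sequentially. \<forall>k::int. \<bar>mean l (\<theta> j) - 2 * pi * of_int k\<bar> \<le> 1 \<longrightarrow> n j = k"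
    and h: "\<And>j x. h j x = g j x - b j"
    and b: "(\<lambda>j. mean l (g j) - b j - a j * m) \<longlonglongrightarrow> 0"
  shows "converges_to_profile \<sigma> D2 a0 \<beta> l f h"
proof (rule converges_to_profileI[OF assms(1) a])
  let ?I = "{-l<..<l}"
  show "in_Lp 1 ?I (f j)" for j
  proof -
    have "\<theta> j absolutely_integrable_on ?I" using Y_C_in_Lp(2)[OF assms(1) Y[of j]]
      by (simp add: in_Lp_def absolutely_integrable_measurable_real)
    then have "f j absolutely_integrable_on ?I"
      unfolding f[abs_def] by (intro set_integral_diff(1)) (auto simp: lmeasurable_interval[of "-l" l, unfolded box_real])
    then show ?thesis by (simp add: in_Lp_def absolutely_integrable_measurable_real)
  qed
  show "in_Lp 2 ?I (h j)" for j
    unfolding h[abs_def] by (rule in_L2_diff_const[OF Y_C_in_Lp(3)[OF assms(1) Y]])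
  fix \<rho> :: real assume \<rho>: "\<rho> > 0"
  obtain \<delta> where \<delta>: "\<delta> > 0" and prof: "\<And>\<rho>. \<rho> > 0 \<Longrightarrow> \<exists>\<epsilon>1>0. \<forall>\<epsilon> \<theta> g. 0 < \<epsilon> \<and> \<epsilon> < \<epsilon>1 \<and> (\<theta>, g) \<in> Y_C l \<and>
      F_C \<sigma> D1 D2 a0 l \<epsilon> \<theta> g \<le> 2 * P \<beta> + \<delta> \<longrightarrow>
      (\<exists>k::int. near_step \<beta> l \<rho> (\<lambda>x. \<theta> x - 2 * pi * of_int k) (\<lambda>x. g x - mean l g) \<and>
        \<bar>mean l \<theta> - 2 * pi * of_int k\<bar> \<le> \<rho>)"
    using low_energy_profile[OF assms(1,2)] by blast
  \<comment> \<open>The bound 1 makes the period \<open>k\<close> of the step satisfy the premise in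
    the assumption on \<open>n j\<close>, which identifies the two. The other half of
    \<open>\<rho>\<close> is left for the deviation of the means of \<open>g j\<close>.\<close>
  define \<rho>' where "\<rho>' = min 1 (\<rho> / 2)"
  have \<rho>': "\<rho>' > 0" "\<rho>' \<le> 1" "\<rho>' \<le> \<rho> / 2" using \<rho> by (auto simp: \<rho>'_def)
  obtain \<epsilon>1 where \<epsilon>1: "\<epsilon>1 > 0" "\<And>\<epsilon> \<theta> g. 0 < \<epsilon> \<and> \<epsilon> < \<epsilon>1 \<and> (\<theta>, g) \<in> Y_C l \<and>
      F_C \<sigma> D1 D2 a0 l \<epsilon> \<theta> g \<le> 2 * P \<beta> + \<delta> \<Longrightarrow>
      (\<exists>k::int. near_step \<beta> l \<rho>' (\<lambda>x. \<theta> x - 2 * pi * of_int k) (\<lambda>x. g x - mean l g) \<and>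
        \<bar>mean l \<theta> - 2 * pi * of_int k\<bar> \<le> \<rho>')"
    using prof[OF \<rho>'(1)] by blast
  obtain \<epsilon>0 where \<epsilon>0: "\<epsilon>0 > 0" "\<And>\<epsilon>. 0 < \<epsilon> \<Longrightarrow> \<epsilon> < \<epsilon>0 \<Longrightarrow>
    \<exists>\<theta> g. (\<theta>, g) \<in> Y_C l \<and> F_C \<sigma> D1 D2 a0 l \<epsilon> \<theta> g \<le> 2 * P \<beta> + \<delta>"
    using recovery_sequence[OF assms(1,2) \<delta>] by blast
  have "\<forall>\<^sub>F j in sequentially. \<epsilon> j < min \<epsilon>0 \<epsilon>1"
    by (rule order_tendstoD[OF eps(2)]) (use \<epsilon>0 \<epsilon>1 in simp)
  moreover have "\<forall>\<^sub>F j in sequentially. \<bar>mean l (g j) - b j - a j * m\<bar> < \<rho> / 2"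
    using tendstoD[OF b, of "\<rho> / 2"] \<rho> by simp
  ultimately show "\<forall>\<^sub>F j in sequentially. near_step \<beta> l \<rho> (f j) (\<lambda>x. h j x - a j * m)"
    using n
  proof eventually_elim
    fix j assume \<epsilon>: "\<epsilon> j < min \<epsilon>0 \<epsilon>1" and bj: "\<bar>mean l (g j) - b j - a j * m\<bar> < \<rho> / 2"
      and nj: "\<forall>k::int. \<bar>mean l (\<theta> j) - 2 * pi * of_int k\<bar> \<le> 1 \<longrightarrow> n j = k"
    obtain \<theta>' g' where c: "(\<theta>', g') \<in> Y_C l" "F_C \<sigma> D1 D2 a0 l (\<epsilon> j) \<theta>' g' \<le> 2 * P \<beta> + \<delta>"
      using \<epsilon>0(2)[OF eps(1), of j] \<epsilon> by auto
    have "G_C \<sigma> D1 D2 a0 l (\<epsilon> j) (\<theta> j, g j) \<le> G_C \<sigma> D1 D2 a0 l (\<epsilon> j) (\<theta>', g')"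
      using min[of j] unfolding is_minimizer_def by blast
    then have "F_C \<sigma> D1 D2 a0 l (\<epsilon> j) (\<theta> j) (g j) \<le> 2 * P \<beta> + \<delta>"
      using c Y[of j] by (simp add: G_C_def)
    then obtain k :: int where k: "near_step \<beta> l \<rho>' (\<lambda>x. \<theta> j x - 2 * pi * of_int k) (\<lambda>x. g j x - mean l (g j))"
      and 3: "\<bar>mean l (\<theta> j) - 2 * pi * of_int k\<bar> \<le> \<rho>'"
      using \<epsilon>1(2)[of "\<epsilon> j" "\<theta> j" "g j"] eps(1)[of j] \<epsilon> Y[of j] by auto
    obtain s c where s: "s = 1 \<or> s = -1" "c \<in> {-l/2..l/2}" "c \<noteq> 0"
      and 1: "(LINT x|lebesgue_on ?I. \<bar>\<theta> j x - 2 * pi * of_int k - s * prof \<beta> l (x - c)\<bar>) \<le> \<rho>'"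
      and 2: "AE x in lebesgue_on ?I. \<bar>g j x - mean l (g j) - s * (- sin \<beta> * tri l (x - c))\<bar> \<le> \<rho>'"
      using k unfolding near_step_def by blast
    have nk: "n j = k" using nj 3 \<rho>'(2) by force
    have "(LINT x|lebesgue_on ?I. \<bar>f j x - s * prof \<beta> l (x - c)\<bar>) \<le> \<rho>"
      using 1 \<rho>' \<rho> by (simp add: f nk)
    moreover have "AE x in lebesgue_on ?I. \<bar>h j x - a j * m - s * (- sin \<beta> * tri l (x - c))\<bar> \<le> \<rho>"
    proof (rule lebesgue_on_mono[OF 2])
      fix x assume "\<bar>g j x - mean l (g j) - s * (- sin \<beta> * tri l (x - c))\<bar> \<le> \<rho>'"
      then show "\<bar>h j x - a j * m - s * (- sin \<beta> * tri l (x - c))\<bar> \<le> \<rho>"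
        using bj \<rho>'(3) unfolding h by linarith
    qed
    ultimately show "near_step \<beta> l \<rho> (f j) (\<lambda>x. h j x - a j * m)"
      unfolding near_step_def using s by blast
  qed
qed

end

theorem theorem3p1:
  fixes \<sigma> D1 D2 l a0 \<beta> :: real
    and \<epsilon> :: "nat \<Rightarrow> real"
    and \<theta> g :: "nat \<Rightarrow> real \<Rightarrow> real"
  assumes "\<sigma> > 0" and "D1 > 0" and "D2 > 0" and "l > 0"
    and min_W: "\<forall>t. W \<sigma> D2 a0 t \<ge> 0" "\<exists>t. W \<sigma> D2 a0 t = 0"
    and beta: "0 < \<beta>" "\<beta> < pi / 2" "{t \<in> {-pi..pi}. W \<sigma> D2 a0 t = 0} = {-\<beta>, \<beta>}"
    and eps: "\<forall>j. \<epsilon> j > 0" "\<epsilon> \<longlonglongrightarrow> 0"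
    and minimizers: "\<forall>j. (\<theta> j, g j) \<in> Y_C l"
      "\<forall>j. is_minimizer (G_C \<sigma> D1 D2 a0 l (\<epsilon> j)) (\<theta> j, g j)"
  shows "converges_to_profile \<sigma> D2 a0 \<beta> l (\<lambda>j. angle_rep l (\<theta> j)) (\<lambda>j. mean_zero_rep l (g j)) \<and>
    ((\<forall>\<^sub>F j in sequentially. \<bar>mean l (\<theta> j)\<bar> \<le> pi) \<and> convergent (\<lambda>j. \<bar>mean l (g j)\<bar>) \<longrightarrow>
      converges_to_profile \<sigma> D2 a0 \<beta> l \<theta> g)"
proof -
  interpret wells \<sigma> D2 a0 \<beta>
    by unfold_locales (use assms in auto)
  note mc = minimizers_converge[OF \<open>l > 0\<close> \<open>D1 > 0\<close> _ eps(2), of \<theta> g]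
  have 1: "converges_to_profile \<sigma> D2 a0 \<beta> l (\<lambda>j. angle_rep l (\<theta> j)) (\<lambda>j. mean_zero_rep l (g j))"
    by (rule mc[where a="\<lambda>_. 1" and n="\<lambda>j. round (mean l (\<theta> j) / (2 * pi))" and b="\<lambda>j. mean l (g j)" and m=0])
      (use eps minimizers round_near_int(1) in \<open>auto simp: angle_rep_def mean_zero_rep_def\<close>)
  have 2: "converges_to_profile \<sigma> D2 a0 \<beta> l \<theta> g"
    if pi: "\<forall>\<^sub>F j in sequentially. \<bar>mean l (\<theta> j)\<bar> \<le> pi" and conv: "convergent (\<lambda>j. \<bar>mean l (g j)\<bar>)"
  proof -
    obtain m where m: "(\<lambda>j. \<bar>mean l (g j)\<bar>) \<longlonglongrightarrow> m" using conv convergent_def by blast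
    \<comment> \<open>The sign is used up on the mean of \<open>g j\<close>, so that
      \<open>a j\<close> times this mean is its absolute value and converges to \<open>m\<close>.
      The sign of the step in \<open>\<theta> j\<close> is then adjusted by a half-period
      translation.\<close>
    define a :: "nat \<Rightarrow> real" where "a j = (if mean l (g j) \<ge> 0 then 1 else -1)" for j
    have "(\<lambda>j. a j * (\<bar>mean l (g j)\<bar> - m)) \<longlonglongrightarrow> 0"
    proof (rule Lim_null_comparison)
      show "\<forall>\<^sub>F j in sequentially. norm (a j * (\<bar>mean l (g j)\<bar> - m)) \<le> \<bar>\<bar>mean l (g j)\<bar> - m\<bar>"
        by (intro always_eventually allI) (simp add: a_def abs_mult)
      show "(\<lambda>j. \<bar>\<bar>mean l (g j)\<bar> - m\<bar>) \<longlonglongrightarrow> 0"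
        using m by (intro tendsto_rabs_zero) (simp add: LIM_zero)
    qed
    moreover have "a j * (\<bar>mean l (g j)\<bar> - m) = mean l (g j) - 0 - a j * m" for j
      by (auto simp: a_def)
    ultimately have b: "(\<lambda>j. mean l (g j) - 0 - a j * m) \<longlonglongrightarrow> 0" by simp
    have n: "\<forall>\<^sub>F j in sequentially. \<forall>k::int. \<bar>mean l (\<theta> j) - 2 * pi * of_int k\<bar> \<le> 1 \<longrightarrow> 0 = k"
      using pi by eventually_elim (use round_near_int(2) in metis)
    show ?thesis
      by (rule mc[where a=a and n="\<lambda>_. 0" and b="\<lambda>_. 0" and m=m, OF _ _ _ _ _ n _ b])
        (use eps minimizers in \<open>auto simp: a_def\<close>)
  qed
  from 1 2 show ?thesis by blast
qed

end
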